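(* Let $m,n\ge 2$ be integers, let $p$ be a real number with $1\le p<\infty$ and $p\neq 2$, and let $\phi: M_{mn}\to M_{mn}$ be a (complex-)linear map. The following are equivalent. (a) $\|\phi(A\otimes B)\|_p = \|A\otimes B\|_p$ for all $A\in M_m$ and $B\in M_n$. (b) There are unitary matrices $U,V\in M_{mn}$, and maps $\varphi_1: M_m\to M_m$, $\varphi_2: M_n\to M_n$, where each $\varphi_s$ ($s=1,2$) is either the identity map $X\mapsto X$ or the transposition map $X\mapsto X^t$, such that $$\phi(A\otimes B)=U(\varphi_1(A)\otimes\varphi_2(B))V\quad\text{for all } A\in M_m \text{ and } B\in M_n.$$
   Context: $M_n$ denotes the set of $n\times n$ complex matrices. For $A\in M_m$, $B\in M_n$, $A\otimes B\in M_{mn}$ is the tensor (Kronecker) product. For $X\in M_N$ with singular values $s_1(X)\ge\cdots\ge s_N(X)$ and $p\ge 1$, the Schatten $p$-norm is $\|X\|_p=\left(\sum_{i=1}^N s_i(X)^p\right)^{1/p}$. $X^t$ is the transpose of $X$ (without conjugation). *)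

theory Defs
  imports
    "Jordan_Normal_Form.Schur_Decomposition"
    "Jordan_Normal_Form.VS_Connect"
    "HOL-Computational_Algebra.Fundamental_Theorem_Algebra"
begin

text \<open>
  Matrices are those of \<^theory>\<open>Jordan_Normal_Form.Matrix\<close>, with dimensions given by natural
  numbers and indices starting at \<open>0\<close>; \<open>carrier_mat n n\<close> over \<^typ>\<open>complex\<close> plays the role of the
  space \<open>M_n\<close>.
\<close>

text \<open>
  Block convention for the Kronecker product: the row index \<open>i * dim_row B + k\<close> stands for the pair
  \<open>(i, k)\<close>, and likewise for columns, so that the \<open>(i, j)\<close> block of the product is \<open>A $$ (i, j)\<close>
  times \<open>B\<close>.
\<close>

definition kronecker :: "complex mat \<Rightarrow> complex mat \<Rightarrow> complex mat" (infixl \<open>\<otimes>\<^sub>m\<close> 70) where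
  "A \<otimes>\<^sub>m B = mat (dim_row A * dim_row B) (dim_col A * dim_col B)
     (\<lambda>(i, j). A $$ (i div dim_row B, j div dim_col B) * B $$ (i mod dim_row B, j mod dim_col B))"

lemma kronecker_carrier [simp, intro]:
  "A \<in> carrier_mat a b \<Longrightarrow> B \<in> carrier_mat c d \<Longrightarrow> A \<otimes>\<^sub>m B \<in> carrier_mat (a * c) (b * d)"
  by (auto simp: kronecker_def)

lemma kronecker_index:
  assumes "A \<in> carrier_mat a b" "B \<in> carrier_mat c d" "i < a" "j < b" "k < c" "l < d"
  shows "(A \<otimes>\<^sub>m B) $$ (i * c + k, j * d + l) = A $$ (i, j) * B $$ (k, l)"
proof -
  have bound: "x * q + y < p * q" if "x < p" "y < q" for x y p q :: nat
  proof -
    have "x * q + y < Suc x * q" using that by simp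
    also have "\<dots> \<le> p * q" using that by (intro mult_le_mono1) simp
    finally show ?thesis .
  qed
  show ?thesis using assms bound[of i a k c] bound[of j b l d]
    by (auto simp: kronecker_def)
qed

text \<open>
  The singular values of \<open>X\<close> are the square roots of the eigenvalues of \<open>X\<^sup>* X\<close>, listed in decreasing
  order with algebraic multiplicity. These eigenvalues are nonnegative reals, so taking \<^const>\<open>Re\<close>
  only changes their type.
\<close>

definition singular_values :: "complex mat \<Rightarrow> real list" where
  "singular_values X = rev (sorted_list_of_multiset
     (image_mset (\<lambda>z. sqrt (Re z)) (proots (char_poly (mat_adjoint X * X)))))"

lemma length_singular_values:
  assumes "X \<in> carrier_mat k l"
  shows "length (singular_values X) = l"
proof -
  have c: "mat_adjoint X * X \<in> carrier_mat l l"
    using assms by (auto simp: mat_adjoint_def)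
  have "length (singular_values X) = size (proots (char_poly (mat_adjoint X * X)))"
    by (metis (no_types) length_rev mset_sorted_list_of_multiset singular_values_def size_image_mset size_mset)
  also have "\<dots> = l"
    using degree_monic_char_poly[OF c] by (simp add: size_proots_complex)
  finally show ?thesis .
qed

definition schatten_norm :: "real \<Rightarrow> complex mat \<Rightarrow> real" where
  "schatten_norm p X = (\<Sum>s\<leftarrow>singular_values X. s powr p) powr (1 / p)"

definition unitary_mat :: "nat \<Rightarrow> complex mat \<Rightarrow> bool" where
  "unitary_mat N U \<longleftrightarrow> U \<in> carrier_mat N N \<and>
     mat_adjoint U * U = 1\<^sub>m N \<and> U * mat_adjoint U = 1\<^sub>m N"

abbreviation linear_map_mat :: "nat \<Rightarrow> (complex mat \<Rightarrow> complex mat) \<Rightarrow> bool" where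
  "linear_map_mat N \<equiv>
     linear_map class_ring (module_mat TYPE(complex) N N) (module_mat TYPE(complex) N N)"

lemma linear_map_mat_iff:
  "linear_map_mat N \<phi> \<longleftrightarrow>
     (\<forall>X \<in> carrier_mat N N. \<phi> X \<in> carrier_mat N N) \<and>
     (\<forall>X \<in> carrier_mat N N. \<forall>Y \<in> carrier_mat N N. \<phi> (X + Y) = \<phi> X + \<phi> Y) \<and>
     (\<forall>c. \<forall>X \<in> carrier_mat N N. \<phi> (c \<cdot>\<^sub>m X) = c \<cdot>\<^sub>m \<phi> X)"
  using matrix_vs[where 'a = complex, of N N]
  by (auto simp: linear_map_def mod_hom_def mod_hom_axioms_def LinearCombinations.module_hom_def
      vectorspace_def matrix_vs_simps)

end

theory Submission
  imports Defs
begin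

text \<open>
  Write \<open>X \<bottom> Y\<close> for \<open>X\<^sup>* Y = 0 = X Y\<^sup>*\<close>. For \<open>p \<noteq> 2\<close>, \<open>X \<bottom> Y\<close> holds if and only if
  \<open>\<parallel>X + Y\<parallel>\<^sub>p\<close> and \<open>\<parallel>X - Y\<parallel>\<^sub>p\<close> both have \<open>p\<close>-th power \<open>\<parallel>X\<parallel>\<^sub>p\<^sup>p + \<parallel>Y\<parallel>\<^sub>p\<^sup>p\<close>: the trace of \<open>x\<^sup>p\<^sup>/\<^sup>2\<close>
  is strictly concave or strictly convex, so equality in Clarkson's inequality forces
  \<open>(X\<^sup>* X) (Y\<^sup>* Y) = 0\<close>. Hence \<open>A \<bottom> C\<close> implies \<open>\<phi> (A \<otimes> B) \<bottom> \<phi> (C \<otimes> D)\<close>, and likewise in the second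
  factor. The \<open>m n\<close> matrices \<open>\<phi> (E\<^sub>i\<^sub>i \<otimes> E\<^sub>j\<^sub>j)\<close> are then pairwise orthogonal, so of rank one, and
  unitaries move them to \<open>E\<^sub>i\<^sub>i \<otimes> E\<^sub>j\<^sub>j\<close>. After that the orthogonality relations among the matrix units
  leave for each \<open>\<phi> (E\<^sub>i\<^sub>k \<otimes> E\<^sub>j\<^sub>l)\<close> only a unimodular multiple of a matrix unit; partial transposes
  fix which one, and the unimodular factors are a coboundary, that is, a diagonal conjugation.
\<close>

section \<open>Adjoints, unitary matrices and the spectral theorem\<close>

text \<open>No functional calculus is applied to matrices. A trace of powers is written in
  eigenbases, where the transition unitary has squared moduli with row and column sums one, and what
  remains is the tangent line of a scalar power. The sign of \<open>1 - p / 2\<close> multiplies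
  every inequality, so the concave range \<open>p < 2\<close> and the convex range
  \<open>p > 2\<close> are one argument; at \<open>p = 2\<close> the sign is zero and nothing
  survives. The norm hypothesis is available on product matrices only, and a sum of two products is
  again a product when a factor is shared; orthogonality is therefore transported one factor at a
  time. On matrix units it is used through the entries of \<open>adj (h A) * h' B\<close> and
  \<open>h A * adj (h' B)\<close>: each entry is an additive form vanishing on orthogonal pairs, and
  such a form satisfies four linear relations on units. The last obstacle is uniformity. Each
  partial map decides between identity and transposition on each pair of indices. Triangles make the
  decision uniform within one partial map; computing one entry along its row and along its column
  makes it independent of the index fixed in the other factor.\<close>

abbreviation adj :: "complex mat \<Rightarrow> complex mat" where
  "adj \<equiv> mat_adjoint"

lemma dim_adj [simp]: "dim_row (adj A) = dim_col A" "dim_col (adj A) = dim_row A"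
  by (auto simp: mat_adjoint_def)

lemma adj_carrier [simp, intro]: "A \<in> carrier_mat a b \<Longrightarrow> adj A \<in> carrier_mat b a"
  by (intro carrier_matI) auto

lemma adj_index [simp]:
  "i < dim_col A \<Longrightarrow> j < dim_row A \<Longrightarrow> adj A $$ (i, j) = cnj (A $$ (j, i))"
  by (auto simp: mat_adjoint_def mat_of_rows_def)

lemma adj_adj [simp]: "adj (adj A) = A"
  by (intro eq_matI) auto

lemma adj_zero [simp]: "adj (0\<^sub>m a b) = 0\<^sub>m b a"
  by (intro eq_matI) auto

lemma adj_one [simp]: "adj (1\<^sub>m a) = 1\<^sub>m a"
  by (intro eq_matI) auto

lemma adj_add: "A \<in> carrier_mat a b \<Longrightarrow> B \<in> carrier_mat a b \<Longrightarrow> adj (A + B) = adj A + adj B"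
  by (intro eq_matI) auto

lemma mult_index:
  assumes "A \<in> carrier_mat a b" "B \<in> carrier_mat b c" "i < a" "j < c"
  shows "(A * B) $$ (i, j) = (\<Sum>k<b. A $$ (i, k) * B $$ (k, j))"
  using assms by (auto simp: scalar_prod_def atLeast0LessThan intro!: sum.cong)

lemma square_mult_carrier:
  "A \<in> carrier_mat n n \<Longrightarrow> B \<in> carrier_mat n n \<Longrightarrow> A * B \<in> carrier_mat n n"
  by auto

text \<open>A single size keeps the carrier side conditions closed: once \<open>n\<close> is
  instantiated, the simplifier can reassociate products of any length.\<close>

lemma square_mult_assoc:
  assumes "A \<in> carrier_mat n n" "B \<in> carrier_mat n n" "C \<in> carrier_mat n n"
  shows "A * B * C = A * (B * C)"
  using assms by (rule assoc_mult_mat)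

lemmas square_simps = square_mult_carrier square_mult_assoc

declare index_mult_mat(1) [simp del]

lemma adj_mult:
  assumes "A \<in> carrier_mat a b" "B \<in> carrier_mat b c"
  shows "adj (A * B) = adj B * adj A"
proof (intro eq_matI)
  fix i j assume "i < dim_row (adj B * adj A)" "j < dim_col (adj B * adj A)"
  hence ij: "i < c" "j < a" using assms by auto
  have "adj (A * B) $$ (i, j) = cnj ((A * B) $$ (j, i))" using assms ij by auto
  also have "\<dots> = (\<Sum>k<b. adj B $$ (i, k) * adj A $$ (k, j))"
    using assms ij by (subst mult_index[OF assms]) (auto simp: mult.commute intro!: sum.cong)
  also have "\<dots> = (adj B * adj A) $$ (i, j)"
    using assms ij by (subst mult_index[of _ c b _ a]) auto
  finally show "adj (A * B) $$ (i, j) = (adj B * adj A) $$ (i, j)" .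
qed (use assms in auto)

text \<open>A one-sided inverse of a square matrix is two-sided.\<close>

lemma unitary_matI:
  assumes "U \<in> carrier_mat N N" "adj U * U = 1\<^sub>m N"
  shows "unitary_mat N U"
  using assms mat_mult_left_right_inverse[of "adj U" N U] by (auto simp: unitary_mat_def)

lemma unitary_matD:
  assumes "unitary_mat N U"
  shows "U \<in> carrier_mat N N" "adj U * U = 1\<^sub>m N" "U * adj U = 1\<^sub>m N"
  using assms by (auto simp: unitary_mat_def)

lemma unitary_adj [simp, intro]: "unitary_mat N U \<Longrightarrow> unitary_mat N (adj U)"
  by (auto simp: unitary_mat_def)

lemma unitary_mult [intro]:
  assumes "unitary_mat N U" "unitary_mat N V"
  shows "unitary_mat N (U * V)"
proof (rule unitary_matI)
  note U = unitary_matD[OF assms(1)] and V = unitary_matD[OF assms(2)]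
  show "U * V \<in> carrier_mat N N" using U(1) V(1) by (rule square_mult_carrier)
  have "adj (U * V) * (U * V) = adj V * (adj U * U) * V"
    using U(1) V(1) by (simp add: adj_mult[where a = N and b = N and c = N] square_simps[where n = N])
  thus "adj (U * V) * (U * V) = 1\<^sub>m N"
    unfolding U(2) using V(1) by (simp add: V(2))
qed

lemma unitary_conj_inverse:
  assumes "unitary_mat N U" "unitary_mat N V" "X \<in> carrier_mat N N"
  shows "U * (adj U * X * V) * adj V = X" "adj U * (U * X * adj V) * V = X"
proof -
  note U = unitary_matD[OF assms(1)] and V = unitary_matD[OF assms(2)]
  have "U * (adj U * X * V) * adj V = (U * adj U) * X * (V * adj V)"
    using U(1) V(1) assms(3) by (simp add: square_simps[where n = N])
  thus "U * (adj U * X * V) * adj V = X"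
    unfolding U(3) V(3) using assms(3) by simp
  have "adj U * (U * X * adj V) * V = (adj U * U) * X * (adj V * V)"
    using U(1) V(1) assms(3) by (simp add: square_simps[where n = N])
  thus "adj U * (U * X * adj V) * V = X"
    unfolding U(2) V(2) using assms(3) by simp
qed

lemma unitary_similar:
  assumes "unitary_mat N U" "X \<in> carrier_mat N N"
  shows "similar_mat (adj U * X * U) X"
  by (rule similar_matI[of _ _ "adj U" U N])
    (use unitary_matD[OF assms(1)] assms(2) in \<open>auto intro!: square_mult_carrier\<close>)

section \<open>Diagonal matrices\<close>

definition dmat :: "nat \<Rightarrow> (nat \<Rightarrow> complex) \<Rightarrow> complex mat" where
  "dmat N d = mat N N (\<lambda>(i, j). if i = j then d i else 0)"

lemma dmat_carrier [simp, intro]: "dmat N d \<in> carrier_mat N N"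
  by (simp add: dmat_def)

lemma dim_dmat [simp]: "dim_row (dmat N d) = N" "dim_col (dmat N d) = N"
  by (simp_all add: dmat_def)

lemma dmat_index [simp]:
  "i < N \<Longrightarrow> j < N \<Longrightarrow> dmat N d $$ (i, j) = (if i = j then d i else 0)"
  by (simp add: dmat_def)

lemma dmat_cong: "(\<And>i. i < N \<Longrightarrow> d i = e i) \<Longrightarrow> dmat N d = dmat N e"
  by (intro eq_matI) auto

lemma dmat_mult_index:
  assumes "X \<in> carrier_mat N N" "i < N" "j < N"
  shows "(dmat N d * X) $$ (i, j) = d i * X $$ (i, j)"
    and "(X * dmat N d) $$ (i, j) = X $$ (i, j) * d j"
  using assms by (auto simp: mult_index[of _ N N _ N] if_distribR if_distrib[of "\<lambda>x. x * _"] if_distrib[of "\<lambda>x. _ * x"] cong: if_cong)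

lemma unitary_dmat:
  assumes "\<And>i. i < N \<Longrightarrow> cmod (d i) = 1"
  shows "unitary_mat N (dmat N d)"
proof (rule unitary_matI)
  show "adj (dmat N d) * dmat N d = 1\<^sub>m N"
  proof (intro eq_matI)
    fix i j assume ij: "i < dim_row (1\<^sub>m N)" "j < dim_col (1\<^sub>m N)"
    have "cnj (d j) * d j = 1" using assms[of j] ij
      by (metis complex_norm_square index_one_mat(3) mult.commute of_real_1 one_power2)
    thus "(adj (dmat N d) * dmat N d) $$ (i, j) = 1\<^sub>m N $$ (i, j)"
      using ij by (subst dmat_mult_index(2)) auto
  qed auto
qed auto

lemma char_poly_dmat: "char_poly (dmat N d) = (\<Prod>i\<leftarrow>[0..<N]. [:- d i, 1:])"
proof -
  have "char_poly (dmat N d) = (\<Prod>a\<leftarrow>diag_mat (dmat N d). [:- a, 1:])"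
    by (rule char_poly_upper_triangular[of _ N]) (auto simp: upper_triangular_def)
  also have "diag_mat (dmat N d) = map d [0..<N]"
    by (auto simp: diag_mat_def)
  finally show ?thesis by (simp add: comp_def)
qed

section \<open>Unitary diagonalization of Hermitian matrices\<close>

lemma unitary_first_col:
  assumes v: "v \<in> carrier_vec n" and v0: "v \<noteq> 0\<^sub>v n"
  obtains W c where "unitary_mat n W" "\<And>i. i < n \<Longrightarrow> W $$ (i, 0) = c * v $ i"
proof -
  interpret cof_vec_space n "TYPE(complex)" .
  \<comment> \<open>Gram-Schmidt leaves the first vector \<open>v\<close> alone and yields
    orthogonal, not normalized, vectors; \<open>s\<close> below supplies the lengths.\<close>
  define ws where "ws = gram_schmidt n (basis_completion v)"
  note b = basis_completion[OF v v0]
  note ws = gram_schmidt_result[OF b(2) b(4) b(5) refl, folded ws_def]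
  have len: "length ws = n" using ws b by simp
  have n: "n > 0" using v v0 by (cases n) auto
  then obtain vs where "basis_completion v = v # vs" using b(6,7) by (cases "basis_completion v") auto
  hence hd: "ws ! 0 = v"
    using gram_schmidt_hd[OF v, of vs] len n unfolding ws_def by (metis hd_conv_nth length_0_conv not_gr_zero)
  define s where "s j = complex_of_real (1 / sqrt (Re (ws ! j \<bullet>c ws ! j)))" for j
  define W where "W = mat n n (\<lambda>(i, j). s j * ws ! j $ i)"
  have W: "W \<in> carrier_mat n n" by (simp add: W_def)
  have orth: "(ws ! i \<bullet>c ws ! j = 0) = (i \<noteq> j)" if "i < n" "j < n" for i j
    using corthogonalD[OF ws(2)] that len by auto
  have wsc: "ws ! i \<in> carrier_vec n" if "i < n" for i using ws(3) that len by (auto simp: set_conv_nth)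
  have "adj W * W = 1\<^sub>m n"
  proof (rule eq_matI)
    fix i j assume ij: "i < dim_row (1\<^sub>m n)" "j < dim_col (1\<^sub>m n)"
    hence ij': "i < n" "j < n" by auto
    have "(adj W * W) $$ (i, j) = (\<Sum>k<n. cnj (s i) * s j * (ws ! j $ k * cnj (ws ! i $ k)))"
      using ij' W by (subst mult_index[of _ n n _ n]) (auto simp: W_def intro!: sum.cong)
    also have "\<dots> = s i * s j * (\<Sum>k<n. ws ! j $ k * cnj (ws ! i $ k))"
      unfolding sum_distrib_left by (simp add: s_def)
    also have "\<dots> = s i * s j * (ws ! j \<bullet>c ws ! i)"
      using wsc[OF ij'(1)] wsc[OF ij'(2)] by (simp add: scalar_prod_def atLeast0LessThan)
    also have "\<dots> = (1\<^sub>m n) $$ (i, j)"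
    proof (cases "i = j")
      case True
      have "ws ! j \<bullet>c ws ! j = complex_of_real (\<Sum>k<n. (cmod (ws ! j $ k))^2)"
        using wsc[OF ij'(2)] by (simp add: scalar_prod_def atLeast0LessThan complex_norm_square[symmetric])
      then obtain x where x: "ws ! j \<bullet>c ws ! j = complex_of_real x" "x \<ge> 0"
        by (metis sum_nonneg zero_le_power2)
      moreover have "x \<noteq> 0" using orth[of j j] x ij' by auto
      ultimately show ?thesis using True ij' unfolding s_def
        by (simp flip: of_real_mult of_real_divide)
    qed (use orth[of j i] ij' in auto)
    finally show "(adj W * W) $$ (i, j) = (1\<^sub>m n) $$ (i, j)" .
  qed (use W in auto)
  hence "unitary_mat n W" using W by (rule unitary_matI[rotated])
  moreover have "W $$ (i, 0) = s 0 * v $ i" if "i < n" for i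
    using that n hd by (simp add: W_def)
  ultimately show ?thesis using that by blast
qed

lemma adj_four_block:
  assumes "A \<in> carrier_mat a a" "B \<in> carrier_mat a b" "C \<in> carrier_mat b a" "D \<in> carrier_mat b b"
  shows "adj (four_block_mat A B C D) = four_block_mat (adj A) (adj C) (adj B) (adj D)"
  using assms by (intro eq_matI) auto

text \<open>Deflation at the first listed root: once its eigenvector spans the first column of a
  unitary, the conjugated matrix is block diagonal and its other block has the remaining roots.
  Prescribing the order by \<open>es\<close> lets two Hermitian matrices with the same
  characteristic polynomial receive the same diagonal form.\<close>

theorem hermitian_diagonalization:
  assumes "P \<in> carrier_mat n n" "adj P = P" "char_poly P = (\<Prod>e\<leftarrow>es. [:- e, 1:])"
  shows "\<exists>U. unitary_mat n U \<and> P = U * dmat n (\<lambda>i. es ! i) * adj U"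
  using assms
proof (induction es arbitrary: n P)
  case Nil
  hence "n = 0" using degree_monic_char_poly[OF Nil(1)] by simp
  thus ?case using Nil by (intro exI[of _ "1\<^sub>m 0"]) (auto simp: unitary_mat_def)
next
  case (Cons e es)
  note P = Cons.prems(1)
  have "degree (char_poly P) = length (e # es)"
    unfolding Cons.prems(3) using degree_linear_factors[of uminus "e # es"] by simp
  hence n: "n = Suc (length es)" using degree_monic_char_poly[OF P] by simp
  hence n0: "0 < n" by simp
  define l where "l = length es"
  have n1: "n = 1 + l" using n by (simp add: l_def)
  have "eigenvalue P e"
    unfolding eigenvalue_root_char_poly[OF P] Cons.prems(3) by simp
  then obtain v where v: "v \<in> carrier_vec n" "v \<noteq> 0\<^sub>v n" "P *\<^sub>v v = e \<cdot>\<^sub>v v"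
    using P unfolding eigenvalue_def eigenvector_def by auto
  obtain W c where W: "unitary_mat n W" and Wc: "\<And>i. i < n \<Longrightarrow> W $$ (i, 0) = c * v $ i"
    using unitary_first_col[OF v(1,2)] by blast
  note Wd = unitary_matD[OF W]
  define A where "A = adj W * P * W"
  have A: "A \<in> carrier_mat n n" using P Wd(1) by (simp add: A_def square_simps[where n = n])
  have Aherm: "adj A = A"
    using P Wd(1) Cons.prems(2) by (simp add: A_def adj_mult[where a = n and b = n and c = n] square_simps[where n = n])
  have PW: "(P * W) $$ (i, 0) = e * W $$ (i, 0)" if "i < n" for i
  proof -
    have "(P * W) $$ (i, 0) = c * (P *\<^sub>v v) $ i"
      using P Wd(1) v(1) that n0 by (simp add: mult_index[of _ n n _ n] Wc scalar_prod_def atLeast0LessThan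
            sum_distrib_left mult.assoc mult.left_commute)
    thus ?thesis using v that by (simp add: Wc)
  qed
  have A0: "A $$ (i, 0) = (if i = 0 then e else 0)" if "i < n" for i
  proof -
    have "A = adj W * (P * W)" using P Wd(1) by (simp add: A_def square_simps[where n = n])
    hence "A $$ (i, 0) = (\<Sum>k<n. adj W $$ (i, k) * (P * W) $$ (k, 0))"
      using P Wd(1) that n0 by (simp add: mult_index[of "adj W" n n "P * W" n] square_simps[where n = n])
    also have "\<dots> = e * (\<Sum>k<n. adj W $$ (i, k) * W $$ (k, 0))"
      unfolding sum_distrib_left by (intro sum.cong) (auto simp: PW)
    also have "\<dots> = e * (adj W * W) $$ (i, 0)"
      using Wd(1) that n0 by (simp add: mult_index[of _ n n _ n])
    finally show ?thesis using that n0 by (simp add: Wd(2))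
  qed
  \<comment> \<open>Hermitian symmetry turns the zeros of the first column into zeros of the first
    row.\<close>
  have A0': "A $$ (0, i) = cnj (A $$ (i, 0))" if "i < n" for i
    using adj_index[of 0 A i] A that n0 unfolding Aherm by simp
  define A3 where "A3 = mat l l (\<lambda>(i, j). A $$ (Suc i, Suc j))"
  define E where "E = mat 1 1 (\<lambda>_. e)"
  have A3: "A3 \<in> carrier_mat l l" and E: "E \<in> carrier_mat 1 1" by (auto simp: A3_def E_def)
  have blk: "A = four_block_mat E (0\<^sub>m 1 l) (0\<^sub>m l 1) A3"
  proof (rule eq_matI)
    fix i j assume "i < dim_row (four_block_mat E (0\<^sub>m 1 l) (0\<^sub>m l 1) A3)"
      "j < dim_col (four_block_mat E (0\<^sub>m 1 l) (0\<^sub>m l 1) A3)"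
    hence "i < n" "j < n" using n1 A3 E by auto
    thus "A $$ (i, j) = four_block_mat E (0\<^sub>m 1 l) (0\<^sub>m l 1) A3 $$ (i, j)"
      using A0[of i] A0'[of j] A0[of j] n1 A3 E by (auto simp: A3_def E_def)
  qed (use A A3 E n1 in auto)
  have A3h: "adj A3 = A3"
  proof (rule eq_matI)
    fix i j assume "i < dim_row A3" "j < dim_col A3"
    hence ij: "i < l" "j < l" using A3 by auto
    thus "adj A3 $$ (i, j) = A3 $$ (i, j)"
      using adj_index[of "Suc i" A "Suc j"] A n1 unfolding Aherm by (simp add: A3_def)
  qed (use A3 in auto)
  have "char_poly A = char_poly P"
    by (rule char_poly_similar) (use unitary_similar[OF W P] in \<open>simp add: A_def\<close>)
  moreover have "char_poly A = char_poly E * char_poly A3"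
    unfolding blk by (rule char_poly_four_block_zeros_col[OF E _ A3]) auto
  moreover have "char_poly E = [:- e, 1:]"
    by (simp add: E_def char_poly_defs det_def sign_def)
  ultimately have "char_poly A3 = (\<Prod>e\<leftarrow>es. [:- e, 1:])"
    unfolding Cons.prems(3) by (simp del: mult_pCons_left)
  from Cons.IH[OF A3 A3h this] obtain U where U: "unitary_mat l U"
    and A3U: "A3 = U * dmat l (\<lambda>i. es ! i) * adj U" by blast
  note Ud = unitary_matD[OF U]
  define U' where "U' = four_block_mat (1\<^sub>m 1) (0\<^sub>m 1 l) (0\<^sub>m l 1) U"
  have U'a: "adj U' = four_block_mat (1\<^sub>m 1) (0\<^sub>m 1 l) (0\<^sub>m l 1) (adj U)"
    unfolding U'_def using Ud by (subst adj_four_block[of _ 1 _ l]) auto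
  have U'c: "U' \<in> carrier_mat n n" unfolding U'_def n1 using Ud by auto
  have U': "unitary_mat n U'"
  proof (rule unitary_matI[OF U'c])
    have "adj U' * U' = four_block_mat (1\<^sub>m 1) (0\<^sub>m 1 l) (0\<^sub>m l 1) (1\<^sub>m l)"
      unfolding U'a unfolding U'_def
      by (subst mult_four_block_mat[of _ 1 1 _ l _ l _ _ 1 _ l]) (use Ud in auto)
    thus "adj U' * U' = 1\<^sub>m n" by (simp add: n1)
  qed
  have Db: "dmat n (\<lambda>i. (e # es) ! i) = four_block_mat E (0\<^sub>m 1 l) (0\<^sub>m l 1) (dmat l (\<lambda>i. es ! i))"
    using n1 by (intro eq_matI) (auto simp: E_def)
  have "A = U' * dmat n (\<lambda>i. (e # es) ! i) * adj U'"
  proof -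
    have 1: "U' * dmat n (\<lambda>i. (e # es) ! i) = four_block_mat E (0\<^sub>m 1 l) (0\<^sub>m l 1) (U * dmat l (\<lambda>i. es ! i))"
      unfolding Db U'_def
      by (subst mult_four_block_mat[of _ 1 1 _ l _ l _ _ 1 _ l]) (use Ud E in auto)
    show ?thesis unfolding 1 U'a blk A3U
      by (subst mult_four_block_mat[of _ 1 1 _ l _ l _ _ 1 _ l]) (use Ud E in auto)
  qed
  hence "W * A * adj W = (W * U') * dmat n (\<lambda>i. (e # es) ! i) * adj (W * U')"
    using Wd(1) U'c by (simp add: adj_mult[where a = n and b = n and c = n] square_simps[where n = n])
  moreover have "W * A * adj W = P"
    unfolding A_def by (rule unitary_conj_inverse[OF W W P])
  ultimately show ?case using unitary_mult[OF W U'] by metis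
qed

text \<open>The block matrices with rows \<open>x, A; B, 1\<close> and \<open>1, B; A, x\<close>
  differ by a swap of the two blocks, and their determinants are the two characteristic polynomials.
  This covers singular matrices and gives \<open>X\<close> and \<open>adj X\<close> the same
  singular values.\<close>

lemma char_poly_mult_commute:
  fixes A B :: "complex mat"
  assumes A: "A \<in> carrier_mat n n" and B: "B \<in> carrier_mat n n"
  shows "char_poly (A * B) = char_poly (B * A)"
proof -
  define h where "h = (map_mat (\<lambda>a. [:a:]) :: complex mat \<Rightarrow> _)"
  interpret map_poly: comm_ring_hom "\<lambda>a::complex. [:a:]" by unfold_locales auto
  have hc: "h X \<in> carrier_mat n n" if "X \<in> carrier_mat n n" for X using that by (simp add: h_def)
  have hm: "h (X * Y) = h X * h Y" if "X \<in> carrier_mat n n" "Y \<in> carrier_mat n n" for X Y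
    unfolding h_def using map_poly.mat_hom_mult[OF that] .
  define x where "x = ([:0, 1:] :: complex poly)"
  define I where "I = (1\<^sub>m n :: complex poly mat)"
  have Ic: "I \<in> carrier_mat n n" by (simp add: I_def)
  have cp: "char_poly X = det (x \<cdot>\<^sub>m I - h X)" if "X \<in> carrier_mat n n" for X
  proof -
    have "map_mat (\<lambda>a. [:- a:]) X = - h X" using that by (intro eq_matI) (auto simp: h_def)
    thus ?thesis using that unfolding char_poly_defs x_def I_def
      by (auto simp: h_def minus_add_uminus_mat[of _ n n])
  qed
  define J where "J = four_block_mat (0\<^sub>m n n) I I (0\<^sub>m n n)"
  define M where "M = four_block_mat (x \<cdot>\<^sub>m I) (h A) (h B) I"
  define M' where "M' = four_block_mat I (h B) (h A) (x \<cdot>\<^sub>m I)"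
  have dM: "det M = char_poly (A * B)"
    unfolding M_def using A B Ic hc[OF A] hc[OF B]
    by (subst det_four_block_mat[of _ n]) (auto simp: cp hm I_def)
  have comm: "h A * (x \<cdot>\<^sub>m I) = x \<cdot>\<^sub>m I * h A"
    using hc[OF A] Ic by (simp add: mult_smult_distrib[of _ n n _ n] mult_smult_assoc_mat[of _ n n _ n] I_def)
  have dM': "det M' = char_poly (B * A)"
    unfolding M'_def using A B Ic hc[OF A] hc[OF B] comm
    by (subst det_four_block_mat[of _ n]) (auto simp: cp hm mult_smult_distrib[of _ n n _ n] I_def)
  have JJ: "J * J = 1\<^sub>m (n + n)"
    unfolding J_def using Ic by (subst mult_four_block_mat[of _ n n _ n _ n _ _ n _ n]) (auto simp: I_def)
  have "M = J * M' * J"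
  proof -
    have 1: "J * M' = four_block_mat (h A) (x \<cdot>\<^sub>m I) I (h B)"
      unfolding J_def M'_def using Ic hc[OF A] hc[OF B]
      by (subst mult_four_block_mat[of _ n n _ n _ n _ _ n _ n]) (auto simp: I_def)
    show ?thesis unfolding 1 unfolding J_def M_def using Ic hc[OF A] hc[OF B]
      by (subst mult_four_block_mat[of _ n n _ n _ n _ _ n _ n]) (auto simp: I_def)
  qed
  moreover have "J \<in> carrier_mat (n + n) (n + n)" "M' \<in> carrier_mat (n + n) (n + n)"
    using Ic hc A B by (auto simp: J_def M'_def)
  ultimately have "similar_mat M M'" using JJ
    by (intro similar_matI[of _ _ J J "n + n"]) auto
  hence "det M = det M'" by (rule det_similar)
  thus ?thesis by (simp add: dM dM')
qed

section \<open>Power means and tangent lines\<close>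

text \<open>The factor \<open>sgn (r * (1 - r))\<close> is positive where the power is strictly
  concave and negative where it is strictly convex, so one inequality puts the graph strictly on one
  side of its tangent at 1. Negative exponents occur: later \<open>r = 1 - q\<close> with
  \<open>q = p / 2\<close>.\<close>

lemma powr_tangent_strict:
  fixes r t :: real
  assumes r: "r \<noteq> 0" "r \<noteq> 1" and t: "t > 0" "t \<noteq> 1"
  shows "sgn (r * (1 - r)) * t powr r < sgn (r * (1 - r)) * (1 + r * (t - 1))"
proof -
  define s where "s = sgn (r * (1 - r))"
  \<comment> \<open>The signed gap between tangent and power, which decreases before 1 and increases
    after it.\<close>
  define g where "g t = s * (1 + r * (t - 1) - t powr r)" for t
  define g' where "g' t = s * r * (1 - t powr (r - 1))" for t
  have g': "(g has_real_derivative g' u) (at u)" if "u > 0" for u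
    unfolding g_def g'_def using that
    by (auto intro!: derivative_eq_intros simp: algebra_simps)
  have neg: "g' u < 0" if "0 < u" "u < 1" for u
  proof -
    consider "r < 0" | "0 < r" "r < 1" | "1 < r" using r by linarith
    thus ?thesis
    proof cases
      case 3
      hence "u powr (r - 1) < 1" using that powr_less_mono2[of "r - 1" u 1] by simp
      thus ?thesis using 3 by (simp add: g'_def s_def sgn_mult mult_less_0_iff)
    qed (use that powr_less_mono2_neg[of "r - 1" u 1] in
        \<open>auto simp: g'_def s_def sgn_mult mult_less_0_iff zero_less_mult_iff\<close>)
  qed
  have pos: "g' u > 0" if "1 < u" for u
  proof -
    consider "r < 0" | "0 < r" "r < 1" | "1 < r" using r by linarith
    thus ?thesis
    proof cases
      case 3
      hence "u powr (r - 1) > 1" using that powr_less_mono2[of "r - 1" 1 u] by simp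
      thus ?thesis using 3 by (simp add: g'_def s_def sgn_mult mult_less_0_iff zero_less_mult_iff)
    qed (use that powr_less_mono2_neg[of "r - 1" 1 u] in
        \<open>auto simp: g'_def s_def sgn_mult mult_less_0_iff zero_less_mult_iff\<close>)
  qed
  have cont: "continuous_on A g" if "A \<subseteq> {0<..}" for A
    by (intro continuous_at_imp_continuous_on ballI DERIV_isCont[OF g']) (use that in auto)
  have "g 1 < g t"
  proof (cases "t < 1")
    case True
    show ?thesis
    proof (rule DERIV_neg_imp_decreasing_open[OF True])
      show "\<exists>y. (g has_real_derivative y) (at u) \<and> y < 0" if "t < u" "u < 1" for u
        using g'[of u] neg[of u] that t by auto
    qed (use t in \<open>auto intro!: cont\<close>)
  next
    case False
    hence "1 < t" using t by simp
    thus ?thesis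
    proof (rule DERIV_pos_imp_increasing_open)
      show "\<exists>y. (g has_real_derivative y) (at u) \<and> y > 0" if "1 < u" "u < t" for u
        using g'[of u] pos[of u] that by auto
    qed (auto intro!: cont)
  qed
  thus ?thesis by (simp add: g_def s_def algebra_simps)
qed

lemma powr_tangent:
  fixes r t :: real
  assumes "r \<noteq> 0" "r \<noteq> 1" "t > 0"
  shows "sgn (r * (1 - r)) * t powr r \<le> sgn (r * (1 - r)) * (1 + r * (t - 1))"
  using powr_tangent_strict[OF assms(1,2,3)] by (cases "t = 1") auto

lemma powr_tangent_scaled:
  fixes q x z :: real
  assumes "q > 0" "q \<noteq> 1" "x \<ge> 0" "z > 0"
  shows "sgn (1 - q) * x powr q \<le> sgn (1 - q) * (z powr q * (1 - q) + q * z powr (q - 1) * x)"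
proof -
  have s: "sgn (q * (1 - q)) = sgn (1 - q)" using assms by (simp add: sgn_mult)
  have "sgn (1 - q) * (x / z) powr q \<le> sgn (1 - q) * (1 + q * (x / z - 1))"
  \<comment> \<open>The quotient 0 lies outside the range of the tangent lemma; there the claim
    reads \<open>0 \<le> \<bar>1 - q\<bar>\<close>.\<close>
  proof (cases "x = 0")
    case True
    thus ?thesis using assms by (auto simp: sgn_if)
  next
    case False
    thus ?thesis using powr_tangent[of q "x / z"] assms by (simp add: s)
  qed
  hence "z powr q * (sgn (1 - q) * (x / z) powr q) \<le> z powr q * (sgn (1 - q) * (1 + q * (x / z - 1)))"
    by (rule mult_left_mono) simp
  hence "sgn (1 - q) * (z powr q * (x / z) powr q) \<le> sgn (1 - q) * (z powr q * (1 + q * (x / z - 1)))"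
    by (simp only: mult.left_commute)
  also have "z powr q * (x / z) powr q = x powr q"
    using assms by (simp add: powr_divide)
  also have "z powr q * (1 + q * (x / z - 1)) = z powr q * (1 - q) + q * (z powr q * (x / z))"
    by (simp add: algebra_simps)
  also have "z powr q * (x / z) = z powr (q - 1) * x"
    using assms by (simp add: powr_diff)
  finally show ?thesis by (simp add: mult.assoc)
qed

text \<open>\<open>u\<close> and \<open>v\<close> will be squared moduli of unitaries, and
  \<open>z\<close> the mean diagonal that they produce. Jensen's inequality comes column by column
  from tangents of the power at \<open>z i\<close>: the weights total 2 and the weighted arguments
  total \<open>2 * z i\<close>, so the linear parts add up to twice the value at \<open>z i\<close>.
  Row sums then reassemble the powers of \<open>x\<close> and \<open>y\<close>.\<close>

lemma weighted_powr_jensen: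
  fixes x y z :: "nat \<Rightarrow> real" and u v :: "nat \<Rightarrow> nat \<Rightarrow> real"
  assumes q: "q > 0" "q \<noteq> 1"
    and x: "\<And>k. k < N \<Longrightarrow> x k \<ge> 0" and y: "\<And>k. k < N \<Longrightarrow> y k \<ge> 0"
    and u: "\<And>k i. u k i \<ge> 0" and v: "\<And>k i. v k i \<ge> 0"
    and u1: "\<And>k. k < N \<Longrightarrow> (\<Sum>i<N. u k i) = 1" and v1: "\<And>k. k < N \<Longrightarrow> (\<Sum>i<N. v k i) = 1"
    and u2: "\<And>i. i < N \<Longrightarrow> (\<Sum>k<N. u k i) = 1" and v2: "\<And>i. i < N \<Longrightarrow> (\<Sum>k<N. v k i) = 1"
    and z: "\<And>i. i < N \<Longrightarrow> (\<Sum>k<N. x k * u k i) + (\<Sum>k<N. y k * v k i) = 2 * z i"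
  shows "sgn (1 - q) * ((\<Sum>k<N. x k powr q) + (\<Sum>k<N. y k powr q)) \<le> 2 * (sgn (1 - q) * (\<Sum>i<N. z i powr q))"
proof -
  define s where "s = sgn (1 - q)"
  have col: "s * ((\<Sum>k<N. u k i * x k powr q) + (\<Sum>k<N. v k i * y k powr q)) \<le> 2 * (s * z i powr q)"
    if i: "i < N" for i
  proof (cases "z i = 0")
    case True
    \<comment> \<open>At \<open>z i = 0\<close> there is no tangent, but nonnegative terms with sum
      zero all vanish.\<close>
    have nn: "(\<Sum>k<N. x k * u k i) \<ge> 0" "(\<Sum>k<N. y k * v k i) \<ge> 0"
      using x y u v by (auto intro!: sum_nonneg)
    hence "(\<Sum>k<N. x k * u k i) = 0" "(\<Sum>k<N. y k * v k i) = 0" using z[OF i] True by auto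
    hence 0: "x k * u k i = 0" "y k * v k i = 0" if "k < N" for k
      using that x y u v sum_nonneg_0[of "{..<N}" "\<lambda>k. x k * u k i" k]
        sum_nonneg_0[of "{..<N}" "\<lambda>k. y k * v k i" k] by simp_all
    have "u k i * x k powr q = 0" "v k i * y k powr q = 0" if "k < N" for k
      using 0[OF that] by auto
    hence "(\<Sum>k<N. u k i * x k powr q) = 0" "(\<Sum>k<N. v k i * y k powr q) = 0"
      by (simp_all del: mult_eq_0_iff)
    thus ?thesis using True by simp
  next
    case False
    have "2 * z i \<ge> 0" unfolding z[OF i, symmetric] using x y u v by (auto intro!: add_nonneg_nonneg sum_nonneg)
    hence zi: "z i > 0" using False by simp
    have tan: "w * (s * t powr q) \<le> s * (z i powr q * (1 - q)) * w + s * q * z i powr (q - 1) * (t * w)"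
      if "t \<ge> 0" "w \<ge> 0" for t w
      using mult_left_mono[OF powr_tangent_scaled[OF q that(1) zi] that(2)]
      by (simp add: s_def algebra_simps)
    have "s * ((\<Sum>k<N. u k i * x k powr q) + (\<Sum>k<N. v k i * y k powr q))
        = (\<Sum>k<N. u k i * (s * x k powr q)) + (\<Sum>k<N. v k i * (s * y k powr q))"
      by (simp add: sum_distrib_left distrib_left mult.left_commute)
    also have "\<dots> \<le> (\<Sum>k<N. s * (z i powr q * (1 - q)) * u k i + s * q * z i powr (q - 1) * (x k * u k i))
        + (\<Sum>k<N. s * (z i powr q * (1 - q)) * v k i + s * q * z i powr (q - 1) * (y k * v k i))"
      by (intro add_mono sum_mono tan) (use x y u v in auto)
    also have "\<dots> = s * (z i powr q * (1 - q)) * ((\<Sum>k<N. u k i) + (\<Sum>k<N. v k i))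
        + s * q * z i powr (q - 1) * ((\<Sum>k<N. x k * u k i) + (\<Sum>k<N. y k * v k i))"
      by (simp add: sum.distrib sum_distrib_left distrib_left)
    also have "\<dots> = 2 * s * (z i powr q * (1 - q) + q * (z i powr (q - 1) * z i))"
      using u2[OF i] v2[OF i] z[OF i] by (simp add: algebra_simps)
    also have "z i powr (q - 1) * z i = z i powr q" using zi by (simp add: powr_diff)
    also have "2 * s * (z i powr q * (1 - q) + q * (z i powr q)) = 2 * (s * z i powr q)"
      by (simp add: algebra_simps)
    finally show ?thesis .
  qed
  have swap: "(\<Sum>k<N. f k) = (\<Sum>i<N. \<Sum>k<N. w k i * f k)"
    if "\<And>k. k < N \<Longrightarrow> (\<Sum>i<N. w k i) = 1" for f :: "nat \<Rightarrow> real" and w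
    by (subst sum.swap) (simp add: sum_distrib_right[symmetric] that)
  have "(\<Sum>k<N. x k powr q) = (\<Sum>i<N. \<Sum>k<N. u k i * x k powr q)"
      "(\<Sum>k<N. y k powr q) = (\<Sum>i<N. \<Sum>k<N. v k i * y k powr q)"
    by (intro swap u1 v1; assumption)+
  hence "s * ((\<Sum>k<N. x k powr q) + (\<Sum>k<N. y k powr q))
      = (\<Sum>i<N. s * ((\<Sum>k<N. u k i * x k powr q) + (\<Sum>k<N. v k i * y k powr q)))"
    by (simp add: sum.distrib sum_distrib_left distrib_left)
  also have "\<dots> \<le> (\<Sum>i<N. 2 * (s * z i powr q))" by (intro sum_mono col) auto
  finally show ?thesis by (simp add: sum_distrib_left s_def)
qed

text \<open>
  In an eigenbasis of \<open>Z = P + Q\<close> with eigenvalues \<open>z\<close>, the matrices are \<open>P = W\<^sup>* diag(a) W\<close> and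
  \<open>Q = W'\<^sup>* diag(b) W'\<close>. The sum of the \<open>mixed q k\<close> below is the trace of \<open>P Z\<^sup>q\<^sup>-\<^sup>1\<close>, and the tangent line
  of \<open>x\<^sup>1\<^sup>-\<^sup>q\<close> compares it with the trace of \<open>P\<^sup>q\<close>.
\<close>

locale diagonal_sum =
  fixes N :: nat and W W' :: "nat \<Rightarrow> nat \<Rightarrow> complex" and a b z :: "nat \<Rightarrow> real"
  assumes a: "\<And>k. k < N \<Longrightarrow> a k \<ge> 0" and b: "\<And>k. k < N \<Longrightarrow> b k \<ge> 0"
    and W: "\<And>k l. k < N \<Longrightarrow> l < N \<Longrightarrow> (\<Sum>j<N. W l j * cnj (W k j)) = (if k = l then 1 else 0)"
    and z: "\<And>i j. i < N \<Longrightarrow> j < N \<Longrightarrow>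
        (\<Sum>l<N. a l * (cnj (W l i) * W l j)) + (\<Sum>l<N. b l * (cnj (W' l i) * W' l j))
        = (if i = j then complex_of_real (z i) else 0)"
begin

lemma z_eq:
  assumes "i < N"
  shows "z i = (\<Sum>l<N. a l * (cmod (W l i))\<^sup>2) + (\<Sum>l<N. b l * (cmod (W' l i))\<^sup>2)"
proof -
  have "complex_of_real (z i) = (\<Sum>l<N. a l * (cnj (W l i) * W l i)) + (\<Sum>l<N. b l * (cnj (W' l i) * W' l i))"
    using z[OF assms assms] by simp
  also have "\<dots> = complex_of_real ((\<Sum>l<N. a l * (cmod (W l i))\<^sup>2) + (\<Sum>l<N. b l * (cmod (W' l i))\<^sup>2))"
    by (simp add: complex_norm_square mult.commute del: of_real_power)
  finally show ?thesis using of_real_eq_iff by blast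
qed

lemma z_nonneg: "i < N \<Longrightarrow> z i \<ge> 0"
  using a b by (auto simp: z_eq intro!: add_nonneg_nonneg sum_nonneg)

lemma row_norm: "k < N \<Longrightarrow> (\<Sum>i<N. (cmod (W k i))\<^sup>2) = 1"
proof -
  assume "k < N"
  hence "complex_of_real (\<Sum>i<N. (cmod (W k i))\<^sup>2) = 1"
    using W[of k k] by (simp add: complex_norm_square del: of_real_power)
  thus ?thesis using of_real_eq_1_iff by blast
qed

text \<open>The \<open>k\<close>-th term alone bounds \<open>z i\<close> from below. For
  \<open>a k > 0\<close> the zeros of \<open>z\<close> thus sit where \<open>W k i\<close> vanishes,
  which makes division by \<open>z i\<close> harmless.\<close>

lemma z_pos:
  assumes "k < N" "i < N" "a k > 0" "W k i \<noteq> 0"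
  shows "z i > 0"
proof -
  have "0 < a k * (cmod (W k i))\<^sup>2" using assms by simp
  also have "\<dots> \<le> (\<Sum>l<N. a l * (cmod (W l i))\<^sup>2)"
    using assms(1) a by (intro member_le_sum) auto
  also have "\<dots> \<le> z i"
    using z_eq[OF assms(2)] b by (auto intro!: sum_nonneg)
  finally show ?thesis .
qed

text \<open>
  With \<open>v = W\<^sup>* e\<^sub>k\<close>, the number \<open>t k\<close> is \<open>\<langle>v, Z\<^sup>-\<^sup>1 v\<rangle>\<close>; as \<open>Z \<ge> a\<^sub>k v v\<^sup>*\<close>, it is at most \<open>1 / a\<^sub>k\<close>.
  Division by zero makes \<open>Z\<^sup>-\<^sup>1\<close> the pseudoinverse.
\<close>

definition t :: "nat \<Rightarrow> real" where "t k = (\<Sum>i<N. (cmod (W k i))\<^sup>2 / z i)"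

text \<open>At the vector \<open>Z^-1 v\<close> the quadratic form of \<open>Z = P + Q\<close> takes
  the value \<open>t k\<close>. Of its nonnegative terms one from each summand is kept: the one from
  \<open>P\<close> is \<open>a k * (t k)\<^sup>2\<close>, and the one from \<open>Q\<close> will
  detect orthogonality in the equality case.\<close>

lemma t_quadratic:
  assumes "k < N" "l' < N"
  shows "a k * (t k)\<^sup>2 + b l' * (cmod (\<Sum>j<N. W' l' j * (cnj (W k j) / z j)))\<^sup>2 \<le> t k"
proof -
  define x where "x j = cnj (W k j) / complex_of_real (z j)" for j
  define c where "c V l = (\<Sum>j<N. V l j * x j)" for V :: "nat \<Rightarrow> nat \<Rightarrow> complex" and l :: nat
  have quad: "(\<Sum>i<N. \<Sum>j<N. cnj (x i) * x j * (\<Sum>l<N. d l * (cnj (V l i) * V l j)))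
      = complex_of_real (\<Sum>l<N. d l * (cmod (c V l))\<^sup>2)" for V d
  proof -
    have "(\<Sum>i<N. \<Sum>j<N. cnj (x i) * x j * (\<Sum>l<N. d l * (cnj (V l i) * V l j)))
      = (\<Sum>i<N. \<Sum>j<N. \<Sum>l<N. d l * (cnj (V l i * x i) * (V l j * x j)))"
      by (simp add: sum_distrib_left mult_ac)
    also have "\<dots> = (\<Sum>i<N. \<Sum>l<N. \<Sum>j<N. d l * (cnj (V l i * x i) * (V l j * x j)))"
      by (intro sum.cong refl sum.swap)
    also have "\<dots> = (\<Sum>l<N. \<Sum>i<N. \<Sum>j<N. d l * (cnj (V l i * x i) * (V l j * x j)))"
      by (rule sum.swap)
    also have "\<dots> = (\<Sum>l<N. d l * (cnj (c V l) * c V l))"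
      unfolding c_def cnj_sum sum_product by (simp add: sum_distrib_left)
    also have "\<dots> = complex_of_real (\<Sum>l<N. d l * (cmod (c V l))\<^sup>2)"
      by (simp add: complex_norm_square mult.commute del: of_real_power)
    finally show ?thesis .
  qed
  have "complex_of_real ((\<Sum>l<N. a l * (cmod (c W l))\<^sup>2) + (\<Sum>l<N. b l * (cmod (c W' l))\<^sup>2))
      = (\<Sum>i<N. \<Sum>j<N. cnj (x i) * x j * (if i = j then complex_of_real (z i) else 0))"
    unfolding of_real_add quad[symmetric]
    unfolding sum.distrib[symmetric] distrib_left[symmetric]
    by (intro sum.cong refl) (subst z[symmetric]; simp add: sum.distrib)
  also have "\<dots> = (\<Sum>i<N. cnj (x i) * x i * complex_of_real (z i))"
    by (simp add: if_distrib[of "\<lambda>x. _ * x"] cong: if_cong)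
  also have "\<dots> = complex_of_real (t k)"
    unfolding t_def of_real_sum
  proof (intro sum.cong refl)
    fix i show "cnj (x i) * x i * complex_of_real (z i) = complex_of_real ((cmod (W k i))\<^sup>2 / z i)"
      by (cases "z i = 0") (simp_all add: x_def complex_norm_square del: of_real_power)
  qed
  finally have eq: "(\<Sum>l<N. a l * (cmod (c W l))\<^sup>2) + (\<Sum>l<N. b l * (cmod (c W' l))\<^sup>2) = t k"
    using of_real_eq_iff by blast
  have "c W k = complex_of_real (t k)"
    by (simp add: c_def x_def t_def complex_norm_square del: of_real_power)
  hence "a k * (t k)\<^sup>2 \<le> (\<Sum>l<N. a l * (cmod (c W l))\<^sup>2)"
    using assms(1) a member_le_sum[of k "{..<N}" "\<lambda>l. a l * (cmod (c W l))\<^sup>2"] by simp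
  moreover have "b l' * (cmod (c W' l'))\<^sup>2 \<le> (\<Sum>l<N. b l * (cmod (c W' l))\<^sup>2)"
    using assms(2) b by (intro member_le_sum) auto
  ultimately show ?thesis using eq by (simp add: c_def x_def)
qed

lemma t_bound:
  assumes "k < N" "a k > 0"
  shows "a k * t k \<le> 1"
proof -
  have "0 \<le> b k * (cmod (\<Sum>j<N. W' k j * (cnj (W k j) / z j)))\<^sup>2" using assms b by simp
  hence "a k * t k * t k \<le> 1 * t k" using t_quadratic[OF assms(1) assms(1)] by (simp add: power2_eq_square)
  moreover have "t k \<ge> 0" using z_nonneg by (auto simp: t_def intro!: sum_nonneg)
  ultimately show ?thesis
    by (metis mult_le_cancel_right mult_zero_right order_le_less zero_le_one)
qed

definition mixed :: "real \<Rightarrow> nat \<Rightarrow> real" where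
  "mixed q k = (\<Sum>i<N. a k * (cmod (W k i))\<^sup>2 * z i powr (q - 1))"

context
  fixes q :: real
  assumes q: "q > 0" "q \<noteq> 1"
begin

text \<open>Since \<open>a * z powr (q - 1) = a powr q * (a / z) powr (1 - q)\<close>, the bound is
  the tangent at 1 to the power \<open>1 - q\<close>, taken at \<open>a k / z i\<close>. Strictness
  is recorded because equality has to force \<open>z i = a k\<close>.\<close>

lemma mixed_term:
  assumes "k < N" "i < N" "a k > 0"
  defines "L \<equiv> sgn (1 - q) * (a k * (cmod (W k i))\<^sup>2 * z i powr (q - 1))"
    and "R \<equiv> sgn (1 - q) * (a k powr q * (cmod (W k i))\<^sup>2 * (1 + (1 - q) * (a k / z i - 1)))"
  shows "L \<le> R" and "W k i \<noteq> 0 \<Longrightarrow> z i \<noteq> a k \<Longrightarrow> L < R"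
proof -
  have s: "sgn ((1 - q) * (1 - (1 - q))) = sgn (1 - q)" using q by (simp add: sgn_mult)
  note strict = powr_tangent_strict[of "1 - q", unfolded s]
  have eq: "a k * z i powr (q - 1) = a k powr q * (a k / z i) powr (1 - q)" if "z i > 0"
    using assms that by (simp add: powr_divide powr_diff field_simps)
  have less: "L < R" if "W k i \<noteq> 0" "z i \<noteq> a k"
  proof -
    have zi: "z i > 0" using z_pos[OF assms(1-3) that(1)] .
    have "sgn (1 - q) * (a k / z i) powr (1 - q) < sgn (1 - q) * (1 + (1 - q) * (a k / z i - 1))"
      by (rule strict) (use q assms(3) zi that in auto)
    hence "a k powr q * (cmod (W k i))\<^sup>2 * (sgn (1 - q) * (a k / z i) powr (1 - q))
        < a k powr q * (cmod (W k i))\<^sup>2 * (sgn (1 - q) * (1 + (1 - q) * (a k / z i - 1)))"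
      by (rule mult_strict_left_mono) (use assms that in auto)
    moreover have "L = a k powr q * (cmod (W k i))\<^sup>2 * (sgn (1 - q) * (a k / z i) powr (1 - q))"
      using eq[OF zi] by (simp add: L_def mult_ac)
    ultimately show ?thesis by (simp add: R_def mult_ac)
  qed
  show "W k i \<noteq> 0 \<Longrightarrow> z i \<noteq> a k \<Longrightarrow> L < R" by (rule less)
  show "L \<le> R"
  proof (cases "W k i = 0 \<or> z i = a k")
    case True
    thus ?thesis using assms by (auto simp: L_def R_def powr_diff)
  qed (use less in auto)
qed

text \<open>The tangent values \<open>q + (1 - q) * a k / z i\<close>, averaged with weights of
  total one, give \<open>1 + (1 - q) * (a k * t k - 1)\<close>. After multiplication by the sign the
  excess carries \<open>\<bar>1 - q\<bar>\<close>, so for \<open>a k > 0\<close> it is nonpositive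
  by \<open>t_bound\<close> whatever the sign of \<open>1 - q\<close>.\<close>

lemma mixed_sum:
  assumes "k < N"
  shows "(\<Sum>i<N. sgn (1 - q) * (a k powr q * (cmod (W k i))\<^sup>2 * (1 + (1 - q) * (a k / z i - 1))))
      = sgn (1 - q) * a k powr q + a k powr q * \<bar>1 - q\<bar> * (a k * t k - 1)"
proof -
  have "(\<Sum>i<N. sgn (1 - q) * (a k powr q * (cmod (W k i))\<^sup>2 * (1 + (1 - q) * (a k / z i - 1))))
      = (\<Sum>i<N. sgn (1 - q) * a k powr q * q * (cmod (W k i))\<^sup>2
          + sgn (1 - q) * a k powr q * (1 - q) * a k * ((cmod (W k i))\<^sup>2 / z i))"
    by (intro sum.cong) (auto simp: divide_inverse algebra_simps)
  also have "\<dots> = sgn (1 - q) * a k powr q * q * (\<Sum>i<N. (cmod (W k i))\<^sup>2)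
      + sgn (1 - q) * a k powr q * (1 - q) * a k * t k"
    by (simp only: sum.distrib sum_distrib_left t_def)
  also have "\<dots> = sgn (1 - q) * a k powr q + a k powr q * ((1 - q) * sgn (1 - q)) * (a k * t k - 1)"
    unfolding row_norm[OF assms] by (simp add: algebra_simps)
  finally show ?thesis by (simp add: abs_sgn)
qed

lemma mixed_le:
  assumes k: "k < N"
  shows "sgn (1 - q) * mixed q k \<le> sgn (1 - q) * a k powr q"
proof (cases "a k = 0")
  case True
  thus ?thesis by (simp add: mixed_def)
next
  case False
  hence ak: "a k > 0" using a[OF k] by simp
  have "sgn (1 - q) * mixed q k
      \<le> (\<Sum>i<N. sgn (1 - q) * (a k powr q * (cmod (W k i))\<^sup>2 * (1 + (1 - q) * (a k / z i - 1))))"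
    unfolding mixed_def sum_distrib_left by (intro sum_mono mixed_term(1)) (use k ak in auto)
  also have "\<dots> \<le> sgn (1 - q) * a k powr q"
    unfolding mixed_sum[OF k] using t_bound[OF k ak] by (simp add: mult_nonneg_nonpos)
  finally show ?thesis .
qed

text \<open>Two estimates become equalities. The strict tangent gives \<open>z i = a k\<close> on
  the support of row \<open>k\<close> of \<open>W\<close>, and \<open>a k * t k = 1\<close> leaves
  no room for the \<open>Q\<close> term of \<open>t_quadratic\<close>. On that support dividing by
  \<open>z\<close> is dividing by \<open>a k\<close>, which turns the \<open>Q\<close> term into the
  inner product of the claim.\<close>

lemma mixed_eq_imp:
  assumes k: "k < N" and l: "l < N" and eq: "mixed q k = a k powr q"
  shows "a k * b l * (\<Sum>j<N. W' l j * cnj (W k j)) = 0"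
proof (cases "a k = 0")
  case False
  hence ak: "a k > 0" using a[OF k] by simp
  let ?L = "\<lambda>i. sgn (1 - q) * (a k * (cmod (W k i))\<^sup>2 * z i powr (q - 1))"
  let ?R = "\<lambda>i. sgn (1 - q) * (a k powr q * (cmod (W k i))\<^sup>2 * (1 + (1 - q) * (a k / z i - 1)))"
  have le: "a k powr q * \<bar>1 - q\<bar> * (a k * t k - 1) \<le> 0"
    using t_bound[OF k ak] by (simp add: mult_nonneg_nonpos)
  have L: "sum ?L {..<N} = sgn (1 - q) * a k powr q"
    unfolding eq[symmetric] mixed_def sum_distrib_left ..
  have "sum ?L {..<N} \<le> sum ?R {..<N}" by (intro sum_mono mixed_term(1)) (use k ak in auto)
  hence R: "sum ?R {..<N} = sum ?L {..<N}" and t1: "a k powr q * \<bar>1 - q\<bar> * (a k * t k - 1) = 0"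
    using le unfolding L mixed_sum[OF k] by linarith+
  have za: "z i = a k" if "i < N" "W k i \<noteq> 0" for i
  proof (rule ccontr)
    assume "z i \<noteq> a k"
    hence "sum ?L {..<N} < sum ?R {..<N}"
      using that k ak by (intro sum_strict_mono_ex1 ballI bexI[of _ i] mixed_term) auto
    thus False using R by simp
  qed
  have "a k * t k = 1" using t1 ak q by simp
  hence "a k * (t k)\<^sup>2 = t k" by (simp add: power2_eq_square)
  hence "b l * (cmod (\<Sum>j<N. W' l j * (cnj (W k j) / z j)))\<^sup>2 = 0"
    using t_quadratic[OF k l] mult_nonneg_nonneg[OF b[OF l] zero_le_power2] by (intro order_antisym) auto
  moreover have "(\<Sum>j<N. W' l j * (cnj (W k j) / z j)) = (\<Sum>j<N. W' l j * cnj (W k j)) / a k"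
    unfolding sum_divide_distrib
  proof (intro sum.cong refl)
    fix j assume "j \<in> {..<N}"
    thus "W' l j * (cnj (W k j) / z j) = W' l j * cnj (W k j) / a k"
      using za[of j] by (cases "W k j = 0") auto
  qed
  ultimately show ?thesis by auto
qed simp

text \<open>A row of \<open>W\<close> orthogonal to the rows of \<open>W'\<close> with nonzero
  \<open>b\<close> gives an eigenvector of \<open>Z\<close>: only \<open>P\<close> acts on it, by
  \<open>a k\<close>. Hence \<open>z i = a k\<close> wherever the row is nonzero.\<close>

lemma mixed_eqI:
  assumes k: "k < N" and orth: "\<And>l. l < N \<Longrightarrow> a k * b l * (\<Sum>j<N. W' l j * cnj (W k j)) = 0"
  shows "mixed q k = a k powr q"
proof (cases "a k = 0")
  case False
  hence ak: "a k > 0" using a[OF k] by simp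
  have za: "z i = a k" if i: "i < N" "W k i \<noteq> 0" for i
  proof -
    \<comment> \<open>Component \<open>i\<close> of \<open>Z\<close> applied to the conjugated row
      \<open>k\<close>, computed with \<open>z\<close> and then with \<open>P + Q\<close>.\<close>
    have "z i * cnj (W k i) = (\<Sum>j<N. (if i = j then complex_of_real (z i) else 0) * cnj (W k j))"
      using i by (simp add: if_distrib[of "\<lambda>x. x * _"] cong: if_cong)
    also have "\<dots> = (\<Sum>j<N. (\<Sum>l<N. a l * (cnj (W l i) * W l j)) * cnj (W k j))
        + (\<Sum>j<N. (\<Sum>l<N. b l * (cnj (W' l i) * W' l j)) * cnj (W k j))"
      unfolding sum.distrib[symmetric] distrib_right[symmetric] by (intro sum.cong) (use i z in auto)
    also have "\<dots> = (\<Sum>l<N. a l * cnj (W l i) * (\<Sum>j<N. W l j * cnj (W k j)))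
        + (\<Sum>l<N. b l * cnj (W' l i) * (\<Sum>j<N. W' l j * cnj (W k j)))"
      unfolding sum_distrib_right sum_distrib_left
      by (subst (1 2) sum.swap) (simp add: mult_ac)
    also have "(\<Sum>l<N. a l * cnj (W l i) * (\<Sum>j<N. W l j * cnj (W k j))) = a k * cnj (W k i)"
      using k by (simp add: W if_distrib[of "\<lambda>x. _ * x"] cong: if_cong)
    also have "(\<Sum>l<N. b l * cnj (W' l i) * (\<Sum>j<N. W' l j * cnj (W k j))) = 0"
      using orth ak by (intro sum.neutral) auto
    finally show ?thesis using i by auto
  qed
  have "mixed q k = (\<Sum>i<N. a k powr q * (cmod (W k i))\<^sup>2)"
    unfolding mixed_def
  proof (intro sum.cong refl)
    fix i assume "i \<in> {..<N}"
    thus "a k * (cmod (W k i))\<^sup>2 * z i powr (q - 1) = a k powr q * (cmod (W k i))\<^sup>2"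
      using za[of i] ak by (cases "W k i = 0") (auto simp: powr_diff)
  qed
  thus ?thesis using row_norm[OF k] by (simp add: sum_distrib_left[symmetric])
qed (simp add: mixed_def)

end

end

section \<open>Schatten norms and orthogonality\<close>

text \<open>For \<open>P = X\<^sup>* X\<close> this is \<open>\<parallel>X\<parallel>\<^sub>p\<^sup>p\<close>.\<close>

definition spec_sum :: "real \<Rightarrow> complex mat \<Rightarrow> real" where
  "spec_sum p P = (\<Sum>z\<in>#proots (char_poly P). sqrt (Re z) powr p)"

lemma schatten_norm_spec_sum: "schatten_norm p X = spec_sum p (adj X * X) powr (1 / p)"
proof -
  have "(\<Sum>s\<leftarrow>singular_values X. s powr p) = sum_mset (mset (map (\<lambda>s. s powr p) (singular_values X)))"
    by (rule sum_mset_sum_list[symmetric])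
  also have "\<dots> = spec_sum p (adj X * X)"
    by (simp add: singular_values_def spec_sum_def multiset.map_comp comp_def)
  finally show ?thesis by (simp add: schatten_norm_def)
qed

lemma spec_sum_nonneg: "spec_sum p P \<ge> 0"
proof -
  have "(\<Sum>z\<in>#M. sqrt (Re z) powr p) \<ge> 0" for M by (induction M) auto
  thus ?thesis by (simp add: spec_sum_def)
qed

lemma schatten_norm_eq_iff:
  assumes "p > 0"
  shows "schatten_norm p X = schatten_norm p Y \<longleftrightarrow> spec_sum p (adj X * X) = spec_sum p (adj Y * Y)"
proof
  assume "schatten_norm p X = schatten_norm p Y"
  hence "(spec_sum p (adj X * X) powr (1 / p)) powr p = (spec_sum p (adj Y * Y) powr (1 / p)) powr p"
    by (simp add: schatten_norm_spec_sum)
  thus "spec_sum p (adj X * X) = spec_sum p (adj Y * Y)"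
    using assms spec_sum_nonneg by (simp add: powr_powr)
qed (simp add: schatten_norm_spec_sum)

text \<open>Similarity identifies the multiset of roots with the diagonal. The exponent is halved
  because \<open>d\<close> plays the role of squared singular values.\<close>

lemma spec_sum_diagonal:
  assumes "unitary_mat N U" "P = U * dmat N (\<lambda>i. complex_of_real (d i)) * adj U"
    and "\<And>i. i < N \<Longrightarrow> d i \<ge> 0"
  shows "spec_sum p P = (\<Sum>i<N. d i powr (p / 2))"
proof -
  have "similar_mat P (dmat N (\<lambda>i. complex_of_real (d i)))"
    using unitary_similar[OF unitary_adj[OF assms(1)], of "dmat N (\<lambda>i. complex_of_real (d i))"] assms(2) by simp
  hence "char_poly P = (\<Prod>i\<leftarrow>[0..<N]. [:- complex_of_real (d i), 1:])"
    using char_poly_similar char_poly_dmat by metis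
  moreover have "proots (\<Prod>i\<leftarrow>xs. [:- complex_of_real (d i), 1:]) = mset (map (\<lambda>i. complex_of_real (d i)) xs)"
    for xs :: "nat list"
  proof (induction xs)
    case (Cons x xs)
    have "(\<Prod>i\<leftarrow>xs. [:- complex_of_real (d i), 1:]) \<noteq> 0" by (auto simp: prod_list_zero_iff)
    thus ?case using Cons by (simp add: proots_mult del: mult_pCons_left)
  qed simp
  ultimately have "spec_sum p P = (\<Sum>i\<leftarrow>[0..<N]. sqrt (d i) powr p)"
    by (simp add: spec_sum_def sum_mset_sum_list[symmetric] multiset.map_comp comp_def)
  also have "\<dots> = (\<Sum>i<N. sqrt (d i) powr p)"
    by (simp add: interv_sum_list_conv_sum_set_nat atLeast0LessThan)
  also have "\<dots> = (\<Sum>i<N. d i powr (p / 2))"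
    using assms(3) by (intro sum.cong) (auto simp: powr_half_sqrt[symmetric] powr_powr)
  finally show ?thesis .
qed

section \<open>Positive semidefinite matrices\<close>

definition psd :: "nat \<Rightarrow> complex mat \<Rightarrow> bool" where
  "psd N P \<longleftrightarrow> (\<exists>U d. unitary_mat N U \<and> (\<forall>i<N. d i \<ge> (0::real)) \<and>
     P = U * dmat N (\<lambda>i. complex_of_real (d i)) * adj U)"

lemma adj_dmat_real [simp]: "adj (dmat N (\<lambda>i. complex_of_real (d i))) = dmat N (\<lambda>i. complex_of_real (d i))"
  by (intro eq_matI) auto

lemma psd_carrier: "psd N P \<Longrightarrow> P \<in> carrier_mat N N"
  by (auto simp: psd_def unitary_mat_def intro!: square_mult_carrier)

lemma psd_hermitian: "psd N P \<Longrightarrow> adj P = P"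
  by (auto simp: psd_def unitary_mat_def adj_mult[where a = N and b = N and c = N] square_simps[where n = N])

lemma adj_dmat_conj_index:
  assumes "W \<in> carrier_mat N N" "i < N" "j < N"
  shows "(adj W * dmat N d * W) $$ (i, j) = (\<Sum>k<N. d k * (cnj (W $$ (k, i)) * W $$ (k, j)))"
proof -
  have "(adj W * dmat N d * W) $$ (i, j) = (\<Sum>k<N. (adj W * dmat N d) $$ (i, k) * W $$ (k, j))"
    using assms by (intro mult_index[of _ N N]) (auto intro!: square_mult_carrier)
  also have "\<dots> = (\<Sum>k<N. d k * (cnj (W $$ (k, i)) * W $$ (k, j)))"
    using assms by (intro sum.cong) (auto simp: dmat_mult_index)
  finally show ?thesis .
qed

lemma unitary_entry_sums:
  assumes "unitary_mat N W" "i < N" "j < N"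
  shows "(\<Sum>k<N. W $$ (j, k) * cnj (W $$ (i, k))) = (if i = j then 1 else 0)"
    and "(\<Sum>k<N. cnj (W $$ (k, i)) * W $$ (k, j)) = (if i = j then 1 else 0)"
proof -
  note W = unitary_matD[OF assms(1)]
  have "(W * adj W) $$ (j, i) = (\<Sum>k<N. W $$ (j, k) * cnj (W $$ (i, k)))"
    using W(1) assms by (simp add: mult_index[of _ N N _ N])
  thus "(\<Sum>k<N. W $$ (j, k) * cnj (W $$ (i, k))) = (if i = j then 1 else 0)"
    using assms by (auto simp: W(3))
  have "(adj W * W) $$ (i, j) = (\<Sum>k<N. cnj (W $$ (k, i)) * W $$ (k, j))"
    using W(1) assms by (simp add: mult_index[of _ N N _ N])
  thus "(\<Sum>k<N. cnj (W $$ (k, i)) * W $$ (k, j)) = (if i = j then 1 else 0)"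
    using assms by (auto simp: W(2))
qed

lemma unitary_entry_norms:
  assumes "unitary_mat N W" "i < N"
  shows "(\<Sum>k<N. (cmod (W $$ (i, k)))\<^sup>2) = 1" "(\<Sum>k<N. (cmod (W $$ (k, i)))\<^sup>2) = 1"
proof -
  have "complex_of_real (\<Sum>k<N. (cmod (W $$ (i, k)))\<^sup>2) = 1" "complex_of_real (\<Sum>k<N. (cmod (W $$ (k, i)))\<^sup>2) = 1"
    using unitary_entry_sums[OF assms(1,2,2)]
    by (simp_all add: complex_norm_square mult.commute del: of_real_power)
  thus "(\<Sum>k<N. (cmod (W $$ (i, k)))\<^sup>2) = 1" "(\<Sum>k<N. (cmod (W $$ (k, i)))\<^sup>2) = 1"
    using of_real_eq_1_iff by blast+
qed

text \<open>\<open>psd\<close> asks for a diagonalization, the form in which spectra are computed,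
  whereas nonnegative diagonals in all orthonormal bases are easy to check for sums and Gram
  matrices. An eigenbasis turns the latter into the former, Hermitian symmetry making the
  eigenvalues real.\<close>

lemma psdI:
  assumes "P \<in> carrier_mat N N" "adj P = P"
    and "\<And>U i. unitary_mat N U \<Longrightarrow> i < N \<Longrightarrow> Re ((adj U * P * U) $$ (i, i)) \<ge> 0"
  shows "psd N P"
proof -
  obtain es where "char_poly P = (\<Prod>e\<leftarrow>es. [:- e, 1:])"
    using char_poly_factorized[OF assms(1)] by blast
  from hermitian_diagonalization[OF assms(1,2) this]
  obtain U where U: "unitary_mat N U" and P: "P = U * dmat N (\<lambda>i. es ! i) * adj U" by blast
  note Ud = unitary_matD[OF U]
  define D where "D = dmat N (\<lambda>i. es ! i)"
  have D: "adj U * P * U = D"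
    unfolding P D_def using unitary_conj_inverse(2)[OF U U, of "dmat N (\<lambda>i. es ! i)"] by simp
  have "adj D = D"
    unfolding D[symmetric] using Ud(1) assms(1,2)
    by (simp add: adj_mult[where a = N and b = N and c = N] square_simps[where n = N])
  hence "cnj (D $$ (i, i)) = D $$ (i, i)" if "i < N" for i
    using adj_index[of i D i] that by (simp add: D_def)
  hence "es ! i = complex_of_real (Re (es ! i))" if "i < N" for i
    using that by (auto simp: D_def complex_eq_iff)
  hence "D = dmat N (\<lambda>i. complex_of_real (Re (es ! i)))"
    unfolding D_def by (intro dmat_cong) auto
  moreover have "Re (es ! i) \<ge> 0" if "i < N" for i
    using assms(3)[OF U that] that by (simp add: D) (simp add: D_def)
  ultimately show ?thesis unfolding psd_def using U P D_def
    by (intro exI[of _ U] exI[of _ "\<lambda>i. Re (es ! i)"]) auto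
qed

lemma gram_diag:
  assumes "X \<in> carrier_mat N N" "i < N"
  shows "(adj X * X) $$ (i, i) = complex_of_real (\<Sum>k<N. (cmod (X $$ (k, i)))\<^sup>2)"
  using assms by (simp add: mult_index[of _ N N _ N] complex_norm_square mult.commute del: of_real_power)

lemma psd_gram:
  assumes "X \<in> carrier_mat N N"
  shows "psd N (adj X * X)"
proof (rule psdI)
  show "adj (adj X * X) = adj X * X" using assms by (simp add: adj_mult[where a = N and b = N and c = N])
  fix U i assume U: "unitary_mat N U" and i: "i < N"
  have "adj U * (adj X * X) * U = adj (X * U) * (X * U)"
    using unitary_matD(1)[OF U] assms
    by (simp add: adj_mult[where a = N and b = N and c = N] square_simps[where n = N])
  thus "Re ((adj U * (adj X * X) * U) $$ (i, i)) \<ge> 0"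
    using gram_diag[of "X * U" N i] unitary_matD(1)[OF U] assms i
    by (simp add: square_mult_carrier sum_nonneg)
qed (use assms in \<open>auto intro!: square_mult_carrier\<close>)

text \<open>\<open>adj V * U\<close> is the transition between two eigenbases; its squared moduli
  are the weights used below.\<close>

lemma diagonal_conj:
  assumes "unitary_mat N V" "unitary_mat N U" "P = V * dmat N (\<lambda>i. complex_of_real (d i)) * adj V"
  shows "adj U * P * U = adj (adj V * U) * dmat N (\<lambda>i. complex_of_real (d i)) * (adj V * U)"
  using unitary_matD(1)[OF assms(1)] unitary_matD(1)[OF assms(2)] unfolding assms(3)
  by (simp add: adj_mult[where a = N and b = N and c = N] square_simps[where n = N])

lemma conj_add:
  assumes "U \<in> carrier_mat N N" "P \<in> carrier_mat N N" "Q \<in> carrier_mat N N"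
  shows "adj U * (P + Q) * U = adj U * P * U + adj U * Q * U"
  using assms by (simp add: mult_add_distrib_mat[of _ N N _ N] add_mult_distrib_mat[of _ N N _ _ N] square_mult_carrier)

lemma conj_add_index:
  assumes "U \<in> carrier_mat N N" "P \<in> carrier_mat N N" "Q \<in> carrier_mat N N" "i < N" "j < N"
  shows "(adj U * (P + Q) * U) $$ (i, j) = (adj U * P * U) $$ (i, j) + (adj U * Q * U) $$ (i, j)"
  unfolding conj_add[OF assms(1-3)] using assms by (subst index_add_mat) auto

lemma psd_diag_nonneg:
  assumes "psd N P" "unitary_mat N U" "i < N"
  shows "Re ((adj U * P * U) $$ (i, i)) \<ge> 0"
proof -
  obtain V d where V: "unitary_mat N V" and d: "\<And>i. i < N \<Longrightarrow> d i \<ge> (0::real)"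
    and P: "P = V * dmat N (\<lambda>i. complex_of_real (d i)) * adj V"
    using assms(1) unfolding psd_def by blast
  define W where "W = adj V * U"
  have W: "W \<in> carrier_mat N N"
    using unitary_matD(1)[OF V] unitary_matD(1)[OF assms(2)] by (auto simp: W_def intro!: square_mult_carrier)
  have "(adj U * P * U) $$ (i, i) = (\<Sum>k<N. d k * (cnj (W $$ (k, i)) * W $$ (k, i)))"
    unfolding diagonal_conj[OF V assms(2) P] W_def[symmetric] using W assms by (simp add: adj_dmat_conj_index)
  also have "\<dots> = complex_of_real (\<Sum>k<N. d k * (cmod (W $$ (k, i)))\<^sup>2)"
    by (simp add: complex_norm_square mult.commute del: of_real_power)
  finally show ?thesis using d by (auto intro!: sum_nonneg)
qed

lemma psd_add:
  assumes "psd N P" "psd N Q"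
  shows "psd N (P + Q)"
proof (rule psdI)
  note P = psd_carrier[OF assms(1)] and Q = psd_carrier[OF assms(2)]
  show "P + Q \<in> carrier_mat N N" using P Q by auto
  show "adj (P + Q) = P + Q" using assms P Q by (simp add: adj_add[of _ N N] psd_hermitian)
  fix U i assume U: "unitary_mat N U" and i: "i < N"
  have "(adj U * (P + Q) * U) $$ (i, i) = (adj U * P * U) $$ (i, i) + (adj U * Q * U) $$ (i, i)"
    by (rule conj_add_index[OF unitary_matD(1)[OF U] P Q i i])
  thus "Re ((adj U * (P + Q) * U) $$ (i, i)) \<ge> 0"
    using psd_diag_nonneg[OF assms(1) U i] psd_diag_nonneg[OF assms(2) U i] by simp
qed

text \<open>In an eigenbasis of \<open>Z\<close> the diagonals of \<open>X\<close> and
  \<open>Y\<close> are averages of their eigenvalues, weighted by the squared moduli of the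
  transition unitaries, so scalar Jensen applies. The mean is written \<open>X + Y = Z + Z\<close>,
  the shape that the parallelogram law delivers.\<close>

lemma spec_sum_mean:
  assumes "psd N X" "psd N Y" "psd N Z" "X + Y = Z + Z" "p > 0" "p \<noteq> 2"
  shows "sgn (1 - p / 2) * (spec_sum p X + spec_sum p Y) \<le> 2 * (sgn (1 - p / 2) * spec_sum p Z)"
proof -
  obtain V x where V: "unitary_mat N V" and x: "\<And>i. i < N \<Longrightarrow> x i \<ge> (0::real)"
    and X: "X = V * dmat N (\<lambda>i. complex_of_real (x i)) * adj V"
    using assms(1) unfolding psd_def by blast
  obtain V' y where V': "unitary_mat N V'" and y: "\<And>i. i < N \<Longrightarrow> y i \<ge> (0::real)"
    and Y: "Y = V' * dmat N (\<lambda>i. complex_of_real (y i)) * adj V'"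
    using assms(2) unfolding psd_def by blast
  obtain U z where U: "unitary_mat N U" and z: "\<And>i. i < N \<Longrightarrow> z i \<ge> (0::real)"
    and Z: "Z = U * dmat N (\<lambda>i. complex_of_real (z i)) * adj U"
    using assms(3) unfolding psd_def by blast
  define W where "W = adj V * U" define W' where "W' = adj V' * U"
  have W: "unitary_mat N W" and W': "unitary_mat N W'" using U V V' by (auto simp: W_def W'_def)
  note c = psd_carrier[OF assms(1)] psd_carrier[OF assms(2)] psd_carrier[OF assms(3)]
    unitary_matD(1)[OF U] unitary_matD(1)[OF W] unitary_matD(1)[OF W']
  have D: "adj U * Z * U = dmat N (\<lambda>i. complex_of_real (z i))"
    unfolding Z using unitary_conj_inverse(2)[OF U U, of "dmat N (\<lambda>i. complex_of_real (z i))"] by simp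
  have eq: "(\<Sum>k<N. x k * (cmod (W $$ (k, i)))\<^sup>2) + (\<Sum>k<N. y k * (cmod (W' $$ (k, i)))\<^sup>2) = 2 * z i"
    if i: "i < N" for i
  proof -
    have "(adj U * X * U) $$ (i, i) + (adj U * Y * U) $$ (i, i) = (adj U * Z * U) $$ (i, i) + (adj U * Z * U) $$ (i, i)"
      unfolding conj_add_index[OF c(4,1,2) i i, symmetric] conj_add_index[OF c(4,3,3) i i, symmetric] assms(4) ..
    moreover have "(adj U * X * U) $$ (i, i) = complex_of_real (\<Sum>k<N. x k * (cmod (W $$ (k, i)))\<^sup>2)"
      unfolding diagonal_conj[OF V U X] W_def[symmetric] using c i
      by (simp add: adj_dmat_conj_index complex_norm_square mult.commute del: of_real_power)
    moreover have "(adj U * Y * U) $$ (i, i) = complex_of_real (\<Sum>k<N. y k * (cmod (W' $$ (k, i)))\<^sup>2)"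
      unfolding diagonal_conj[OF V' U Y] W'_def[symmetric] using c i
      by (simp add: adj_dmat_conj_index complex_norm_square mult.commute del: of_real_power)
    ultimately have "complex_of_real ((\<Sum>k<N. x k * (cmod (W $$ (k, i)))\<^sup>2) + (\<Sum>k<N. y k * (cmod (W' $$ (k, i)))\<^sup>2))
        = complex_of_real (2 * z i)"
      using i by (simp add: D)
    thus ?thesis using of_real_eq_iff by blast
  qed
  have "sgn (1 - p / 2) * ((\<Sum>k<N. x k powr (p / 2)) + (\<Sum>k<N. y k powr (p / 2)))
      \<le> 2 * (sgn (1 - p / 2) * (\<Sum>i<N. z i powr (p / 2)))"
    by (rule weighted_powr_jensen[of _ _ _ _ "\<lambda>k i. (cmod (W $$ (k, i)))\<^sup>2" "\<lambda>k i. (cmod (W' $$ (k, i)))\<^sup>2"])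
      (use assms(5,6) x y eq unitary_entry_norms[OF W] unitary_entry_norms[OF W'] in auto)
  moreover have "spec_sum p X = (\<Sum>k<N. x k powr (p / 2))" "spec_sum p Y = (\<Sum>k<N. y k powr (p / 2))"
    "spec_sum p Z = (\<Sum>k<N. z k powr (p / 2))"
    using spec_sum_diagonal[OF V X] spec_sum_diagonal[OF V' Y] spec_sum_diagonal[OF U Z] x y z by blast+
  ultimately show ?thesis by simp
qed

text \<open>With \<open>Z = P + Q\<close> the trace of the \<open>q\<close>-th power of
  \<open>Z\<close> splits into the mixed traces of \<open>P\<close> and of \<open>Q\<close>, which
  \<open>mixed_le\<close> bounds separately. Equality makes every term tight and kills the inner
  products between eigenvectors with nonzero \<open>a\<close> and \<open>b\<close>; up to scaling
  these are the entries of \<open>Q * P\<close> in the two eigenbases.\<close>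

lemma spec_sum_add:
  assumes "psd N P" "psd N Q" "p > 0" "p \<noteq> 2"
  shows "sgn (1 - p / 2) * spec_sum p (P + Q) \<le> sgn (1 - p / 2) * (spec_sum p P + spec_sum p Q)"
    and "spec_sum p (P + Q) = spec_sum p P + spec_sum p Q \<longleftrightarrow> Q * P = 0\<^sub>m N N"
proof -
  obtain V a where V: "unitary_mat N V" and a: "\<And>i. i < N \<Longrightarrow> a i \<ge> (0::real)"
    and P: "P = V * dmat N (\<lambda>i. complex_of_real (a i)) * adj V"
    using assms(1) unfolding psd_def by blast
  obtain V' b where V': "unitary_mat N V'" and b: "\<And>i. i < N \<Longrightarrow> b i \<ge> (0::real)"
    and Q: "Q = V' * dmat N (\<lambda>i. complex_of_real (b i)) * adj V'"
    using assms(2) unfolding psd_def by blast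
  obtain U z where U: "unitary_mat N U" and z: "\<And>i. i < N \<Longrightarrow> z i \<ge> (0::real)"
    and Z: "P + Q = U * dmat N (\<lambda>i. complex_of_real (z i)) * adj U"
    using psd_add[OF assms(1,2)] unfolding psd_def by blast
  define W where "W = adj V * U" define W' where "W' = adj V' * U"
  have W: "unitary_mat N W" and W': "unitary_mat N W'" using U V V' by (auto simp: W_def W'_def)
  note c = psd_carrier[OF assms(1)] psd_carrier[OF assms(2)]
    unitary_matD(1)[OF U] unitary_matD(1)[OF W] unitary_matD(1)[OF W']
  have D: "adj U * (P + Q) * U = dmat N (\<lambda>i. complex_of_real (z i))"
    unfolding Z using unitary_conj_inverse(2)[OF U U, of "dmat N (\<lambda>i. complex_of_real (z i))"] by simp
  have eq: "(\<Sum>l<N. a l * (cnj (W $$ (l, i)) * W $$ (l, j))) + (\<Sum>l<N. b l * (cnj (W' $$ (l, i)) * W' $$ (l, j)))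
        = (if i = j then complex_of_real (z i) else 0)" if ij: "i < N" "j < N" for i j
  proof -
    have "(adj U * P * U) $$ (i, j) + (adj U * Q * U) $$ (i, j) = (adj U * (P + Q) * U) $$ (i, j)"
      by (rule conj_add_index[OF c(3,1,2) ij, symmetric])
    moreover have "(adj U * P * U) $$ (i, j) = (\<Sum>l<N. a l * (cnj (W $$ (l, i)) * W $$ (l, j)))"
      unfolding diagonal_conj[OF V U P] W_def[symmetric] using c ij by (simp add: adj_dmat_conj_index)
    moreover have "(adj U * Q * U) $$ (i, j) = (\<Sum>l<N. b l * (cnj (W' $$ (l, i)) * W' $$ (l, j)))"
      unfolding diagonal_conj[OF V' U Q] W'_def[symmetric] using c ij by (simp add: adj_dmat_conj_index)
    ultimately show ?thesis using ij by (simp add: D)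
  qed
  \<comment> \<open>The locale is used twice, with \<open>P\<close> and \<open>Q\<close> exchanging
    roles over one eigenbasis of the sum.\<close>
  interpret PQ: diagonal_sum N "\<lambda>l i. W $$ (l, i)" "\<lambda>l i. W' $$ (l, i)" a b z
    using a b unitary_entry_sums(1)[OF W] eq by unfold_locales auto
  interpret QP: diagonal_sum N "\<lambda>l i. W' $$ (l, i)" "\<lambda>l i. W $$ (l, i)" b a z
    using a b unitary_entry_sums(1)[OF W'] eq by unfold_locales (auto simp: add.commute)
  define q s where "q = p / 2" and "s = sgn (1 - q)"
  have q: "q > 0" "q \<noteq> 1" and s0: "s \<noteq> 0" using assms by (auto simp: q_def s_def sgn_if)
  have SP: "spec_sum p P = (\<Sum>k<N. a k powr q)" and SQ: "spec_sum p Q = (\<Sum>k<N. b k powr q)"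
    and SZ: "spec_sum p (P + Q) = (\<Sum>k<N. z k powr q)"
    unfolding q_def using spec_sum_diagonal[OF V P] spec_sum_diagonal[OF V' Q] spec_sum_diagonal[OF U Z] a b z by blast+
  have "(\<Sum>k<N. PQ.mixed q k) + (\<Sum>k<N. QP.mixed q k) = (\<Sum>i<N. z i * z i powr (q - 1))"
  proof -
    have "(\<Sum>k<N. PQ.mixed q k) + (\<Sum>k<N. QP.mixed q k)
        = (\<Sum>i<N. \<Sum>k<N. a k * (cmod (W $$ (k, i)))\<^sup>2 * z i powr (q - 1))
          + (\<Sum>i<N. \<Sum>k<N. b k * (cmod (W' $$ (k, i)))\<^sup>2 * z i powr (q - 1))"
      unfolding PQ.mixed_def QP.mixed_def by (intro arg_cong2[of _ _ _ _ "(+)"] sum.swap)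
    also have "\<dots> = (\<Sum>i<N. z i * z i powr (q - 1))"
      unfolding sum.distrib[symmetric] sum_distrib_right[symmetric]
      by (intro sum.cong refl) (simp add: PQ.z_eq sum.distrib sum_distrib_right distrib_right)
    finally show ?thesis .
  qed
  also have "\<dots> = (\<Sum>k<N. z k powr q)"
  proof (intro sum.cong refl)
    fix i assume "i \<in> {..<N}"
    thus "z i * z i powr (q - 1) = z i powr q" using z[of i] by (cases "z i = 0") (auto simp: powr_diff)
  qed
  finally have Zsum: "(\<Sum>k<N. PQ.mixed q k) + (\<Sum>k<N. QP.mixed q k) = (\<Sum>k<N. z k powr q)" .
  have leP: "(\<Sum>k<N. s * PQ.mixed q k) \<le> (\<Sum>k<N. s * a k powr q)"
    unfolding s_def by (intro sum_mono PQ.mixed_le q) auto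
  have leQ: "(\<Sum>k<N. s * QP.mixed q k) \<le> (\<Sum>k<N. s * b k powr q)"
    unfolding s_def by (intro sum_mono QP.mixed_le q) auto
  have sZ: "s * spec_sum p (P + Q) = (\<Sum>k<N. s * PQ.mixed q k) + (\<Sum>k<N. s * QP.mixed q k)"
    unfolding SZ Zsum[symmetric] by (simp add: sum_distrib_left distrib_left)
  have sPQ: "s * (spec_sum p P + spec_sum p Q) = (\<Sum>k<N. s * a k powr q) + (\<Sum>k<N. s * b k powr q)"
    unfolding SP SQ by (simp add: sum_distrib_left distrib_left)
  show "sgn (1 - p / 2) * spec_sum p (P + Q) \<le> sgn (1 - p / 2) * (spec_sum p P + spec_sum p Q)"
    using leP leQ sZ sPQ by (simp add: s_def q_def)
  \<comment> \<open>\<open>Q * P\<close> read from the eigenbasis of \<open>P\<close> to that of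
    \<open>Q\<close>; its \<open>(l, k)\<close> entry is the expression in
    \<open>mixed_eq_imp\<close>.\<close>
  define R where "R = dmat N (\<lambda>i. complex_of_real (b i)) * (W' * adj W) * dmat N (\<lambda>i. complex_of_real (a i))"
  have Rc: "R \<in> carrier_mat N N" using c by (auto simp: R_def intro!: square_mult_carrier)
  have Rindex: "R $$ (l, k) = a k * b l * (\<Sum>j<N. W' $$ (l, j) * cnj (W $$ (k, j)))" if "k < N" "l < N" for k l
  proof -
    have "R $$ (l, k) = b l * (W' * adj W) $$ (l, k) * a k"
      using that c by (simp add: R_def dmat_mult_index square_mult_carrier)
    also have "(W' * adj W) $$ (l, k) = (\<Sum>j<N. W' $$ (l, j) * cnj (W $$ (k, j)))"
      using that c by (simp add: mult_index[of _ N N _ N])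
    finally show ?thesis by simp
  qed
  have WW: "W' * adj W = adj V' * V"
  proof -
    have "W' * adj W = adj V' * (U * adj U) * V"
      unfolding W_def W'_def using unitary_matD(1)[OF U] unitary_matD(1)[OF V] unitary_matD(1)[OF V']
      by (simp add: adj_mult[where a = N and b = N and c = N] square_simps[where n = N])
    thus ?thesis using unitary_matD(1,3)[OF U] unitary_matD(1)[OF V'] by simp
  qed
  have QP: "Q * P = V' * R * adj V"
    unfolding P Q R_def WW using unitary_matD(1)[OF V] unitary_matD(1)[OF V']
    by (simp add: square_simps[where n = N])
  have R: "R = adj V' * (Q * P) * V"
    unfolding QP using unitary_conj_inverse(2)[OF V' V Rc] by simp
  have Riff: "R = 0\<^sub>m N N \<longleftrightarrow> Q * P = 0\<^sub>m N N"
  proof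
    assume "R = 0\<^sub>m N N" thus "Q * P = 0\<^sub>m N N"
      using unitary_matD(1)[OF V] unitary_matD(1)[OF V'] by (simp add: QP)
  next
    assume "Q * P = 0\<^sub>m N N" thus "R = 0\<^sub>m N N"
      using unitary_matD(1)[OF V] unitary_matD(1)[OF V'] by (simp add: R)
  qed
  show "spec_sum p (P + Q) = spec_sum p P + spec_sum p Q \<longleftrightarrow> Q * P = 0\<^sub>m N N"
  proof
    assume "spec_sum p (P + Q) = spec_sum p P + spec_sum p Q"
    hence eqP: "(\<Sum>k<N. s * PQ.mixed q k) = (\<Sum>k<N. s * a k powr q)"
      using leP leQ sZ sPQ by simp
    have "s * PQ.mixed q k = s * a k powr q" if "k < N" for k
      by (rule sum_mono_inv[OF eqP]) (simp_all add: s_def PQ.mixed_le[OF q] that)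
    hence "PQ.mixed q k = a k powr q" if "k < N" for k
      using that s0 by simp
    hence "a k * b l * (\<Sum>j<N. W' $$ (l, j) * cnj (W $$ (k, j))) = 0" if "k < N" "l < N" for k l
      using PQ.mixed_eq_imp[OF q] that by simp
    hence "R = 0\<^sub>m N N" using Rindex Rc by (intro eq_matI) auto
    thus "Q * P = 0\<^sub>m N N" by (simp add: Riff)
  next
    assume "Q * P = 0\<^sub>m N N"
    hence "R = 0\<^sub>m N N" by (simp add: Riff)
    hence 0: "a k * b l * (\<Sum>j<N. W' $$ (l, j) * cnj (W $$ (k, j))) = 0" if "k < N" "l < N" for k l
      using Rindex[OF that] that by simp
    have 1: "b k * a l * (\<Sum>j<N. W $$ (l, j) * cnj (W' $$ (k, j))) = 0" if "k < N" "l < N" for k l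
      using arg_cong[OF 0[OF that(2,1)], of cnj] by (simp add: mult_ac)
    have "PQ.mixed q k = a k powr q" "QP.mixed q k = b k powr q" if "k < N" for k
      using PQ.mixed_eqI[OF q that] QP.mixed_eqI[OF q that] 0 1 that by blast+
    thus "spec_sum p (P + Q) = spec_sum p P + spec_sum p Q"
      unfolding SP SQ SZ Zsum[symmetric] by simp
  qed
qed

section \<open>Orthogonality and the equality case of Clarkson's inequality\<close>

definition orth :: "nat \<Rightarrow> complex mat \<Rightarrow> complex mat \<Rightarrow> bool" where
  "orth N X Y \<longleftrightarrow> adj X * Y = 0\<^sub>m N N \<and> X * adj Y = 0\<^sub>m N N"

lemma gram_eq_zero:
  assumes X: "X \<in> carrier_mat N N" and 0: "adj X * X = 0\<^sub>m N N"
  shows "X = 0\<^sub>m N N"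
proof (rule eq_matI)
  fix k i assume "k < dim_row (0\<^sub>m N N)" "i < dim_col (0\<^sub>m N N)"
  hence ki: "k < N" "i < N" by auto
  have "complex_of_real (\<Sum>k<N. (cmod (X $$ (k, i)))\<^sup>2) = 0"
    using gram_diag[OF X ki(2)] 0 ki by simp
  hence "(\<Sum>k<N. (cmod (X $$ (k, i)))\<^sup>2) = 0" using of_real_eq_0_iff by blast
  hence "(cmod (X $$ (k, i)))\<^sup>2 = 0" using ki by (subst (asm) sum_nonneg_eq_0_iff) auto
  thus "X $$ (k, i) = 0\<^sub>m N N $$ (k, i)" using ki by simp
qed (use X in auto)

text \<open>Gram factors are cancelled one side at a time. With \<open>M = X * adj Y\<close>, the
  Gram matrix of \<open>M * Y\<close> contains the zero product, so \<open>M * Y = 0\<close>; then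
  \<open>M * adj M = M * Y * adj X\<close> vanishes too.\<close>

lemma gram_mult_eq_zero:
  assumes X: "X \<in> carrier_mat N N" and Y: "Y \<in> carrier_mat N N"
    and 0: "(adj X * X) * (adj Y * Y) = 0\<^sub>m N N"
  shows "X * adj Y = 0\<^sub>m N N"
proof -
  define M where "M = X * adj Y"
  have M: "M \<in> carrier_mat N N" using X Y by (auto simp: M_def intro!: square_mult_carrier)
  have "adj (M * Y) * (M * Y) = (adj Y * Y) * ((adj X * X) * (adj Y * Y))"
    unfolding M_def using X Y
    by (simp add: adj_mult[where a = N and b = N and c = N] square_simps[where n = N])
  also have "\<dots> = 0\<^sub>m N N" unfolding 0 using Y by (simp add: square_mult_carrier)
  finally have MY: "M * Y = 0\<^sub>m N N" by (rule gram_eq_zero[OF square_mult_carrier[OF M Y]])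
  have "adj (adj M) * adj M = (M * Y) * adj X"
    unfolding M_def using X Y
    by (simp add: adj_mult[where a = N and b = N and c = N] square_simps[where n = N])
  also have "\<dots> = 0\<^sub>m N N" unfolding MY using X by simp
  finally have "adj M = 0\<^sub>m N N" by (rule gram_eq_zero[OF adj_carrier[OF M]])
  hence "adj (adj M) = adj (0\<^sub>m N N)" by simp
  thus ?thesis by (simp add: M_def)
qed

lemma spec_sum_adj:
  assumes "X \<in> carrier_mat N N"
  shows "spec_sum p (adj (adj X) * adj X) = spec_sum p (adj X * X)"
  using char_poly_mult_commute[of X N "adj X"] assms by (simp add: spec_sum_def)

lemma gram_add_orth:
  assumes "X \<in> carrier_mat N N" "Y \<in> carrier_mat N N" "adj X * Y = 0\<^sub>m N N"
  shows "adj (X + Y) * (X + Y) = adj X * X + adj Y * Y"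
proof -
  have "adj (adj X * Y) = adj Y * X"
    using assms(1,2) by (simp add: adj_mult[where a = N and b = N and c = N])
  hence "adj Y * X = 0\<^sub>m N N" by (simp add: assms(3))
  thus ?thesis using assms
    by (simp add: adj_add[of _ N N] mult_add_distrib_mat[of _ N N _ N] add_mult_distrib_mat[of _ N N _ _ N] square_mult_carrier)
qed

text \<open>The two halves of orthogonality act separately: \<open>adj X * Y = 0\<close> makes the
  Gram matrix additive, and \<open>X * adj Y = 0\<close> makes the two Gram matrices multiply to
  zero, the equality case of \<open>spec_sum_add\<close>.\<close>

theorem spec_sum_orth:
  assumes p: "p > 0" "p \<noteq> 2" and X: "X \<in> carrier_mat N N" and Y: "Y \<in> carrier_mat N N"
    and orth: "orth N X Y"
  shows "spec_sum p (adj (X + Y) * (X + Y)) = spec_sum p (adj X * X) + spec_sum p (adj Y * Y)"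
proof -
  have "(adj Y * Y) * (adj X * X) = adj Y * adj (X * adj Y) * X"
    using X Y by (simp add: adj_mult[where a = N and b = N and c = N] square_simps[where n = N])
  also have "\<dots> = 0\<^sub>m N N" using orth X Y by (simp add: orth_def)
  finally show ?thesis
    using spec_sum_add(2)[OF psd_gram[OF X] psd_gram[OF Y] p] gram_add_orth[OF X Y] orth
    by (simp add: orth_def)
qed

lemma adj_uminus: "adj (- X) = - adj X"
  by (intro eq_matI) auto

lemma parallelogram_mat:
  assumes "X \<in> carrier_mat N N" "Y \<in> carrier_mat N N"
  shows "adj (X + Y) * (X + Y) + adj (X + - Y) * (X + - Y) = (adj X * X + adj Y * Y) + (adj X * X + adj Y * Y)"
    (is "?L = ?R")
proof (rule eq_matI)
  fix i j assume "i < dim_row ?R" "j < dim_col ?R"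
  hence ij: "i < N" "j < N" using assms by auto
  have gram: "(adj M * M) $$ (i, j) = (\<Sum>k<N. cnj (M $$ (k, i)) * M $$ (k, j))" if "M \<in> carrier_mat N N" for M
    using that ij by (simp add: mult_index[of _ N N _ N])
  have "?L $$ (i, j) = (\<Sum>k<N. cnj ((X + Y) $$ (k, i)) * (X + Y) $$ (k, j))
      + (\<Sum>k<N. cnj ((X + - Y) $$ (k, i)) * (X + - Y) $$ (k, j))"
    using assms ij by (subst index_add_mat) (auto simp: gram)
  also have "\<dots> = (\<Sum>k<N. cnj (X $$ (k, i)) * X $$ (k, j) + cnj (Y $$ (k, i)) * Y $$ (k, j)
      + (cnj (X $$ (k, i)) * X $$ (k, j) + cnj (Y $$ (k, i)) * Y $$ (k, j)))"
    unfolding sum.distrib[symmetric] using assms ij by (intro sum.cong) (auto simp: algebra_simps)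
  also have "\<dots> = ?R $$ (i, j)"
    using assms ij by (simp add: gram sum.distrib sum_distrib_left mult.commute)
  finally show "?L $$ (i, j) = ?R $$ (i, j)" .
qed (use assms in auto)

text \<open>Chaining \<open>spec_sum_mean\<close> with \<open>spec_sum_add\<close>, the hypotheses
  make both ends of the chain agree, so the second inequality is an equality and the Gram matrices
  multiply to zero. This yields only \<open>X * adj Y = 0\<close>; the adjoints have the same
  spectral sums and yield the other half.\<close>

theorem spec_sum_orth_converse:
  assumes p: "p > 0" "p \<noteq> 2" and X: "X \<in> carrier_mat N N" and Y: "Y \<in> carrier_mat N N"
    and plus: "spec_sum p (adj (X + Y) * (X + Y)) = spec_sum p (adj X * X) + spec_sum p (adj Y * Y)"
    and minus: "spec_sum p (adj (X + - Y) * (X + - Y)) = spec_sum p (adj X * X) + spec_sum p (adj Y * Y)"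
  shows "orth N X Y"
proof -
  have right: "X * adj Y = 0\<^sub>m N N"
    if X: "X \<in> carrier_mat N N" and Y: "Y \<in> carrier_mat N N"
      and plus: "spec_sum p (adj (X + Y) * (X + Y)) = spec_sum p (adj X * X) + spec_sum p (adj Y * Y)"
      and minus: "spec_sum p (adj (X + - Y) * (X + - Y)) = spec_sum p (adj X * X) + spec_sum p (adj Y * Y)"
    for X Y
  proof -
    define s where "s = sgn (1 - p / 2)"
    have s0: "s \<noteq> 0" using p by (auto simp: s_def sgn_if)
    have "s * (spec_sum p (adj (X + Y) * (X + Y)) + spec_sum p (adj (X + - Y) * (X + - Y)))
        \<le> 2 * (s * spec_sum p (adj X * X + adj Y * Y))"
      unfolding s_def using X Y p
      by (intro spec_sum_mean[of N] psd_gram psd_add parallelogram_mat) auto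
    moreover have "s * spec_sum p (adj X * X + adj Y * Y) \<le> s * (spec_sum p (adj X * X) + spec_sum p (adj Y * Y))"
      unfolding s_def by (rule spec_sum_add(1)[OF psd_gram[OF X] psd_gram[OF Y] p])
    ultimately have "s * spec_sum p (adj X * X + adj Y * Y) = s * (spec_sum p (adj X * X) + spec_sum p (adj Y * Y))"
      unfolding plus minus distrib_left by linarith
    hence "spec_sum p (adj X * X + adj Y * Y) = spec_sum p (adj X * X) + spec_sum p (adj Y * Y)"
      using s0 by simp
    hence "(adj Y * Y) * (adj X * X) = 0\<^sub>m N N"
      using spec_sum_add(2)[OF psd_gram[OF X] psd_gram[OF Y] p] by simp
    hence "Y * adj X = 0\<^sub>m N N" by (rule gram_mult_eq_zero[OF Y X])
    hence "adj (Y * adj X) = adj (0\<^sub>m N N)" by simp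
    thus ?thesis using X Y by (simp add: adj_mult[where a = N and b = N and c = N])
  qed
  have "adj (adj X + adj Y) * (adj X + adj Y) = adj (adj (X + Y)) * adj (X + Y)"
    "adj (adj X + - adj Y) * (adj X + - adj Y) = adj (adj (X + - Y)) * adj (X + - Y)"
    using X Y by (simp_all add: adj_add[of _ N N] adj_uminus)
  hence "adj X * adj (adj Y) = 0\<^sub>m N N"
    using X Y plus minus by (intro right) (simp_all add: spec_sum_adj[of _ N] del: adj_adj)
  thus ?thesis using right[OF X Y plus minus] by (simp add: orth_def)
qed

section \<open>Matrix units\<close>

definition munit :: "nat \<Rightarrow> nat \<Rightarrow> nat \<Rightarrow> complex mat" where
  "munit n r s = mat n n (\<lambda>(i, j). if i = r \<and> j = s then 1 else 0)"

lemma munit_carrier [simp, intro]: "munit n r s \<in> carrier_mat n n"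
  by (simp add: munit_def)

lemma dim_munit [simp]: "dim_row (munit n r s) = n" "dim_col (munit n r s) = n"
  by (simp_all add: munit_def)

lemma munit_index [simp]:
  "i < n \<Longrightarrow> j < n \<Longrightarrow> munit n r s $$ (i, j) = (if i = r \<and> j = s then 1 else 0)"
  by (simp add: munit_def)

lemma transpose_munit [simp]: "(munit n r s)\<^sup>T = munit n s r"
  by (intro eq_matI) auto

lemma sum_single:
  fixes f :: "nat \<Rightarrow> 'a :: comm_monoid_add"
  assumes "p < N" "\<And>u. u < N \<Longrightarrow> u \<noteq> p \<Longrightarrow> f u = 0"
  shows "(\<Sum>u<N. f u) = f p"
proof -
  have "(\<Sum>u<N. f u) = (\<Sum>u\<in>{p}. f u)"
    using assms by (intro sum.mono_neutral_right) auto
  thus ?thesis by simp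
qed

lemma adj_mult_index:
  assumes "X \<in> carrier_mat N N" "Y \<in> carrier_mat N N" "c < N" "d < N"
  shows "(adj X * Y) $$ (c, d) = (\<Sum>u<N. cnj (X $$ (u, c)) * Y $$ (u, d))"
    and "(X * adj Y) $$ (c, d) = (\<Sum>u<N. X $$ (c, u) * cnj (Y $$ (d, u)))"
  using assms by (auto simp: mult_index[of _ N N _ N])

lemma orthI:
  assumes "X \<in> carrier_mat N N" "Y \<in> carrier_mat N N"
    and "\<And>c d. c < N \<Longrightarrow> d < N \<Longrightarrow> (\<Sum>u<N. cnj (X $$ (u, c)) * Y $$ (u, d)) = 0"
    and "\<And>c d. c < N \<Longrightarrow> d < N \<Longrightarrow> (\<Sum>u<N. X $$ (c, u) * cnj (Y $$ (d, u))) = 0"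
  shows "orth N X Y"
  unfolding orth_def using assms(1,2)
  by (auto intro!: eq_matI simp: adj_mult_index[OF assms(1,2)] assms(3,4))

lemma orthD:
  assumes "orth N X Y" "X \<in> carrier_mat N N" "Y \<in> carrier_mat N N" "c < N" "d < N"
  shows "(\<Sum>u<N. cnj (X $$ (u, c)) * Y $$ (u, d)) = 0"
    and "(\<Sum>u<N. X $$ (c, u) * cnj (Y $$ (d, u))) = 0"
  using assms(1) adj_mult_index[OF assms(2-5)] assms(4,5) by (auto simp: orth_def)

lemma orth_transpose:
  assumes "orth N X Y" "X \<in> carrier_mat N N" "Y \<in> carrier_mat N N"
  shows "orth N X\<^sup>T Y\<^sup>T"
proof (rule orthI)
  fix c d assume cd: "c < N" "d < N"
  have "(\<Sum>u<N. cnj (X\<^sup>T $$ (u, c)) * Y\<^sup>T $$ (u, d)) = cnj (\<Sum>u<N. X $$ (c, u) * cnj (Y $$ (d, u)))"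
    unfolding cnj_sum using assms(2,3) cd by (intro sum.cong) auto
  thus "(\<Sum>u<N. cnj (X\<^sup>T $$ (u, c)) * Y\<^sup>T $$ (u, d)) = 0"
    by (simp only: orthD(2)[OF assms cd] complex_cnj_zero)
  have "(\<Sum>u<N. X\<^sup>T $$ (c, u) * cnj (Y\<^sup>T $$ (d, u))) = cnj (\<Sum>u<N. cnj (X $$ (u, c)) * Y $$ (u, d))"
    unfolding cnj_sum using assms(2,3) cd by (intro sum.cong) auto
  thus "(\<Sum>u<N. X\<^sup>T $$ (c, u) * cnj (Y\<^sup>T $$ (d, u))) = 0"
    by (simp only: orthD(1)[OF assms cd] complex_cnj_zero)
qed (use assms in auto)

lemma orth_munit_entries:
  assumes "orth N (munit N p p) X" "X \<in> carrier_mat N N" "p < N" "c < N"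
  shows "X $$ (p, c) = 0" "X $$ (c, p) = 0"
proof -
  have "(\<Sum>u<N. cnj (munit N p p $$ (u, p)) * X $$ (u, c)) = X $$ (p, c)"
    using assms by (subst sum_single[of p]) auto
  thus "X $$ (p, c) = 0" using orthD(1)[OF assms(1) _ assms(2,3,4)] by simp
  have "(\<Sum>u<N. munit N p p $$ (p, u) * cnj (X $$ (c, u))) = cnj (X $$ (c, p))"
    using assms by (subst sum_single[of p]) auto
  thus "X $$ (c, p) = 0" using orthD(2)[OF assms(1) _ assms(2,3,4)] by simp
qed

section \<open>Rank-one matrices and forms vanishing on orthogonal pairs\<close>

definition rank_one :: "nat \<Rightarrow> (nat \<Rightarrow> complex) \<Rightarrow> (nat \<Rightarrow> complex) \<Rightarrow> complex mat" where
  "rank_one n u v = mat n n (\<lambda>(i, j). u i * v j)"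

lemma orth_rank_one:
  assumes "(\<Sum>i<n. cnj (u i) * u' i) = 0" "(\<Sum>i<n. v i * cnj (v' i)) = 0"
  shows "orth n (rank_one n u v) (rank_one n u' v')"
proof (rule orthI)
  fix c d assume cd: "c < n" "d < n"
  have "(\<Sum>i<n. cnj (rank_one n u v $$ (i, c)) * rank_one n u' v' $$ (i, d))
      = cnj (v c) * v' d * (\<Sum>i<n. cnj (u i) * u' i)"
    unfolding sum_distrib_left using cd by (intro sum.cong) (auto simp: rank_one_def)
  thus "(\<Sum>i<n. cnj (rank_one n u v $$ (i, c)) * rank_one n u' v' $$ (i, d)) = 0"
    by (simp add: assms(1))
  have "(\<Sum>i<n. rank_one n u v $$ (c, i) * cnj (rank_one n u' v' $$ (d, i)))
      = u c * cnj (u' d) * (\<Sum>i<n. v i * cnj (v' i))"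
    unfolding sum_distrib_left using cd by (intro sum.cong) (auto simp: rank_one_def)
  thus "(\<Sum>i<n. rank_one n u v $$ (c, i) * cnj (rank_one n u' v' $$ (d, i))) = 0"
    by (simp add: assms(2))
qed (auto simp: rank_one_def)

definition basis_fun :: "nat \<Rightarrow> nat \<Rightarrow> complex" where
  "basis_fun r i = (if i = r then 1 else 0)"

lemma basis_fun_simps [simp]:
  "basis_fun r r = 1" "i \<noteq> r \<Longrightarrow> basis_fun r i = 0" "cnj (basis_fun r i) = basis_fun r i"
  by (auto simp: basis_fun_def)

lemma sum_basis_fun [simp]:
  assumes "r < n"
  shows "(\<Sum>i<n. basis_fun r i * f i) = f r"
  using assms by (subst sum_single[of r]) auto

text \<open>All members have rank one, with basis vectors or their sums and differences as factors,
  and \<open>e + e'\<close> is orthogonal to \<open>e - e'\<close>. Expanding a form that vanishes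
  on these four pairs gives the relations in \<open>orth_form\<close>.\<close>

lemma munit_orth:
  assumes "r < n" "s < n" "r' < n" "s' < n" "r \<noteq> r'" "s \<noteq> s'"
  shows "orth n (munit n r s) (munit n r' s')"
    and "orth n (munit n r s + munit n r s') (munit n r' s + - munit n r' s')"
    and "orth n (munit n r s + munit n r' s) (munit n r s' + - munit n r' s')"
    and "orth n ((munit n r s + munit n r' s') + (munit n r s' + munit n r' s))
      ((munit n r s + munit n r' s') + - (munit n r s' + munit n r' s))"
proof -
  note [simp] = distrib_left distrib_right left_diff_distrib right_diff_distrib sum.distrib sum_subtractf
  note neq = assms(5,6) assms(5,6)[symmetric]
  have "munit n r s = rank_one n (basis_fun r) (basis_fun s)" "munit n r' s' = rank_one n (basis_fun r') (basis_fun s')"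
    by (auto simp: rank_one_def basis_fun_def intro!: eq_matI)
  thus "orth n (munit n r s) (munit n r' s')"
    using assms neq by (simp add: orth_rank_one)
  have "munit n r s + munit n r s' = rank_one n (basis_fun r) (\<lambda>i. basis_fun s i + basis_fun s' i)"
    "munit n r' s + - munit n r' s' = rank_one n (basis_fun r') (\<lambda>i. basis_fun s i - basis_fun s' i)"
    using assms by (auto simp: rank_one_def basis_fun_def intro!: eq_matI)
  thus "orth n (munit n r s + munit n r s') (munit n r' s + - munit n r' s')"
    using assms neq by (simp add: orth_rank_one)
  have "munit n r s + munit n r' s = rank_one n (\<lambda>i. basis_fun r i + basis_fun r' i) (basis_fun s)"
    "munit n r s' + - munit n r' s' = rank_one n (\<lambda>i. basis_fun r i - basis_fun r' i) (basis_fun s')"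
    using assms by (auto simp: rank_one_def basis_fun_def intro!: eq_matI)
  thus "orth n (munit n r s + munit n r' s) (munit n r s' + - munit n r' s')"
    using assms neq by (simp add: orth_rank_one)
  have "(munit n r s + munit n r' s') + (munit n r s' + munit n r' s)
      = rank_one n (\<lambda>i. basis_fun r i + basis_fun r' i) (\<lambda>i. basis_fun s i + basis_fun s' i)"
    "(munit n r s + munit n r' s') + - (munit n r s' + munit n r' s)
      = rank_one n (\<lambda>i. basis_fun r i - basis_fun r' i) (\<lambda>i. basis_fun s i - basis_fun s' i)"
    using assms by (auto simp: rank_one_def basis_fun_def intro!: eq_matI)
  thus "orth n ((munit n r s + munit n r' s') + (munit n r s' + munit n r' s))
      ((munit n r s + munit n r' s') + - (munit n r s' + munit n r' s))"
    using assms neq by (simp add: orth_rank_one)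
qed

text \<open>Models one entry of \<open>adj (h A) * h' B\<close> or of
  \<open>h A * adj (h' B)\<close>. The former is conjugate-linear on the left, the latter on the
  right; additivity and the sign are what they share.\<close>

locale orth_form =
  fixes n :: nat and S :: "complex mat \<Rightarrow> complex mat \<Rightarrow> complex"
  assumes add_left: "A \<in> carrier_mat n n \<Longrightarrow> B \<in> carrier_mat n n \<Longrightarrow> C \<in> carrier_mat n n \<Longrightarrow>
      S (A + B) C = S A C + S B C"
    and add_right: "A \<in> carrier_mat n n \<Longrightarrow> B \<in> carrier_mat n n \<Longrightarrow> C \<in> carrier_mat n n \<Longrightarrow>
      S A (B + C) = S A B + S A C"
    and uminus_right: "A \<in> carrier_mat n n \<Longrightarrow> B \<in> carrier_mat n n \<Longrightarrow> S A (- B) = - S A B"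
    and orth_zero: "A \<in> carrier_mat n n \<Longrightarrow> B \<in> carrier_mat n n \<Longrightarrow> orth n A B \<Longrightarrow> S A B = 0"
begin

abbreviation U :: "nat \<Rightarrow> nat \<Rightarrow> nat \<Rightarrow> nat \<Rightarrow> complex" where
  "U r s r' s' \<equiv> S (munit n r s) (munit n r' s')"

text \<open>Expanding the second and third pair of \<open>munit_orth\<close> gives four terms each,
  two of which vanish because their units differ in both indices. The other two must agree, so a
  value may be moved between columns or between rows.\<close>

lemma units:
  assumes "r < n" "s < n" "r' < n" "s' < n" "r \<noteq> r'" "s \<noteq> s'"
  shows units_zero: "U r s r' s' = 0"
    and units_col: "U r s r' s = U r s' r' s'"
    and units_row: "U r s r s' = U r' s r' s'"
proof -
  have zero: "U r s r' s' = 0"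
    if "r < n" "s < n" "r' < n" "s' < n" "r \<noteq> r'" "s \<noteq> s'" for r s r' s'
    by (intro orth_zero munit_orth that munit_carrier)
  show "U r s r' s' = 0" using zero assms by blast
  have "S (munit n r s + munit n r s') (munit n r' s + - munit n r' s') = 0"
    by (intro orth_zero munit_orth assms) auto
  thus "U r s r' s = U r s' r' s'"
    using zero[OF assms] zero[of r s' r' s] assms by (simp add: add_left add_right uminus_right)
  have "S (munit n r s + munit n r' s) (munit n r s' + - munit n r' s') = 0"
    by (intro orth_zero munit_orth assms) auto
  thus "U r s r s' = U r' s r' s'"
    using zero[OF assms] zero[of r' s r s'] assms by (simp add: add_left add_right uminus_right)
qed

text \<open>Of the sixteen terms of the fourth pair, those whose units differ in both indices vanish
  and those differing in one cancel by \<open>units_row\<close> and \<open>units_col\<close>. The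
  remaining relation between lengths supplies the normalization in \<open>ab_norm\<close>.\<close>

lemma units_diag:
  assumes "r < n" "s < n" "r' < n" "s' < n" "r \<noteq> r'" "s \<noteq> s'"
  shows "U r s r s + U r' s' r' s' = U r s' r s' + U r' s r' s"
proof -
  note a = assms
  have "S ((munit n r s + munit n r' s') + (munit n r s' + munit n r' s))
      ((munit n r s + munit n r' s') + - (munit n r s' + munit n r' s)) = 0"
    by (intro orth_zero munit_orth assms) auto
  hence "U r s r s + U r s r' s' + (U r' s' r s + U r' s' r' s')
      + (U r s' r s + U r s' r' s' + (U r' s r s + U r' s r' s'))
      - (U r s r s' + U r s r' s + (U r' s' r s' + U r' s' r' s)
      + (U r s' r s' + U r s' r' s + (U r' s r s' + U r' s r' s))) = 0"
    by (simp add: add_left add_right uminus_right algebra_simps)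
  moreover have "U r s r' s' = 0" "U r' s' r s = 0" "U r s' r' s = 0" "U r' s r s' = 0"
    using units_zero a by auto
  moreover have "U r s r s' = U r' s r' s'" "U r s' r s = U r' s' r' s"
    "U r s r' s = U r s' r' s'" "U r' s r s = U r' s' r s'"
    using units_row[OF a] units_row[of r s' r' s] units_col[OF a] units_col[of r' s r s'] a by auto
  ultimately show ?thesis by (simp add: algebra_simps)
qed

end

text \<open>Two sizes, because fixing one tensor factor gives maps from size \<open>m\<close> or
  \<open>n\<close> into size \<open>m * n\<close>.\<close>

definition linear_mm :: "nat \<Rightarrow> nat \<Rightarrow> (complex mat \<Rightarrow> complex mat) \<Rightarrow> bool" where
  "linear_mm n N h \<longleftrightarrow>
     (\<forall>A \<in> carrier_mat n n. h A \<in> carrier_mat N N) \<and>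
     (\<forall>A \<in> carrier_mat n n. \<forall>B \<in> carrier_mat n n. h (A + B) = h A + h B) \<and>
     (\<forall>c. \<forall>A \<in> carrier_mat n n. h (c \<cdot>\<^sub>m A) = c \<cdot>\<^sub>m h A)"

lemma linear_mmD:
  assumes "linear_mm n N h"
  shows "A \<in> carrier_mat n n \<Longrightarrow> h A \<in> carrier_mat N N"
    and "A \<in> carrier_mat n n \<Longrightarrow> B \<in> carrier_mat n n \<Longrightarrow> h (A + B) = h A + h B"
    and "A \<in> carrier_mat n n \<Longrightarrow> h (c \<cdot>\<^sub>m A) = c \<cdot>\<^sub>m h A"
    and "A \<in> carrier_mat n n \<Longrightarrow> h (- A) = - h A"
proof -
  show *: "A \<in> carrier_mat n n \<Longrightarrow> h A \<in> carrier_mat N N"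
    "A \<in> carrier_mat n n \<Longrightarrow> B \<in> carrier_mat n n \<Longrightarrow> h (A + B) = h A + h B"
    "A \<in> carrier_mat n n \<Longrightarrow> h (c \<cdot>\<^sub>m A) = c \<cdot>\<^sub>m h A" for A B c
    using assms by (auto simp: linear_mm_def)
  have "- A = (-1) \<cdot>\<^sub>m A" "- h A = (-1) \<cdot>\<^sub>m h A" by (auto intro!: eq_matI)
  thus "A \<in> carrier_mat n n \<Longrightarrow> h (- A) = - h A" using *(3)[of A "-1"] by metis
qed

lemma orth_form_adj:
  assumes h: "linear_mm n N h" and h': "linear_mm n N h'" and cd: "c < N" "d < N"
    and orth: "\<And>A B. A \<in> carrier_mat n n \<Longrightarrow> B \<in> carrier_mat n n \<Longrightarrow> orth n A B \<Longrightarrow> orth N (h A) (h' B)"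
  shows "orth_form n (\<lambda>A B. \<Sum>u<N. cnj (h A $$ (u, c)) * h' B $$ (u, d))"
    and "orth_form n (\<lambda>A B. \<Sum>u<N. h A $$ (c, u) * cnj (h' B $$ (d, u)))"
proof -
  note l = linear_mmD[OF h] linear_mmD[OF h']
  have dims [simp]: "dim_row (h A) = N" "dim_col (h A) = N" "dim_row (h' A) = N" "dim_col (h' A) = N"
    if "A \<in> carrier_mat n n" for A using l(1,5)[OF that] by auto
  show "orth_form n (\<lambda>A B. \<Sum>u<N. cnj (h A $$ (u, c)) * h' B $$ (u, d))"
  proof unfold_locales
    fix A B assume "A \<in> carrier_mat n n" "B \<in> carrier_mat n n" "orth n A B"
    thus "(\<Sum>u<N. cnj (h A $$ (u, c)) * h' B $$ (u, d)) = 0" using orthD(1)[OF orth] l(1,5) cd by blast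
  qed (use cd in \<open>simp_all add: l sum.distrib sum_negf distrib_left distrib_right\<close>)
  show "orth_form n (\<lambda>A B. \<Sum>u<N. h A $$ (c, u) * cnj (h' B $$ (d, u)))"
  proof unfold_locales
    fix A B assume "A \<in> carrier_mat n n" "B \<in> carrier_mat n n" "orth n A B"
    thus "(\<Sum>u<N. h A $$ (c, u) * cnj (h' B $$ (d, u))) = 0" using orthD(2)[OF orth] l(1,5) cd by blast
  qed (use cd in \<open>simp_all add: l sum.distrib sum_negf distrib_left distrib_right\<close>)
qed

section \<open>Orthogonality-preserving maps on matrix units\<close>

lemma sum_munit:
  assumes "p < N"
  shows "d < N \<Longrightarrow> (\<Sum>u<N. f u * munit N p p $$ (u, d)) = (if d = p then f p else 0)"
    and "d < N \<Longrightarrow> (\<Sum>u<N. munit N p p $$ (d, u) * f u) = (if d = p then f p else 0)"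
    and "d < N \<Longrightarrow> (\<Sum>u<N. cnj (munit N p p $$ (u, d)) * f u) = (if d = p then f p else 0)"
    and "d < N \<Longrightarrow> (\<Sum>u<N. f u * cnj (munit N p p $$ (d, u))) = (if d = p then f p else 0)"
  using assms by (subst sum_single[of p]; simp)+

locale unit_system =
  fixes n N :: nat and \<iota> :: "nat \<Rightarrow> nat" and h :: "complex mat \<Rightarrow> complex mat"
  assumes linear: "linear_mm n N h"
    and orth: "\<And>A B. A \<in> carrier_mat n n \<Longrightarrow> B \<in> carrier_mat n n \<Longrightarrow> orth n A B \<Longrightarrow> orth N (h A) (h B)"
    and index: "\<And>j. j < n \<Longrightarrow> \<iota> j < N"
    and inj: "\<And>j l. j < n \<Longrightarrow> l < n \<Longrightarrow> \<iota> j = \<iota> l \<Longrightarrow> j = l"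
    and diag: "\<And>j. j < n \<Longrightarrow> h (munit n j j) = munit N (\<iota> j) (\<iota> j)"
    and outside: "\<And>p A. p < N \<Longrightarrow> p \<notin> \<iota> ` {..<n} \<Longrightarrow> A \<in> carrier_mat n n \<Longrightarrow> orth N (munit N p p) (h A)"
begin

text \<open>The coefficient of the unit itself; \<open>b\<close> below is that of the transposed
  unit. For \<open>j \<noteq> l\<close> the identity has \<open>b j l = 0\<close> and transposition
  has \<open>a j l = 0\<close>.\<close>

definition a :: "nat \<Rightarrow> nat \<Rightarrow> complex" where "a j l = h (munit n j l) $$ (\<iota> j, \<iota> l)"
definition b :: "nat \<Rightarrow> nat \<Rightarrow> complex" where "b j l = h (munit n j l) $$ (\<iota> l, \<iota> j)"

lemma h_carrier [simp]: "h (munit n j l) \<in> carrier_mat N N"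
  using linear_mmD(1)[OF linear] by auto

lemma form: "c < N \<Longrightarrow> d < N \<Longrightarrow> orth_form n (\<lambda>A B. \<Sum>u<N. cnj (h A $$ (u, c)) * h B $$ (u, d))"
  and form': "c < N \<Longrightarrow> d < N \<Longrightarrow> orth_form n (\<lambda>A B. \<Sum>u<N. h A $$ (c, u) * cnj (h B $$ (d, u)))"
  using orth_form_adj[OF linear linear] orth by auto

text \<open>Diagonal units away from \<open>j\<close> and \<open>l\<close> are orthogonal to
  \<open>munit n j l\<close> and have known images, so orthogonality empties row and column
  \<open>p\<close>.\<close>

lemma support:
  assumes "j < n" "l < n" "p < N" "p \<noteq> \<iota> j" "p \<noteq> \<iota> l" "c < N"
  shows "h (munit n j l) $$ (p, c) = 0" "h (munit n j l) $$ (c, p) = 0"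
proof -
  have "orth N (munit N p p) (h (munit n j l))"
  proof (cases "p \<in> \<iota> ` {..<n}")
    case True
    then obtain s where s: "s < n" "p = \<iota> s" by auto
    have "orth n (munit n s s) (munit n j l)" using s assms by (intro munit_orth) auto
    thus ?thesis using orth[of "munit n s s" "munit n j l"] s by (simp add: diag)
  qed (use outside assms in auto)
  thus "h (munit n j l) $$ (p, c) = 0" "h (munit n j l) $$ (c, p) = 0"
    using orth_munit_entries assms h_carrier by blast+
qed

text \<open>Pairing with a diagonal image isolates one row. Moving the pairing by
  \<open>units_row\<close> or \<open>units_col\<close> brings in \<open>munit n l j\<close> and
  another diagonal image, which leaves a single entry.\<close>

lemma rows:
  assumes jl: "j < n" "l < n" "j \<noteq> l" and d: "d < N"
  shows "h (munit n j l) $$ (\<iota> j, d) = (if d = \<iota> l then cnj (a l j) else 0)"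
    and "h (munit n j l) $$ (\<iota> l, d) = (if d = \<iota> j then cnj (b l j) else 0)"
proof -
  interpret P: orth_form n "\<lambda>A B. \<Sum>u<N. cnj (h A $$ (u, \<iota> j)) * h B $$ (u, d)"
    using form index[OF jl(1)] d by blast
  interpret Q: orth_form n "\<lambda>A B. \<Sum>u<N. cnj (h A $$ (u, \<iota> l)) * h B $$ (u, d)"
    using form index[OF jl(2)] d by blast
  show "h (munit n j l) $$ (\<iota> j, d) = (if d = \<iota> l then cnj (a l j) else 0)"
    using P.units_row[of j j l l] jl d index by (simp add: diag sum_munit a_def del: munit_index)
  show "h (munit n j l) $$ (\<iota> l, d) = (if d = \<iota> j then cnj (b l j) else 0)"
    using Q.units_col[of l l j j] jl d index by (simp add: diag sum_munit b_def del: munit_index)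
qed

lemma a_refl: "j < n \<Longrightarrow> a j j = 1" and b_refl: "j < n \<Longrightarrow> b j j = 1"
  using index by (simp_all add: a_def b_def diag)

lemma a_cnj: "j < n \<Longrightarrow> l < n \<Longrightarrow> a j l = cnj (a l j)"
  using rows(1)[of j l "\<iota> l"] index by (cases "j = l") (auto simp: a_def[of j l] a_refl[unfolded a_def] a_refl)

lemma b_cnj: "j < n \<Longrightarrow> l < n \<Longrightarrow> b j l = cnj (b l j)"
  using rows(2)[of j l "\<iota> j"] index by (cases "j = l") (auto simp: b_def[of j l] b_refl[unfolded b_def] b_refl)

lemma entries:
  assumes jl: "j < n" "l < n" "j \<noteq> l" and rc: "r < N" "c < N"
  shows "h (munit n j l) $$ (r, c)
    = (if r = \<iota> j \<and> c = \<iota> l then a j l else if r = \<iota> l \<and> c = \<iota> j then b j l else 0)"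
proof -
  have "\<iota> j \<noteq> \<iota> l" using inj jl by auto
  thus ?thesis
    using rows[OF jl rc(2)] support(1)[OF jl(1,2) rc(1) _ _ rc(2)] a_cnj[OF jl(1,2)] b_cnj[OF jl(1,2)]
    by (cases "r = \<iota> j"; cases "r = \<iota> l") auto
qed

lemma ab_zero:
  assumes jl: "j < n" "l < n" "j \<noteq> l"
  shows "a j l * b j l = 0"
proof -
  interpret P: orth_form n "\<lambda>A B. \<Sum>u<N. cnj (h A $$ (u, \<iota> l)) * h B $$ (u, \<iota> l)"
    using form index[OF jl(2)] by blast
  have ne: "\<iota> j \<noteq> \<iota> l" using inj jl by auto
  have "(\<Sum>u<N. cnj (h (munit n j l) $$ (u, \<iota> l)) * h (munit n l j) $$ (u, \<iota> l)) = cnj (a j l) * b l j"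
    using jl index ne by (subst sum_single[of "\<iota> j"]) (auto simp: entries)
  hence "cnj (a j l) * b l j = 0" using P.units_zero[of j l l j] jl by auto
  thus ?thesis using b_cnj[OF jl(2,1)] by auto
qed

text \<open>The diagonal relation for \<open>j\<close> and \<open>l\<close>, read in column
  \<open>\<iota> l\<close>, where the images of the two diagonal units contribute 0 and 1.\<close>

lemma ab_norm:
  assumes jl: "j < n" "l < n" "j \<noteq> l"
  shows "(cmod (a j l))\<^sup>2 + (cmod (b j l))\<^sup>2 = 1"
proof -
  interpret P: orth_form n "\<lambda>A B. \<Sum>u<N. cnj (h A $$ (u, \<iota> l)) * h B $$ (u, \<iota> l)"
    using form index[OF jl(2)] by blast
  have ne: "\<iota> j \<noteq> \<iota> l" using inj jl by auto
  have "(\<Sum>u<N. cnj (h (munit n j l) $$ (u, \<iota> l)) * h (munit n j l) $$ (u, \<iota> l)) = cnj (a j l) * a j l"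
    using jl index ne by (subst sum_single[of "\<iota> j"]) (auto simp: entries)
  moreover have "(\<Sum>u<N. cnj (h (munit n l j) $$ (u, \<iota> l)) * h (munit n l j) $$ (u, \<iota> l)) = cnj (b l j) * b l j"
    using jl index ne by (subst sum_single[of "\<iota> j"]) (auto simp: entries)
  moreover have "P.U j j j j = 0"
    using jl index ne by (simp add: diag sum_munit del: munit_index)
  moreover have "P.U l l l l = 1"
    using jl index by (simp add: diag sum_munit del: munit_index) simp
  ultimately have "cnj (a j l) * a j l + cnj (b l j) * b l j = 1"
    using P.units_diag[of j j l l] jl by simp
  hence "complex_of_real ((cmod (a j l))\<^sup>2 + (cmod (b j l))\<^sup>2) = 1"
    using b_cnj[OF jl(1,2)] by (simp add: complex_norm_square mult.commute del: of_real_power)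
  thus ?thesis using of_real_eq_1_iff by blast
qed

text \<open>Moving the common column index from \<open>j\<close> to \<open>l\<close> makes one of
  the two images diagonal, so a product of two coefficients becomes a single one. For
  \<open>b\<close> the other one-sided product is used, and the order of composition is
  reversed.\<close>

lemma a_cocycle:
  assumes "j < n" "k < n" "l < n" "j \<noteq> k" "k \<noteq> l" "j \<noteq> l"
  shows "a l j * a j k = a l k"
proof -
  interpret P: orth_form n "\<lambda>A B. \<Sum>u<N. h A $$ (\<iota> l, u) * cnj (h B $$ (\<iota> k, u))"
    using form' index assms by blast
  have ne: "\<iota> j \<noteq> \<iota> l" "\<iota> j \<noteq> \<iota> k" "\<iota> k \<noteq> \<iota> l" using inj assms by auto
  have "(\<Sum>u<N. h (munit n l j) $$ (\<iota> l, u) * cnj (h (munit n k j) $$ (\<iota> k, u))) = a l j * cnj (a k j)"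
    using assms index ne by (subst sum_single[of "\<iota> j"]) (auto simp: entries)
  moreover have "(\<Sum>u<N. h (munit n l l) $$ (\<iota> l, u) * cnj (h (munit n k l) $$ (\<iota> k, u))) = cnj (a k l)"
    using assms index ne by (simp add: diag sum_munit a_def del: munit_index)
  ultimately show ?thesis
    using P.units_col[of l j k l] assms a_cnj[of j k] a_cnj[of l k] by simp
qed

lemma b_cocycle:
  assumes "j < n" "k < n" "l < n" "j \<noteq> k" "k \<noteq> l" "j \<noteq> l"
  shows "b j l * b k j = b k l"
proof -
  interpret P: orth_form n "\<lambda>A B. \<Sum>u<N. cnj (h A $$ (u, \<iota> l)) * h B $$ (u, \<iota> k)"
    using form index assms by blast
  have ne: "\<iota> j \<noteq> \<iota> l" "\<iota> j \<noteq> \<iota> k" "\<iota> k \<noteq> \<iota> l" using inj assms by auto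
  have "(\<Sum>u<N. cnj (h (munit n l j) $$ (u, \<iota> l)) * h (munit n k j) $$ (u, \<iota> k)) = cnj (b l j) * b k j"
    using assms index ne by (subst sum_single[of "\<iota> j"]) (auto simp: entries)
  moreover have "(\<Sum>u<N. cnj (h (munit n l l) $$ (u, \<iota> l)) * h (munit n k l) $$ (u, \<iota> k)) = b k l"
    using assms index ne by (simp add: diag sum_munit b_def del: munit_index)
  ultimately show ?thesis
    using P.units_col[of l j k l] assms b_cnj[of j l] by simp
qed

lemma a_or_b:
  assumes "j < n" "l < n" "j \<noteq> l"
  shows "a j l \<noteq> 0 \<longleftrightarrow> b j l = 0"
  using ab_zero[OF assms] ab_norm[OF assms] by auto

text \<open>
  Colour an edge by whether \<open>a\<close> or \<open>b\<close> survives on it. The two cocycle relations forbid triangles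
  with two colours.
\<close>

lemma a_triangle:
  assumes "j < n" "k < n" "l < n" "j \<noteq> k" "j \<noteq> l" "a j l \<noteq> 0"
  shows "a j k \<noteq> 0"
proof (cases "k = l")
  case False
  show ?thesis
  proof
    assume "a j k = 0"
    hence bjk: "b j k \<noteq> 0" using a_or_b[of j k] assms by auto
    have bjl: "b j l = 0" using a_or_b[of j l] assms by auto
    show False
    proof (cases "a l k = 0")
      case True
      hence "b l k \<noteq> 0" using a_or_b[of l k] assms False by auto
      hence "b k l \<noteq> 0" using b_cnj[of k l] assms by auto
      thus False using b_cocycle[of k j l] bjk bjl assms False by auto
    next
      case b: False
      thus False using a_cocycle[of l k j] assms False \<open>a j k = 0\<close> by auto
    qed
  qed
qed (use assms in auto)

text \<open>Edges at the vertex 0 inherit the type of the edge from 0 to 1, and every other edge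
  closes a triangle with two of them.\<close>

lemma a_uniform:
  assumes "0 < n" "1 < n" "a 0 1 \<noteq> 0" "j < n" "l < n"
  shows "a j l \<noteq> 0"
proof -
  have 0: "a 0 k \<noteq> 0" if "k < n" for k
    using a_triangle[of 0 k 1] assms that a_refl[of 0] by (cases "k = 0") auto
  have 1: "a j 0 \<noteq> 0" using 0[OF assms(4)] a_cnj[of j 0] assms by auto
  show ?thesis
    using a_triangle[of j l 0] 0[OF assms(5)] 1 assms a_refl[of j] by (cases "j = l"; cases "j = 0") auto
qed

lemma a_type:
  assumes nz: "\<And>j l. j < n \<Longrightarrow> l < n \<Longrightarrow> a j l \<noteq> 0" and jl: "j < n" "l < n"
  shows "cmod (a j l) = 1"
    and "j \<noteq> l \<Longrightarrow> b j l = 0"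
    and "k < n \<Longrightarrow> a j k * a k l = a j l"
    and "r < N \<Longrightarrow> c < N \<Longrightarrow> h (munit n j l) $$ (r, c) = (if r = \<iota> j \<and> c = \<iota> l then a j l else 0)"
proof -
  have b0: "b j l = 0" if "j < n" "l < n" "j \<noteq> l" for j l
    using a_or_b[OF that] nz[OF that(1,2)] by simp
  thus "j \<noteq> l \<Longrightarrow> b j l = 0" using jl by blast
  have norm: "cmod (a j l) = 1" if "j < n" "l < n" for j l
  proof (cases "j = l")
    case False
    hence "(cmod (a j l))\<^sup>2 = 1" using ab_norm[OF that False] b0[OF that False] by simp
    thus ?thesis using abs_norm_cancel by (metis abs_1 one_power2 power2_eq_iff_nonneg norm_ge_zero zero_le_one)
  qed (use that a_refl in auto)
  show "cmod (a j l) = 1" by (rule norm[OF jl])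
  have inv: "a j k * a k j = 1" if "j < n" "k < n" for j k
    using norm[OF that] a_cnj[OF that(2,1)] complex_norm_square[of "a j k"] by simp
  show "a j k * a k l = a j l" if k: "k < n"
  proof (cases "j = k \<or> k = l \<or> j = l")
    case True
    thus ?thesis using inv[OF jl(1) k] a_refl jl k by auto
  next
    case False
    thus ?thesis using a_cocycle[of k l j] jl k by auto
  qed
  show "h (munit n j l) $$ (r, c) = (if r = \<iota> j \<and> c = \<iota> l then a j l else 0)" if "r < N" "c < N"
  proof (cases "j = l")
    case True
    thus ?thesis using that jl by (simp add: diag a_refl)
  next
    case False
    thus ?thesis using entries[OF jl False that] b0[OF jl False] by simp
  qed
qed

end

text \<open>\<open>\<Phi> A B\<close> stands for the normalized image of a tensor product. Separate
  arguments make a partial transposition a substitution in one of them, and the abstract pairing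
  \<open>\<iota>\<close> keeps division with remainder out of the combinatorics.\<close>

locale tensor_system =
  fixes m n N :: nat and \<iota> :: "nat \<Rightarrow> nat \<Rightarrow> nat" and \<Phi> :: "complex mat \<Rightarrow> complex mat \<Rightarrow> complex mat"
  assumes mn: "m \<ge> 2" "n \<ge> 2"
    and linear1: "\<And>B. B \<in> carrier_mat n n \<Longrightarrow> linear_mm m N (\<lambda>A. \<Phi> A B)"
    and linear2: "\<And>A. A \<in> carrier_mat m m \<Longrightarrow> linear_mm n N (\<Phi> A)"
    and orth1: "\<And>A B C D. A \<in> carrier_mat m m \<Longrightarrow> C \<in> carrier_mat m m \<Longrightarrow> B \<in> carrier_mat n n \<Longrightarrow>
        D \<in> carrier_mat n n \<Longrightarrow> orth m A C \<Longrightarrow> orth N (\<Phi> A B) (\<Phi> C D)"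
    and orth2: "\<And>A B C D. A \<in> carrier_mat m m \<Longrightarrow> C \<in> carrier_mat m m \<Longrightarrow> B \<in> carrier_mat n n \<Longrightarrow>
        D \<in> carrier_mat n n \<Longrightarrow> orth n B D \<Longrightarrow> orth N (\<Phi> A B) (\<Phi> C D)"
    and index: "\<And>i j. i < m \<Longrightarrow> j < n \<Longrightarrow> \<iota> i j < N"
    and inj: "\<And>i j k l. i < m \<Longrightarrow> j < n \<Longrightarrow> k < m \<Longrightarrow> l < n \<Longrightarrow> \<iota> i j = \<iota> k l \<Longrightarrow> i = k \<and> j = l"
    and surj: "\<And>p. p < N \<Longrightarrow> \<exists>i<m. \<exists>j<n. p = \<iota> i j"
    and diag: "\<And>i j. i < m \<Longrightarrow> j < n \<Longrightarrow> \<Phi> (munit m i i) (munit n j j) = munit N (\<iota> i j) (\<iota> i j)"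
begin

text \<open>A diagonal unit outside the block has another second index, so orthogonality in the
  second factor separates it from all images with \<open>munit n j j\<close>.\<close>

lemma unit_system1:
  assumes j: "j < n"
  shows "unit_system m N (\<lambda>i. \<iota> i j) (\<lambda>A. \<Phi> A (munit n j j))"
proof unfold_locales
  fix p and A :: "complex mat" assume p: "p < N" "p \<notin> (\<lambda>i. \<iota> i j) ` {..<m}" and A: "A \<in> carrier_mat m m"
  then obtain i l where il: "i < m" "l < n" "p = \<iota> i l" using surj by blast
  hence "l \<noteq> j" using p by auto
  hence "orth N (\<Phi> (munit m i i) (munit n l l)) (\<Phi> A (munit n j j))"
    using il j A by (intro orth2 munit_orth) auto
  thus "orth N (munit N p p) (\<Phi> A (munit n j j))" using il by (simp add: diag)
qed (use j linear1 orth1 index inj diag in auto)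

lemma unit_system2:
  assumes i: "i < m"
  shows "unit_system n N (\<iota> i) (\<Phi> (munit m i i))"
proof unfold_locales
  fix p and A :: "complex mat" assume p: "p < N" "p \<notin> \<iota> i ` {..<n}" and A: "A \<in> carrier_mat n n"
  then obtain k j where kj: "k < m" "j < n" "p = \<iota> k j" using surj by blast
  hence "k \<noteq> i" using p by auto
  hence "orth N (\<Phi> (munit m k k) (munit n j j)) (\<Phi> (munit m i i) A)"
    using kj i A by (intro orth1 munit_orth) auto
  thus "orth N (munit N p p) (\<Phi> (munit m i i) A)" using kj by (simp add: diag)
qed (use i linear2 orth2 index inj diag in auto)

definition a1 :: "nat \<Rightarrow> nat \<Rightarrow> nat \<Rightarrow> complex" where
  "a1 j i k = \<Phi> (munit m i k) (munit n j j) $$ (\<iota> i j, \<iota> k j)"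
definition a2 :: "nat \<Rightarrow> nat \<Rightarrow> nat \<Rightarrow> complex" where
  "a2 i j l = \<Phi> (munit m i i) (munit n j l) $$ (\<iota> i j, \<iota> i l)"

end

text \<open>One surviving entry per factor fixes the type; it spreads to all indices in
  \<open>nz_all\<close>.\<close>

locale tensor_system_id = tensor_system +
  assumes nz1: "a1 0 0 1 \<noteq> 0" and nz2: "a2 0 0 1 \<noteq> 0"
begin

lemma carr [simp]: "\<Phi> (munit m i k) (munit n j l) \<in> carrier_mat N N"
  using linear_mmD(1)[OF linear2] by auto

context
  fixes i k j l :: nat
  assumes ik: "i < m" "k < m" "i \<noteq> k" and jl: "j < n" "l < n"
begin

text \<open>Probing with \<open>munit n y y\<close> in the second factor singles out one row, and
  \<open>orth1\<close> permits a different second factor on the other side. This trades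
  \<open>munit m k i\<close> for \<open>munit m i i\<close>, whose images are governed by
  \<open>unit_system2\<close>.\<close>

lemma row1:
  assumes yd: "y < n" "d < N"
  shows "\<Phi> (munit m k i) (munit n j l) $$ (\<iota> k y, d)
    = cnj (a1 y i k) * \<Phi> (munit m i i) (munit n j l) $$ (\<iota> i y, d)"
proof -
  interpret h: unit_system m N "\<lambda>i. \<iota> i y" "\<lambda>A. \<Phi> A (munit n y y)" by (rule unit_system1[OF yd(1)])
  interpret P: orth_form m "\<lambda>A B. \<Sum>u<N. cnj (\<Phi> A (munit n y y) $$ (u, \<iota> k y)) * \<Phi> B (munit n j l) $$ (u, d)"
    using orth_form_adj(1)[OF linear1 linear1 index[OF ik(2) yd(1)] yd(2)] orth1 by auto
  have a: "h.a i k = a1 y i k" by (simp add: h.a_def a1_def)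
  have ne: "\<iota> i y \<noteq> \<iota> k y" using inj ik yd by blast
  have "(\<Sum>u<N. cnj (\<Phi> (munit m i k) (munit n y y) $$ (u, \<iota> k y)) * \<Phi> (munit m i i) (munit n j l) $$ (u, d))
      = cnj (a1 y i k) * \<Phi> (munit m i i) (munit n j l) $$ (\<iota> i y, d)"
    using ik yd index ne by (subst sum_single[of "\<iota> i y"]) (auto simp: h.entries a)
  moreover have "(\<Sum>u<N. cnj (\<Phi> (munit m k k) (munit n y y) $$ (u, \<iota> k y)) * \<Phi> (munit m k i) (munit n j l) $$ (u, d))
      = \<Phi> (munit m k i) (munit n j l) $$ (\<iota> k y, d)"
    using ik yd index by (simp add: diag sum_munit del: munit_index)
  ultimately show ?thesis using P.units_row[of k k i i] ik by simp
qed

text \<open>The factor in front is the transposed coefficient, which vanishes for the identity type;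
  row \<open>\<iota> i y\<close> will therefore be zero.\<close>

lemma row2:
  assumes yd: "y < n" "d < N"
  shows "\<Phi> (munit m k i) (munit n j l) $$ (\<iota> i y, d)
    = cnj (\<Phi> (munit m i k) (munit n y y) $$ (\<iota> k y, \<iota> i y)) * \<Phi> (munit m k k) (munit n j l) $$ (\<iota> k y, d)"
proof -
  interpret h: unit_system m N "\<lambda>i. \<iota> i y" "\<lambda>A. \<Phi> A (munit n y y)" by (rule unit_system1[OF yd(1)])
  interpret P: orth_form m "\<lambda>A B. \<Sum>u<N. cnj (\<Phi> A (munit n y y) $$ (u, \<iota> i y)) * \<Phi> B (munit n j l) $$ (u, d)"
    using orth_form_adj(1)[OF linear1 linear1 index[OF ik(1) yd(1)] yd(2)] orth1 by auto
  have ne: "\<iota> i y \<noteq> \<iota> k y" using inj ik yd by blast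
  have "(\<Sum>u<N. cnj (\<Phi> (munit m i k) (munit n y y) $$ (u, \<iota> i y)) * \<Phi> (munit m k k) (munit n j l) $$ (u, d))
      = cnj (\<Phi> (munit m i k) (munit n y y) $$ (\<iota> k y, \<iota> i y)) * \<Phi> (munit m k k) (munit n j l) $$ (\<iota> k y, d)"
    using ik yd index ne by (subst sum_single[of "\<iota> k y"]) (auto simp: h.entries)
  moreover have "(\<Sum>u<N. cnj (\<Phi> (munit m i i) (munit n y y) $$ (u, \<iota> i y)) * \<Phi> (munit m k i) (munit n j l) $$ (u, d))
      = \<Phi> (munit m k i) (munit n j l) $$ (\<iota> i y, d)"
    using ik yd index by (simp add: diag sum_munit del: munit_index)
  ultimately show ?thesis using P.units_col[of i i k k] ik by simp
qed

lemma col2: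
  assumes yd: "y < n" "d < N"
  shows "\<Phi> (munit m k i) (munit n j l) $$ (d, \<iota> i y)
    = \<Phi> (munit m k k) (munit n j l) $$ (d, \<iota> k y) * cnj (a1 y i k)"
proof -
  interpret h: unit_system m N "\<lambda>i. \<iota> i y" "\<lambda>A. \<Phi> A (munit n y y)" by (rule unit_system1[OF yd(1)])
  interpret P: orth_form m "\<lambda>A B. \<Sum>u<N. \<Phi> A (munit n j l) $$ (d, u) * cnj (\<Phi> B (munit n y y) $$ (\<iota> i y, u))"
    using orth_form_adj(2)[OF linear1 linear1 yd(2) index[OF ik(1) yd(1)]] orth1 by auto
  have a: "h.a i k = a1 y i k" by (simp add: h.a_def a1_def)
  have ne: "\<iota> i y \<noteq> \<iota> k y" using inj ik yd by blast
  have "(\<Sum>u<N. \<Phi> (munit m k k) (munit n j l) $$ (d, u) * cnj (\<Phi> (munit m i k) (munit n y y) $$ (\<iota> i y, u)))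
      = \<Phi> (munit m k k) (munit n j l) $$ (d, \<iota> k y) * cnj (a1 y i k)"
    using ik yd index ne by (subst sum_single[of "\<iota> k y"]) (auto simp: h.entries a)
  moreover have "(\<Sum>u<N. \<Phi> (munit m k i) (munit n j l) $$ (d, u) * cnj (\<Phi> (munit m i i) (munit n y y) $$ (\<iota> i y, u)))
      = \<Phi> (munit m k i) (munit n j l) $$ (d, \<iota> i y)"
    using ik yd index by (simp add: diag sum_munit del: munit_index)
  ultimately show ?thesis using P.units_col[of k i i k] ik by simp
qed

text \<open>The same entry of the image of \<open>E\<^sub>k\<^sub>i \<otimes> E\<^sub>j\<^sub>l\<close>, computed along its row and along its column.\<close>

lemma exchange_cnj: "cnj (a1 j i k) * a2 i j l = a2 k j l * cnj (a1 l i k)"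
  using row1[of j "\<iota> i l"] col2[of l "\<iota> k j"] ik jl index by (simp add: a2_def)

end

text \<open>\<open>exchange_cnj\<close> carries a nonzero coefficient of one factor from index 0 of
  the other factor to any index. This excludes a map that is the identity on one slice and
  transposition on another.\<close>

lemma nz_all:
  shows "\<And>j i k. j < n \<Longrightarrow> i < m \<Longrightarrow> k < m \<Longrightarrow> a1 j i k \<noteq> 0"
    and "\<And>i j l. i < m \<Longrightarrow> j < n \<Longrightarrow> l < n \<Longrightarrow> a2 i j l \<noteq> 0"
proof -
  have u1: "a1 j i k \<noteq> 0" if "a1 j 0 1 \<noteq> 0" "j < n" "i < m" "k < m" for j i k
  proof -
    interpret h: unit_system m N "\<lambda>i. \<iota> i j" "\<lambda>A. \<Phi> A (munit n j j)" by (rule unit_system1[OF that(2)])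
    show ?thesis using h.a_uniform[of i k] that mn by (simp add: h.a_def a1_def)
  qed
  have u2: "a2 i j l \<noteq> 0" if "a2 i 0 1 \<noteq> 0" "i < m" "j < n" "l < n" for i j l
  proof -
    interpret h: unit_system n N "\<iota> i" "\<Phi> (munit m i i)" by (rule unit_system2[OF that(2)])
    show ?thesis using h.a_uniform[of j l] that mn by (simp add: h.a_def a2_def)
  qed
  have a2i: "a2 i 0 1 \<noteq> 0" if "i < m" for i
  proof (cases "i = 0")
    case False
    have "a1 0 0 i \<noteq> 0" using u1[of 0 0 i] nz1 that mn by simp
    thus ?thesis using exchange_cnj[of 0 i 0 1] nz2 that mn False by auto
  qed (use nz2 in simp)
  have a1j: "a1 j 0 1 \<noteq> 0" if "j < n" for j
  proof (cases "j = 0")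
    case False
    have "a2 0 0 j \<noteq> 0" using u2[of 0 0 j] nz2 that mn by simp
    thus ?thesis using exchange_cnj[of 0 1 0 j] nz1 that mn False by auto
  qed (use nz1 in simp)
  show "\<And>j i k. j < n \<Longrightarrow> i < m \<Longrightarrow> k < m \<Longrightarrow> a1 j i k \<noteq> 0" using u1 a1j by blast
  show "\<And>i j l. i < m \<Longrightarrow> j < n \<Longrightarrow> l < n \<Longrightarrow> a2 i j l \<noteq> 0" using u2 a2i by blast
qed

lemma a1_type:
  assumes j: "j < n" and ik: "i < m" "k < m"
  shows "cmod (a1 j i k) = 1" "a1 j i i = 1" "a1 j i k = cnj (a1 j k i)"
    and "i \<noteq> k \<Longrightarrow> \<Phi> (munit m i k) (munit n j j) $$ (\<iota> k j, \<iota> i j) = 0"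
    and "l < m \<Longrightarrow> a1 j i l * a1 j l k = a1 j i k"
proof -
  interpret h: unit_system m N "\<lambda>i. \<iota> i j" "\<lambda>A. \<Phi> A (munit n j j)" by (rule unit_system1[OF j])
  have a: "h.a = a1 j" by (intro ext) (simp add: h.a_def a1_def)
  have nz: "\<And>i k. i < m \<Longrightarrow> k < m \<Longrightarrow> h.a i k \<noteq> 0" using nz_all(1)[OF j] by (simp add: a)
  note t = h.a_type[OF nz ik]
  show "cmod (a1 j i k) = 1" "a1 j i i = 1" "a1 j i k = cnj (a1 j k i)"
    using t(1) h.a_refl[OF ik(1)] h.a_cnj[OF ik] by (simp_all add: a)
  show "i \<noteq> k \<Longrightarrow> \<Phi> (munit m i k) (munit n j j) $$ (\<iota> k j, \<iota> i j) = 0" using t(2) by (simp add: h.b_def)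
  show "l < m \<Longrightarrow> a1 j i l * a1 j l k = a1 j i k" using t(3)[of l] by (simp add: a)
qed

lemma a2_type:
  assumes i: "i < m" and jl: "j < n" "l < n"
  shows "cmod (a2 i j l) = 1" "a2 i j j = 1" "a2 i j l = cnj (a2 i l j)"
    and "k < n \<Longrightarrow> a2 i j k * a2 i k l = a2 i j l"
    and "r < N \<Longrightarrow> c < N \<Longrightarrow> \<Phi> (munit m i i) (munit n j l) $$ (r, c)
      = (if r = \<iota> i j \<and> c = \<iota> i l then a2 i j l else 0)"
proof -
  interpret h: unit_system n N "\<iota> i" "\<Phi> (munit m i i)" by (rule unit_system2[OF i])
  have a: "h.a = a2 i" by (intro ext) (simp add: h.a_def a2_def)
  have nz: "\<And>j l. j < n \<Longrightarrow> l < n \<Longrightarrow> h.a j l \<noteq> 0" using nz_all(2)[OF i] by (simp add: a)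
  note t = h.a_type[OF nz jl]
  show "cmod (a2 i j l) = 1" "a2 i j j = 1" "a2 i j l = cnj (a2 i l j)"
    using t(1) h.a_refl[OF jl(1)] h.a_cnj[OF jl] by (simp_all add: a)
  show "k < n \<Longrightarrow> a2 i j k * a2 i k l = a2 i j l" using t(3)[of k] by (simp add: a)
  show "r < N \<Longrightarrow> c < N \<Longrightarrow> \<Phi> (munit m i i) (munit n j l) $$ (r, c)
      = (if r = \<iota> i j \<and> c = \<iota> i l then a2 i j l else 0)" using t(4) by (simp add: a)
qed

lemma exchange:
  assumes "i < m" "k < m" "j < n" "l < n"
  shows "a1 j k i * a2 i j l = a2 k j l * a1 l k i"
proof (cases "i = k")
  case True
  thus ?thesis using assms by (simp add: a1_type(2))
next
  case False
  thus ?thesis using exchange_cnj[OF assms(1,2) False assms(3,4)] a1_type(3)[of j k i] a1_type(3)[of l k i] assms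
    by simp
qed

text \<open>Every row is accounted for: \<open>row1\<close> treats the block of \<open>k\<close>,
  \<open>row2\<close> empties that of \<open>i\<close>, and in the other blocks a diagonal unit is
  orthogonal to the image.\<close>

lemma image_entries:
  assumes ik: "i < m" "k < m" and jl: "j < n" "l < n" and rc: "r < N" "c < N"
  shows "\<Phi> (munit m k i) (munit n j l) $$ (r, c)
    = (if r = \<iota> k j \<and> c = \<iota> i l then a1 j k i * a2 i j l else 0)"
proof (cases "i = k")
  case True
  thus ?thesis using a2_type(5)[OF ik(1) jl rc] a1_type(2)[OF jl(1) ik] by simp
next
  case False
  obtain x y where xy: "x < m" "y < n" "r = \<iota> x y" using surj rc by blast
  have inj': "\<iota> x y = \<iota> k j \<longleftrightarrow> x = k \<and> y = j" "\<iota> i y = \<iota> i j \<longleftrightarrow> y = j" "\<iota> k y = \<iota> k j \<longleftrightarrow> y = j"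
    using inj xy ik jl by blast+
  consider "x = k" | "x = i" | "x \<noteq> k" "x \<noteq> i" by blast
  thus ?thesis
  proof cases
    case 1
    thus ?thesis
      using row1[OF ik False jl xy(2) rc(2)] a2_type(5)[OF ik(1) jl index[OF ik(1) xy(2)] rc(2)]
        a1_type(3)[OF jl(1) ik(2,1)] xy inj' by auto
  next
    case 2
    thus ?thesis
      using row2[OF ik False jl xy(2) rc(2)] a1_type(4)[OF xy(2) ik False] xy inj' False by auto
  next
    case 3
    have "orth N (\<Phi> (munit m x x) (munit n y y)) (\<Phi> (munit m k i) (munit n j l))"
      using 3 xy ik by (intro orth1 munit_orth) auto
    hence "orth N (munit N r r) (\<Phi> (munit m k i) (munit n j l))" using xy by (simp add: diag)
    thus ?thesis using orth_munit_entries(1)[OF _ carr rc] xy inj' 3 by simp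
  qed
qed

theorem image_diagonal_conj:
  obtains d where "\<And>i j. i < m \<Longrightarrow> j < n \<Longrightarrow> cmod (d i j) = 1"
    and "\<And>i k j l r c. i < m \<Longrightarrow> k < m \<Longrightarrow> j < n \<Longrightarrow> l < n \<Longrightarrow> r < N \<Longrightarrow> c < N \<Longrightarrow>
      \<Phi> (munit m k i) (munit n j l) $$ (r, c) = (if r = \<iota> k j \<and> c = \<iota> i l then d k j * cnj (d i l) else 0)"
proof (rule that)
  \<comment> \<open>The phase collected from \<open>(i, j)\<close> to \<open>(0, 0)\<close>, along
    the first factor and then along the second; \<open>exchange\<close> makes the order of the two
    moves immaterial.\<close>
  let ?d = "\<lambda>i j. a1 j i 0 * a2 0 j 0"
  have 0: "0 < m" "0 < n" using mn by auto
  show "cmod (?d i j) = 1" if "i < m" "j < n" for i j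
    using that 0 by (simp add: norm_mult a1_type(1) a2_type(1))
  fix i k j l r c assume ik: "i < m" "k < m" and jl: "j < n" "l < n" and rc: "r < N" "c < N"
  have "?d k j * cnj (?d i l) = a1 j k 0 * (a2 0 j 0 * a2 0 0 l) * a1 l 0 i"
    using a1_type(3)[OF jl(2) 0(1) ik(1)] a2_type(3)[OF 0(1) 0(2) jl(2)] by simp
  also have "\<dots> = (a1 j k 0 * a2 0 j l) * a1 l 0 i"
    using a2_type(4)[OF 0(1) jl 0(2)] by simp
  also have "\<dots> = a2 k j l * (a1 l k 0 * a1 l 0 i)"
    using exchange[OF 0(1) ik(2) jl] by simp
  also have "\<dots> = a1 j k i * a2 i j l"
    using a1_type(5)[OF jl(2) ik(2,1) 0(1)] exchange[OF ik jl] by simp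
  finally show "\<Phi> (munit m k i) (munit n j l) $$ (r, c) = (if r = \<iota> k j \<and> c = \<iota> i l then ?d k j * cnj (?d i l) else 0)"
    using image_entries[OF ik jl rc] by simp
qed

end

section \<open>Kronecker products\<close>

lemma kronecker_index':
  assumes "A \<in> carrier_mat m m" "B \<in> carrier_mat n n" "r < m * n" "c < m * n"
  shows "(A \<otimes>\<^sub>m B) $$ (r, c) = A $$ (r div n, c div n) * B $$ (r mod n, c mod n)"
  using assms by (auto simp: kronecker_def)

lemma dim_kronecker [simp]:
  "dim_row (A \<otimes>\<^sub>m B) = dim_row A * dim_row B" "dim_col (A \<otimes>\<^sub>m B) = dim_col A * dim_col B"
  by (simp_all add: kronecker_def)

lemma div_mod_less:
  assumes "r < m * n"
  shows "r div n < m" "r mod n < (n :: nat)"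
proof -
  have "0 < n" using assms by (cases n) auto
  thus "r div n < m" "r mod n < n" using assms by (auto simp: less_mult_imp_div_less)
qed

lemma kronecker_eqI:
  assumes "A \<in> carrier_mat m m" "B \<in> carrier_mat n n" "X \<in> carrier_mat (m * n) (m * n)"
    and "\<And>r c. r < m * n \<Longrightarrow> c < m * n \<Longrightarrow> X $$ (r, c) = A $$ (r div n, c div n) * B $$ (r mod n, c mod n)"
  shows "X = A \<otimes>\<^sub>m B"
proof (rule eq_matI)
  have c: "A \<otimes>\<^sub>m B \<in> carrier_mat (m * n) (m * n)" using assms by auto
  fix r s assume "r < dim_row (A \<otimes>\<^sub>m B)" "s < dim_col (A \<otimes>\<^sub>m B)"
  hence "r < m * n" "s < m * n" using c by auto
  thus "X $$ (r, s) = (A \<otimes>\<^sub>m B) $$ (r, s)" using assms by (simp add: kronecker_index'[OF assms(1,2)])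
qed (use assms in \<open>auto simp: kronecker_def\<close>)

lemma kronecker_add_left:
  assumes "A \<in> carrier_mat m m" "C \<in> carrier_mat m m" "B \<in> carrier_mat n n"
  shows "(A + C) \<otimes>\<^sub>m B = A \<otimes>\<^sub>m B + C \<otimes>\<^sub>m B"
proof (rule sym, rule kronecker_eqI[of _ m _ n])
  have c: "A \<otimes>\<^sub>m B \<in> carrier_mat (m * n) (m * n)" "C \<otimes>\<^sub>m B \<in> carrier_mat (m * n) (m * n)" using assms by auto
  fix r s assume "r < m * n" "s < m * n"
  thus "(A \<otimes>\<^sub>m B + C \<otimes>\<^sub>m B) $$ (r, s) = (A + C) $$ (r div n, s div n) * B $$ (r mod n, s mod n)"
    using assms c div_mod_less[of r m n] div_mod_less[of s m n]
    by (simp add: kronecker_index'[of _ m _ n] distrib_right)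
qed (use assms in auto)

lemma kronecker_add_right:
  assumes "A \<in> carrier_mat m m" "B \<in> carrier_mat n n" "D \<in> carrier_mat n n"
  shows "A \<otimes>\<^sub>m (B + D) = A \<otimes>\<^sub>m B + A \<otimes>\<^sub>m D"
proof (rule sym, rule kronecker_eqI[of _ m _ n])
  have c: "A \<otimes>\<^sub>m B \<in> carrier_mat (m * n) (m * n)" "A \<otimes>\<^sub>m D \<in> carrier_mat (m * n) (m * n)" using assms by auto
  fix r s assume "r < m * n" "s < m * n"
  thus "(A \<otimes>\<^sub>m B + A \<otimes>\<^sub>m D) $$ (r, s) = A $$ (r div n, s div n) * (B + D) $$ (r mod n, s mod n)"
    using assms c div_mod_less[of r m n] div_mod_less[of s m n]
    by (simp add: kronecker_index'[of _ m _ n] distrib_left)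
qed (use assms in auto)

lemma kronecker_smult:
  assumes "A \<in> carrier_mat m m" "B \<in> carrier_mat n n"
  shows "(c \<cdot>\<^sub>m A) \<otimes>\<^sub>m B = c \<cdot>\<^sub>m (A \<otimes>\<^sub>m B)" "A \<otimes>\<^sub>m (c \<cdot>\<^sub>m B) = c \<cdot>\<^sub>m (A \<otimes>\<^sub>m B)"
proof -
  have k: "A \<otimes>\<^sub>m B \<in> carrier_mat (m * n) (m * n)" using assms by auto
  show "(c \<cdot>\<^sub>m A) \<otimes>\<^sub>m B = c \<cdot>\<^sub>m (A \<otimes>\<^sub>m B)"
    by (rule sym, rule kronecker_eqI[of _ m _ n])
      (use assms k in \<open>auto simp: kronecker_index'[of _ m _ n] div_mod_less\<close>)
  show "A \<otimes>\<^sub>m (c \<cdot>\<^sub>m B) = c \<cdot>\<^sub>m (A \<otimes>\<^sub>m B)"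
    by (rule sym, rule kronecker_eqI[of _ m _ n])
      (use assms k in \<open>auto simp: kronecker_index'[of _ m _ n] div_mod_less\<close>)
qed

lemma linear_mm_kronecker:
  "B \<in> carrier_mat n n \<Longrightarrow> linear_mm m (m * n) (\<lambda>A. A \<otimes>\<^sub>m B)"
  "A \<in> carrier_mat m m \<Longrightarrow> linear_mm n (m * n) (\<lambda>B. A \<otimes>\<^sub>m B)"
  unfolding linear_mm_def
  by (auto simp: kronecker_add_left kronecker_add_right kronecker_smult)

lemma kronecker_adj:
  assumes "A \<in> carrier_mat m m" "B \<in> carrier_mat n n"
  shows "adj (A \<otimes>\<^sub>m B) = adj A \<otimes>\<^sub>m adj B"
proof (rule kronecker_eqI[of _ m _ n])
  have c: "A \<otimes>\<^sub>m B \<in> carrier_mat (m * n) (m * n)" using assms by auto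
  fix r s assume "r < m * n" "s < m * n"
  thus "adj (A \<otimes>\<^sub>m B) $$ (r, s) = adj A $$ (r div n, s div n) * adj B $$ (r mod n, s mod n)"
    using assms c div_mod_less[of r m n] div_mod_less[of s m n]
    by (simp add: kronecker_index'[of _ m _ n])
qed (use assms in auto)

lemma index_pair_less:
  fixes i j m n :: nat
  assumes "i < m" "j < n"
  shows "i * n + j < m * n"
proof -
  have "i * n + j < Suc i * n" using assms by simp
  also have "\<dots> \<le> m * n" using assms by (intro mult_le_mono1) simp
  finally show ?thesis .
qed

lemma sum_div_mod:
  "(\<Sum>u<m * n. f (u div n) (u mod n)) = (\<Sum>i<m. \<Sum>j<n. f i j)" for n :: nat
proof -
  have "(\<Sum>u<m * n. f (u div n) (u mod n)) = (\<Sum>(i, j)\<in>{..<m} \<times> {..<n}. f i j)"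
    by (intro sum.reindex_bij_witness[of _ "\<lambda>(i, j). i * n + j" "\<lambda>u. (u div n, u mod n)"])
      (auto simp: div_mod_less index_pair_less)
  thus ?thesis by (simp add: sum.cartesian_product)
qed

lemma kronecker_mult:
  assumes "A \<in> carrier_mat m m" "B \<in> carrier_mat n n" "C \<in> carrier_mat m m" "D \<in> carrier_mat n n"
  shows "(A \<otimes>\<^sub>m B) * (C \<otimes>\<^sub>m D) = (A * C) \<otimes>\<^sub>m (B * D)"
proof (rule kronecker_eqI[of _ m _ n])
  have c: "A \<otimes>\<^sub>m B \<in> carrier_mat (m * n) (m * n)" "C \<otimes>\<^sub>m D \<in> carrier_mat (m * n) (m * n)" using assms by auto
  show "(A \<otimes>\<^sub>m B) * (C \<otimes>\<^sub>m D) \<in> carrier_mat (m * n) (m * n)" using c by (rule square_mult_carrier)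
  fix r s assume rs: "r < m * n" "s < m * n"
  have "((A \<otimes>\<^sub>m B) * (C \<otimes>\<^sub>m D)) $$ (r, s) = (\<Sum>u<m * n. (A $$ (r div n, u div n) * C $$ (u div n, s div n))
      * (B $$ (r mod n, u mod n) * D $$ (u mod n, s mod n)))"
    unfolding mult_index[OF c rs] using assms rs by (intro sum.cong) (auto simp: kronecker_index'[of _ m _ n])
  also have "\<dots> = (\<Sum>i<m. \<Sum>j<n. (A $$ (r div n, i) * C $$ (i, s div n)) * (B $$ (r mod n, j) * D $$ (j, s mod n)))"
    by (rule sum_div_mod)
  also have "\<dots> = (A * C) $$ (r div n, s div n) * (B * D) $$ (r mod n, s mod n)"
    using assms div_mod_less[OF rs(1)] div_mod_less[OF rs(2)]
    by (simp add: mult_index[of _ m m _ m] mult_index[of _ n n _ n] sum_product)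
  finally show "((A \<otimes>\<^sub>m B) * (C \<otimes>\<^sub>m D)) $$ (r, s) = (A * C) $$ (r div n, s div n) * (B * D) $$ (r mod n, s mod n)" .
qed (use assms in \<open>auto intro!: square_mult_carrier\<close>)

lemma kronecker_zero:
  assumes "B \<in> carrier_mat n n" "A \<in> carrier_mat m m"
  shows "0\<^sub>m m m \<otimes>\<^sub>m B = 0\<^sub>m (m * n) (m * n)" "A \<otimes>\<^sub>m 0\<^sub>m n n = 0\<^sub>m (m * n) (m * n)"
  using assms by (auto intro!: kronecker_eqI[symmetric] simp: div_mod_less)

lemma kronecker_munit:
  assumes "i < m" "j < n" "k < m" "l < n"
  shows "munit m i k \<otimes>\<^sub>m munit n j l = munit (m * n) (i * n + j) (k * n + l)"
proof (rule sym, rule kronecker_eqI[of _ m _ n])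
  have "r = x * n + y \<longleftrightarrow> r div n = x \<and> r mod n = y" if "y < n" for r x y using that by auto
  thus "munit (m * n) (i * n + j) (k * n + l) $$ (r, c)
      = munit m i k $$ (r div n, c div n) * munit n j l $$ (r mod n, c mod n)"
    if "r < m * n" "c < m * n" for r c
    using that assms by (auto simp: div_mod_less)
qed auto

lemma kronecker_one: "1\<^sub>m m \<otimes>\<^sub>m 1\<^sub>m n = 1\<^sub>m (m * n)"
proof (rule sym, rule kronecker_eqI[of _ m _ n])
  fix r c assume "r < m * n" "c < m * n"
  moreover have "r = c \<longleftrightarrow> r div n = c div n \<and> r mod n = c mod n" by (metis div_mult_mod_eq)
  ultimately show "(1\<^sub>m (m * n) :: complex mat) $$ (r, c) = 1\<^sub>m m $$ (r div n, c div n) * 1\<^sub>m n $$ (r mod n, c mod n)"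
    by (auto simp: div_mod_less)
qed auto

section \<open>Orthogonality and spectra of Kronecker products\<close>

lemma orth_kronecker:
  assumes "A \<in> carrier_mat m m" "C \<in> carrier_mat m m" "B \<in> carrier_mat n n" "D \<in> carrier_mat n n"
  shows "orth m A C \<Longrightarrow> orth (m * n) (A \<otimes>\<^sub>m B) (C \<otimes>\<^sub>m D)"
    and "orth n B D \<Longrightarrow> orth (m * n) (A \<otimes>\<^sub>m B) (C \<otimes>\<^sub>m D)"
  using assms by (auto simp: orth_def kronecker_adj[of _ m _ n] kronecker_mult[of _ m _ n] kronecker_zero square_mult_carrier)

text \<open>Both matrices get the same diagonal form, as the diagonalization follows a prescribed
  list of roots. Similarity passes directly to Kronecker products through its witnesses.\<close>

lemma hermitian_similar:
  assumes "G \<in> carrier_mat n n" "adj G = G" "H \<in> carrier_mat n n" "adj H = H" "char_poly G = char_poly H"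
  shows "similar_mat G H"
proof -
  obtain es where es: "char_poly H = (\<Prod>e\<leftarrow>es. [:- e, 1:])" using char_poly_factorized[OF assms(3)] by blast
  have "similar_mat X (dmat n (\<lambda>i. es ! i))"
    if X: "X \<in> carrier_mat n n" "adj X = X" "char_poly X = (\<Prod>e\<leftarrow>es. [:- e, 1:])" for X
  proof -
    obtain U where U: "unitary_mat n U" and XU: "X = U * dmat n (\<lambda>i. es ! i) * adj U"
      using hermitian_diagonalization[OF X] by blast
    show ?thesis
      using unitary_similar[OF unitary_adj[OF U], of "dmat n (\<lambda>i. es ! i)"] by (simp add: XU)
  qed
  thus ?thesis using assms es by (metis similar_mat_sym similar_mat_trans)
qed

lemma similar_kronecker:
  assumes "similar_mat G H" "similar_mat G' H'" "G \<in> carrier_mat m m" "G' \<in> carrier_mat n n"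
  shows "similar_mat (G \<otimes>\<^sub>m G') (H \<otimes>\<^sub>m H')"
proof -
  obtain P Q where "similar_mat_wit G H P Q" using assms(1) by (auto simp: similar_mat_def)
  note P = similar_mat_witD2[OF assms(3) this]
  obtain P' Q' where "similar_mat_wit G' H' P' Q'" using assms(2) by (auto simp: similar_mat_def)
  note P' = similar_mat_witD2[OF assms(4) this]
  show ?thesis
  proof (rule similar_matI[of _ _ "P \<otimes>\<^sub>m P'" "Q \<otimes>\<^sub>m Q'" "m * n"])
    show "(P \<otimes>\<^sub>m P') * (Q \<otimes>\<^sub>m Q') = 1\<^sub>m (m * n)"
      by (simp only: kronecker_mult[OF P(6) P'(6) P(7) P'(7)] P(1) P'(1) kronecker_one)
    show "(Q \<otimes>\<^sub>m Q') * (P \<otimes>\<^sub>m P') = 1\<^sub>m (m * n)"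
      by (simp only: kronecker_mult[OF P(7) P'(7) P(6) P'(6)] P(2) P'(2) kronecker_one)
    show "G \<otimes>\<^sub>m G' = (P \<otimes>\<^sub>m P') * (H \<otimes>\<^sub>m H') * (Q \<otimes>\<^sub>m Q')"
      by (simp only: kronecker_mult[OF P(6) P'(6) P(5) P'(5)] P(3) P'(3)
          kronecker_mult[OF square_mult_carrier[OF P(6,5)] square_mult_carrier[OF P'(6,5)] P(7) P'(7)])
  qed (use P P' in auto)
qed

lemma gram_kronecker:
  assumes "A \<in> carrier_mat m m" "B \<in> carrier_mat n n"
  shows "adj (A \<otimes>\<^sub>m B) * (A \<otimes>\<^sub>m B) = (adj A * A) \<otimes>\<^sub>m (adj B * B)"
  using assms by (simp add: kronecker_adj[of _ m _ n] kronecker_mult[of _ m _ n])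

text \<open>The Gram matrix of the transpose is the transpose of \<open>A * adj A\<close>.
  Transposition and exchange of factors preserve the characteristic polynomial, which for Hermitian
  matrices suffices for similarity.\<close>

lemma gram_transpose_similar:
  assumes "A \<in> carrier_mat n n"
  shows "similar_mat (adj A\<^sup>T * A\<^sup>T) (adj A * A)"
proof (rule hermitian_similar)
  have c: "A\<^sup>T \<in> carrier_mat n n" using assms by simp
  have t: "adj A\<^sup>T * A\<^sup>T = (A * adj A)\<^sup>T"
  proof -
    have "(adj A)\<^sup>T = adj A\<^sup>T" by (intro eq_matI) auto
    thus ?thesis using transpose_mult[OF assms adj_carrier[OF assms]] by simp
  qed
  have "char_poly (A * adj A)\<^sup>T = char_poly (A * adj A)"
    using assms by (intro char_poly_transpose_mat[of _ n]) (auto intro!: square_mult_carrier)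
  thus "char_poly (adj A\<^sup>T * A\<^sup>T) = char_poly (adj A * A)"
    unfolding t using char_poly_mult_commute[OF assms adj_carrier[OF assms]] by simp
  show "adj (adj A\<^sup>T * A\<^sup>T) = adj A\<^sup>T * A\<^sup>T" "adj (adj A * A) = adj A * A"
    by (rule psd_hermitian[OF psd_gram[OF c]], rule psd_hermitian[OF psd_gram[OF assms]])
  show "adj A\<^sup>T * A\<^sup>T \<in> carrier_mat n n" "adj A * A \<in> carrier_mat n n"
    by (rule psd_carrier[OF psd_gram[OF c]], rule psd_carrier[OF psd_gram[OF assms]])
qed

lemma spec_sum_kronecker_transpose:
  assumes "A \<in> carrier_mat m m" "B \<in> carrier_mat n n"
    and "\<phi>\<^sub>1 \<in> {\<lambda>X. X, transpose_mat}" "\<phi>\<^sub>2 \<in> {\<lambda>X. X, transpose_mat}"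
  shows "spec_sum p (adj (\<phi>\<^sub>1 A \<otimes>\<^sub>m \<phi>\<^sub>2 B) * (\<phi>\<^sub>1 A \<otimes>\<^sub>m \<phi>\<^sub>2 B)) = spec_sum p (adj (A \<otimes>\<^sub>m B) * (A \<otimes>\<^sub>m B))"
proof -
  have sim: "similar_mat (adj (\<phi> A) * \<phi> A) (adj A * A)" "\<phi> A \<in> carrier_mat n n" "adj (\<phi> A) * \<phi> A \<in> carrier_mat n n"
    if "A \<in> carrier_mat n n" "\<phi> \<in> {\<lambda>X. X, transpose_mat}" for A \<phi> n
  proof -
    show c: "\<phi> A \<in> carrier_mat n n" using that by auto
    show "adj (\<phi> A) * \<phi> A \<in> carrier_mat n n" by (rule psd_carrier[OF psd_gram[OF c]])
    show "similar_mat (adj (\<phi> A) * \<phi> A) (adj A * A)"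
      using that gram_transpose_similar[OF that(1)] similar_mat_refl[OF psd_carrier[OF psd_gram[OF that(1)]]] by auto
  qed
  note A = sim[OF assms(1,3)] and B = sim[OF assms(2,4)]
  have "char_poly (adj (\<phi>\<^sub>1 A \<otimes>\<^sub>m \<phi>\<^sub>2 B) * (\<phi>\<^sub>1 A \<otimes>\<^sub>m \<phi>\<^sub>2 B)) = char_poly (adj (A \<otimes>\<^sub>m B) * (A \<otimes>\<^sub>m B))"
    unfolding gram_kronecker[OF A(2) B(2)] gram_kronecker[OF assms(1,2)]
    by (rule char_poly_similar, rule similar_kronecker[OF A(1) B(1) A(3) B(3)])
  thus ?thesis by (simp add: spec_sum_def)
qed

lemma spec_sum_unitary:
  assumes "unitary_mat N U" "unitary_mat N V" "X \<in> carrier_mat N N"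
  shows "spec_sum p (adj (U * X * V) * (U * X * V)) = spec_sum p (adj X * X)"
proof -
  note U = unitary_matD[OF assms(1)] and V = unitary_matD[OF assms(2)]
  have "adj (U * X * V) * (U * X * V) = adj V * (adj X * (adj U * U) * X) * V"
    using U(1) V(1) assms(3)
    by (simp add: adj_mult[where a = N and b = N and c = N] square_simps[where n = N])
  also have "\<dots> = adj V * (adj X * X) * V" unfolding U(2) using assms(3) by simp
  finally have "char_poly (adj (U * X * V) * (U * X * V)) = char_poly (adj X * X)"
    using unitary_similar[OF assms(2) psd_carrier[OF psd_gram[OF assms(3)]]] char_poly_similar by metis
  thus ?thesis by (simp add: spec_sum_def)
qed

lemma orth_unitary:
  assumes "unitary_mat N U" "unitary_mat N V" "X \<in> carrier_mat N N" "Y \<in> carrier_mat N N" "orth N X Y"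
  shows "orth N (U * X * V) (U * Y * V)"
proof -
  note U = unitary_matD[OF assms(1)] and V = unitary_matD[OF assms(2)]
  have "adj (U * X * V) * (U * Y * V) = adj V * (adj X * (adj U * U) * Y) * V"
    "(U * X * V) * adj (U * Y * V) = U * (X * (V * adj V) * adj Y) * adj U"
    using U(1) V(1) assms(3,4)
    by (simp_all add: adj_mult[where a = N and b = N and c = N] square_simps[where n = N])
  thus ?thesis unfolding orth_def U(2) V(3) using assms(3-5) U(1) V(1) by (simp add: orth_def)
qed

text \<open>Expansion at \<open>A + B\<close> gives the sum of the cross terms, and at
  \<open>A + \<i> \<cdot>\<^sub>m B\<close> their difference up to a factor, so complex scalars
  separate them. Conjugation is on the left in \<open>?f\<close> and on the right in
  \<open>?g\<close>, whence the opposite signs.\<close>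

lemma orth_polarization:
  assumes h: "linear_mm n N h" and h': "linear_mm n N h'"
    and orth: "\<And>A. A \<in> carrier_mat n n \<Longrightarrow> orth N (h A) (h' A)"
    and A: "A \<in> carrier_mat n n" and B: "B \<in> carrier_mat n n"
  shows "orth N (h A) (h' B)"
proof (rule orthI)
  note l = linear_mmD[OF h] linear_mmD[OF h']
  have dims [simp]: "dim_row (h A) = N" "dim_col (h A) = N" "dim_row (h' A) = N" "dim_col (h' A) = N"
    if "A \<in> carrier_mat n n" for A using l(1,5)[OF that] by auto
  have zero: "x = 0" if "x + y = 0" "\<i> * x - \<i> * y = 0" for x y :: complex
  proof -
    have "\<i> * (x - y) = 0" using that(2) by (simp add: algebra_simps)
    thus ?thesis using that(1) by simp
  qed
  have iB: "\<i> \<cdot>\<^sub>m B \<in> carrier_mat n n" using B by simp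
  fix c d assume cd: "c < N" "d < N"
  let ?f = "\<lambda>A B. \<Sum>u<N. cnj (h A $$ (u, c)) * h' B $$ (u, d)"
  let ?g = "\<lambda>A B. \<Sum>u<N. h A $$ (c, u) * cnj (h' B $$ (d, u))"
  have f0: "?f A A = 0" "?g A A = 0" if "A \<in> carrier_mat n n" for A
    using orthD[OF orth[OF that] l(1,5)[OF that] cd] by auto
  have "?f (A + B) (A + B) = ?f A A + ?f A B + (?f B A + ?f B B)"
    "?g (A + B) (A + B) = ?g A A + ?g A B + (?g B A + ?g B B)"
    using A B cd by (simp_all add: l sum.distrib distrib_left distrib_right)
  hence 1: "?f A B + ?f B A = 0" "?g A B + ?g B A = 0" using f0 A B by auto
  have "?f (A + \<i> \<cdot>\<^sub>m B) (A + \<i> \<cdot>\<^sub>m B) = ?f A A + \<i> * ?f A B + (- \<i> * ?f B A + ?f B B)"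
    "?g (A + \<i> \<cdot>\<^sub>m B) (A + \<i> \<cdot>\<^sub>m B) = ?g A A + - \<i> * ?g A B + (\<i> * ?g B A + ?g B B)"
    using A B iB cd
    by (simp_all add: l sum.distrib distrib_left distrib_right left_diff_distrib right_diff_distrib
        sum_subtractf sum_distrib_left mult.left_commute mult.assoc sum_negf)
  hence 2: "\<i> * ?f A B - \<i> * ?f B A = 0" "\<i> * ?g A B - \<i> * ?g B A = 0" using f0 A B iB by auto
  show "?f A B = 0" "?g A B = 0" using zero 1 2 by blast+
qed (use linear_mmD(1)[OF h A] linear_mmD(1)[OF h' B] in auto)

lemma linear_mm_eqI:
  assumes h: "linear_mm n N h" and h': "linear_mm n N h'"
    and eq: "\<And>r s. r < n \<Longrightarrow> s < n \<Longrightarrow> h (munit n r s) = h' (munit n r s)"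
    and A: "A \<in> carrier_mat n n"
  shows "h A = h' A"
proof -
  \<comment> \<open>The entries of \<open>A\<close> before position \<open>K\<close> in row-major
    order: each step adds one multiple of a unit, which makes the expansion in units an induction on
    \<open>K\<close>.\<close>
  define T where "T K = mat n n (\<lambda>(i, j). if i * n + j < K then A $$ (i, j) else 0)" for K
  have T: "T K \<in> carrier_mat n n" for K by (simp add: T_def)
  have "h (T K) = h' (T K)" if "K \<le> n * n" for K
    using that
  proof (induction K)
    case 0
    \<comment> \<open>Written as a zero multiple so that homogeneity yields the value.\<close>
    have z: "T 0 = 0 \<cdot>\<^sub>m 0\<^sub>m n n" by (intro eq_matI) (auto simp: T_def)
    have "h (0\<^sub>m n n) \<in> carrier_mat N N" "h' (0\<^sub>m n n) \<in> carrier_mat N N"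
      using linear_mmD(1)[OF h] linear_mmD(1)[OF h'] by auto
    moreover have "h (T 0) = 0 \<cdot>\<^sub>m h (0\<^sub>m n n)" "h' (T 0) = 0 \<cdot>\<^sub>m h' (0\<^sub>m n n)"
      unfolding z by (rule linear_mmD(3)[OF h], simp, rule linear_mmD(3)[OF h'], simp)
    ultimately show ?case by (auto intro!: eq_matI)
  next
    case (Suc K)
    define r s where "r = K div n" and "s = K mod n"
    have rs: "r < n" "s < n" using div_mod_less[of K n n] Suc by (auto simp: r_def s_def)
    have K: "K = r * n + s" by (simp add: r_def s_def)
    have "T (Suc K) = T K + A $$ (r, s) \<cdot>\<^sub>m munit n r s"
    proof (rule eq_matI)
      fix i j assume "i < dim_row (T K + A $$ (r, s) \<cdot>\<^sub>m munit n r s)" "j < dim_col (T K + A $$ (r, s) \<cdot>\<^sub>m munit n r s)"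
      hence ij: "i < n" "j < n" by auto
      have "i * n + j = K \<longleftrightarrow> i = r \<and> j = s" using ij by (auto simp: r_def s_def)
      moreover have "i * n + j < Suc K \<longleftrightarrow> i * n + j < K \<or> i * n + j = K" by auto
      ultimately show "T (Suc K) $$ (i, j) = (T K + A $$ (r, s) \<cdot>\<^sub>m munit n r s) $$ (i, j)"
        using ij by (auto simp: T_def)
    qed (auto simp: T_def)
    thus ?case using Suc eq[OF rs] T by (simp add: linear_mmD[OF h] linear_mmD[OF h'])
  qed
  moreover have "T (n * n) = A"
  proof (rule eq_matI)
    fix i j assume "i < dim_row A" "j < dim_col A"
    hence ij: "i < n" "j < n" using A by auto
    thus "T (n * n) $$ (i, j) = A $$ (i, j)" using index_pair_less[of i n j n] by (simp add: T_def)
  qed (use A in \<open>auto simp: T_def\<close>)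
  ultimately show ?thesis by (metis order_refl)
qed

lemma linear_mm_transpose:
  assumes "linear_mm n N h"
  shows "linear_mm n N (\<lambda>A. h A\<^sup>T)"
proof -
  have "(c \<cdot>\<^sub>m A)\<^sup>T = c \<cdot>\<^sub>m A\<^sup>T" for c and A :: "complex mat" by (intro eq_matI) auto
  thus ?thesis
    using linear_mmD[OF assms] unfolding linear_mm_def by (auto simp: transpose_add[of _ n n])
qed

lemma linear_mm_conj:
  assumes "linear_mm n N h" "U \<in> carrier_mat N N" "V \<in> carrier_mat N N"
  shows "linear_mm n N (\<lambda>A. U * h A * V)"
  using linear_mmD[OF assms(1)] assms(2,3) unfolding linear_mm_def
  by (auto simp: mult_add_distrib_mat[of _ N N _ N] add_mult_distrib_mat[of _ N N _ _ N] square_mult_carrier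
      mult_smult_distrib[of _ N N _ N] mult_smult_assoc_mat[of _ N N _ N])

lemma linear_mm_comp:
  assumes "linear_mm n N h" "linear_mm N M g"
  shows "linear_mm n M (\<lambda>A. g (h A))"
  using linear_mmD[OF assms(1)] linear_mmD[OF assms(2)] unfolding linear_mm_def by auto

section \<open>The isometry theorem\<close>

text \<open>Needed at three scalars: 1 for the norm of a unit, 0 to see that its image is nonzero,
  and the scalar left by \<open>orth_frame\<close> to see that it is unimodular.\<close>

lemma spec_sum_smult_munit:
  assumes "p > 0" "k < N"
  shows "spec_sum p (adj (c \<cdot>\<^sub>m munit N k k) * (c \<cdot>\<^sub>m munit N k k)) = cmod c powr p"
proof -
  let ?d = "\<lambda>i. if i = k then (cmod c)\<^sup>2 else 0"
  have "c \<cdot>\<^sub>m munit N k k = dmat N (\<lambda>i. if i = k then c else 0)" by (intro eq_matI) auto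
  hence eq: "adj (c \<cdot>\<^sub>m munit N k k) * (c \<cdot>\<^sub>m munit N k k) = 1\<^sub>m N * dmat N (\<lambda>i. complex_of_real (?d i)) * adj (1\<^sub>m N)"
    by (intro eq_matI) (auto simp: dmat_mult_index complex_norm_square mult.commute simp del: of_real_power)
  have one: "unitary_mat N (1\<^sub>m N)" by (auto simp: unitary_mat_def)
  have "spec_sum p (adj (c \<cdot>\<^sub>m munit N k k) * (c \<cdot>\<^sub>m munit N k k)) = (\<Sum>i<N. ?d i powr (p / 2))"
    by (rule spec_sum_diagonal[OF one eq]) auto
  also have "\<dots> = ((cmod c)\<^sup>2) powr (p / 2)"
    using assms by (subst sum_single[of k]) auto
  also have "\<dots> = cmod c powr p"
    by (simp add: powr_numeral[symmetric] powr_powr del: powr_numeral)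
  finally show ?thesis .
qed

lemma gram_uminus:
  assumes "Y \<in> carrier_mat N N"
  shows "adj (- Y) * (- Y) = adj Y * Y"
  using assms by (intro eq_matI) (auto simp: mult_index[of _ N N _ N] sum_negf)

lemma orth_uminus:
  assumes "orth N X Y" "X \<in> carrier_mat N N" "Y \<in> carrier_mat N N"
  shows "orth N X (- Y)"
  using orthD[OF assms] assms(2,3) by (intro orthI) (auto simp: sum_negf)

text \<open>The Clarkson equalities mention only \<open>X\<close>, \<open>Y\<close> and their sum
  and difference, so norm preservation is asked at these four matrices, all of which can be arranged
  to be products.\<close>

lemma isometry_preserves_orth:
  assumes p: "p > 0" "p \<noteq> 2" and lin: "linear_mm N N \<phi>"
    and X: "X \<in> carrier_mat N N" and Y: "Y \<in> carrier_mat N N" and orth: "orth N X Y"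
    and iso: "\<And>Z. Z \<in> {X, Y, X + Y, X + - Y} \<Longrightarrow> spec_sum p (adj (\<phi> Z) * \<phi> Z) = spec_sum p (adj Z * Z)"
  shows "orth N (\<phi> X) (\<phi> Y)"
proof (rule spec_sum_orth_converse[OF p])
  note l = linear_mmD[OF lin]
  have mY: "- Y \<in> carrier_mat N N" using Y by simp
  show "\<phi> X \<in> carrier_mat N N" "\<phi> Y \<in> carrier_mat N N" using l X Y by auto
  have 1: "\<phi> (X + Y) = \<phi> X + \<phi> Y" "\<phi> (X + - Y) = \<phi> X + - \<phi> Y"
    using l(2)[OF X Y] l(2)[OF X mY] l(4)[OF Y] by simp_all
  show "spec_sum p (adj (\<phi> X + \<phi> Y) * (\<phi> X + \<phi> Y)) = spec_sum p (adj (\<phi> X) * \<phi> X) + spec_sum p (adj (\<phi> Y) * \<phi> Y)"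
    unfolding 1[symmetric] using spec_sum_orth[OF p X Y orth] iso by simp
  show "spec_sum p (adj (\<phi> X + - \<phi> Y) * (\<phi> X + - \<phi> Y)) = spec_sum p (adj (\<phi> X) * \<phi> X) + spec_sum p (adj (\<phi> Y) * \<phi> Y)"
    unfolding 1[symmetric] using spec_sum_orth[OF p X mY orth_uminus[OF orth X Y]] iso
    by (simp add: gram_uminus[OF Y])
qed

locale tensor_isometry =
  fixes m n :: nat and p :: real and \<phi> :: "complex mat \<Rightarrow> complex mat"
  assumes mn: "m \<ge> 2" "n \<ge> 2" and p: "p > 0" "p \<noteq> 2"
    and linear: "linear_mm (m * n) (m * n) \<phi>"
    and iso: "\<And>A B. A \<in> carrier_mat m m \<Longrightarrow> B \<in> carrier_mat n n \<Longrightarrow>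
      spec_sum p (adj (\<phi> (A \<otimes>\<^sub>m B)) * \<phi> (A \<otimes>\<^sub>m B)) = spec_sum p (adj (A \<otimes>\<^sub>m B) * (A \<otimes>\<^sub>m B))"
begin

lemma linear_left: "B \<in> carrier_mat n n \<Longrightarrow> linear_mm m (m * n) (\<lambda>A. \<phi> (A \<otimes>\<^sub>m B))"
  and linear_right: "A \<in> carrier_mat m m \<Longrightarrow> linear_mm n (m * n) (\<lambda>B. \<phi> (A \<otimes>\<^sub>m B))"
  by (intro linear_mm_comp[OF _ linear] linear_mm_kronecker; assumption)+

text \<open>
  The norm condition only sees sums of product matrices that are themselves products, so first the
  second factor is the same on both sides; polarization then separates the two second factors.
\<close>

lemma orth_left:
  assumes A: "A \<in> carrier_mat m m" and C: "C \<in> carrier_mat m m" and B: "B \<in> carrier_mat n n"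
    and D: "D \<in> carrier_mat n n" and orth: "orth m A C"
  shows "orth (m * n) (\<phi> (A \<otimes>\<^sub>m B)) (\<phi> (C \<otimes>\<^sub>m D))"
proof (rule orth_polarization[OF linear_right[OF A] linear_right[OF C] _ B D])
  fix B :: "complex mat" assume B: "B \<in> carrier_mat n n"
  have mC: "- C \<in> carrier_mat m m" using C by simp
  have 1: "A \<otimes>\<^sub>m B + C \<otimes>\<^sub>m B = (A + C) \<otimes>\<^sub>m B" "A \<otimes>\<^sub>m B + - (C \<otimes>\<^sub>m B) = (A + - C) \<otimes>\<^sub>m B"
    using kronecker_add_left[OF A C B] kronecker_add_left[OF A mC B]
      linear_mmD(4)[OF linear_mm_kronecker(1)[OF B] C] by simp_all
  show "orth (m * n) (\<phi> (A \<otimes>\<^sub>m B)) (\<phi> (C \<otimes>\<^sub>m B))"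
  proof (rule isometry_preserves_orth[OF p linear])
    show "A \<otimes>\<^sub>m B \<in> carrier_mat (m * n) (m * n)" "C \<otimes>\<^sub>m B \<in> carrier_mat (m * n) (m * n)"
      using A B C by auto
    show "orth (m * n) (A \<otimes>\<^sub>m B) (C \<otimes>\<^sub>m B)" by (rule orth_kronecker(1)[OF A C B B orth])
    fix Z assume "Z \<in> {A \<otimes>\<^sub>m B, C \<otimes>\<^sub>m B, A \<otimes>\<^sub>m B + C \<otimes>\<^sub>m B, A \<otimes>\<^sub>m B + - (C \<otimes>\<^sub>m B)}"
    hence "Z \<in> (\<lambda>A'. A' \<otimes>\<^sub>m B) ` carrier_mat m m" unfolding 1 using A C mC by (auto intro!: imageI)
    then obtain A' where "A' \<in> carrier_mat m m" "Z = A' \<otimes>\<^sub>m B" by blast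
    thus "spec_sum p (adj (\<phi> Z) * \<phi> Z) = spec_sum p (adj Z * Z)" using iso B by simp
  qed
qed

lemma orth_right:
  assumes A: "A \<in> carrier_mat m m" and C: "C \<in> carrier_mat m m" and B: "B \<in> carrier_mat n n"
    and D: "D \<in> carrier_mat n n" and orth: "orth n B D"
  shows "orth (m * n) (\<phi> (A \<otimes>\<^sub>m B)) (\<phi> (C \<otimes>\<^sub>m D))"
proof (rule orth_polarization[OF linear_left[OF B] linear_left[OF D] _ A C])
  fix A :: "complex mat" assume A: "A \<in> carrier_mat m m"
  have mD: "- D \<in> carrier_mat n n" using D by simp
  have 1: "A \<otimes>\<^sub>m B + A \<otimes>\<^sub>m D = A \<otimes>\<^sub>m (B + D)" "A \<otimes>\<^sub>m B + - (A \<otimes>\<^sub>m D) = A \<otimes>\<^sub>m (B + - D)"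
    using kronecker_add_right[OF A B D] kronecker_add_right[OF A B mD]
      linear_mmD(4)[OF linear_mm_kronecker(2)[OF A] D] by simp_all
  show "orth (m * n) (\<phi> (A \<otimes>\<^sub>m B)) (\<phi> (A \<otimes>\<^sub>m D))"
  proof (rule isometry_preserves_orth[OF p linear])
    show "A \<otimes>\<^sub>m B \<in> carrier_mat (m * n) (m * n)" "A \<otimes>\<^sub>m D \<in> carrier_mat (m * n) (m * n)"
      using A B D by auto
    show "orth (m * n) (A \<otimes>\<^sub>m B) (A \<otimes>\<^sub>m D)" by (rule orth_kronecker(2)[OF A A B D orth])
    fix Z assume "Z \<in> {A \<otimes>\<^sub>m B, A \<otimes>\<^sub>m D, A \<otimes>\<^sub>m B + A \<otimes>\<^sub>m D, A \<otimes>\<^sub>m B + - (A \<otimes>\<^sub>m D)}"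
    hence "Z \<in> (\<lambda>B'. A \<otimes>\<^sub>m B') ` carrier_mat n n" unfolding 1 using B D mD by (auto intro!: imageI)
    then obtain B' where "B' \<in> carrier_mat n n" "Z = A \<otimes>\<^sub>m B'" by blast
    thus "spec_sum p (adj (\<phi> Z) * \<phi> Z) = spec_sum p (adj Z * Z)" using iso A by simp
  qed
qed

end

text \<open>
  \<open>N\<close> nonzero pairwise orthogonal matrices of size \<open>N\<close> have rank one each: nonzero columns, one from
  each matrix, already form an orthogonal basis, and so do nonzero rows.
\<close>

lemma orth_frame:
  assumes X: "\<And>k. k < N \<Longrightarrow> X k \<in> carrier_mat N N" and nz: "\<And>k. k < N \<Longrightarrow> X k \<noteq> 0\<^sub>m N N"
    and orth: "\<And>k l. k < N \<Longrightarrow> l < N \<Longrightarrow> k \<noteq> l \<Longrightarrow> orth N (X k) (X l)"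
  obtains U V c where "unitary_mat N U" "unitary_mat N V"
    "\<And>k. k < N \<Longrightarrow> U * X k * V = c k \<cdot>\<^sub>m munit N k k"
proof -
  have "\<exists>r s. r < N \<and> s < N \<and> X k $$ (r, s) \<noteq> 0" if "k < N" for k
  proof (rule ccontr)
    assume "\<not> ?thesis"
    hence "X k = 0\<^sub>m N N" using X[OF that] by (intro eq_matI) auto
    thus False using nz that by blast
  qed
  then obtain r s where rs: "\<And>k. k < N \<Longrightarrow> r k < N" "\<And>k. k < N \<Longrightarrow> s k < N"
    "\<And>k. k < N \<Longrightarrow> X k $$ (r k, s k) \<noteq> 0" by metis
  define a where "a k = sqrt (\<Sum>i<N. (cmod (X k $$ (i, s k)))\<^sup>2)" for k
  define b where "b k = sqrt (\<Sum>i<N. (cmod (X k $$ (r k, i)))\<^sup>2)" for k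
  have pos: "(\<Sum>i<N. (cmod (f i))\<^sup>2) > 0" if "j < N" "f j \<noteq> 0" for f j
    by (rule sum_pos2[of _ j]) (use that in auto)
  have apos: "a k > 0" and bpos: "b k > 0" if "k < N" for k
    unfolding a_def b_def
    using pos[of "r k" "\<lambda>i. X k $$ (i, s k)"] pos[of "s k" "\<lambda>i. X k $$ (r k, i)"] rs[OF that] by simp_all
  have "a k * a k = (\<Sum>i<N. (cmod (X k $$ (i, s k)))\<^sup>2)" "b k * b k = (\<Sum>i<N. (cmod (X k $$ (r k, i)))\<^sup>2)" for k
    unfolding a_def b_def by (simp_all add: sum_nonneg)
  hence a2: "(\<Sum>i<N. cnj (X k $$ (i, s k)) * X k $$ (i, s k)) = complex_of_real (a k * a k)"
    and b2: "(\<Sum>i<N. X k $$ (r k, i) * cnj (X k $$ (r k, i))) = complex_of_real (b k * b k)" for k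
    by (simp_all add: complex_norm_square mult.commute del: of_real_power of_real_mult)
  \<comment> \<open>Conjugation makes multiplication by \<open>U\<close> and \<open>V\<close> take
    inner products with the chosen columns and rows.\<close>
  define U where "U = mat N N (\<lambda>(k, i). cnj (X k $$ (i, s k)) / a k)"
  define V where "V = mat N N (\<lambda>(i, k). cnj (X k $$ (r k, i)) / b k)"
  have Uc: "U \<in> carrier_mat N N" and Vc: "V \<in> carrier_mat N N" by (auto simp: U_def V_def)
  have U: "unitary_mat N (adj U)"
  proof (rule unitary_matI)
    show "adj (adj U) * adj U = 1\<^sub>m N"
    proof (rule eq_matI)
      fix k l assume "k < dim_row (1\<^sub>m N :: complex mat)" "l < dim_col (1\<^sub>m N :: complex mat)"
      hence kl: "k < N" "l < N" by auto
      have "(adj (adj U) * adj U) $$ (k, l) = (\<Sum>i<N. cnj (X k $$ (i, s k)) * X l $$ (i, s l)) / (a k * a l)"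
        using kl Uc by (simp add: mult_index[of _ N N _ N] U_def sum_divide_distrib)
      also have "\<dots> = 1\<^sub>m N $$ (k, l)"
        using kl apos[of k] a2[of k] orthD(1)[OF orth X X rs(2) rs(2), of k l k l] by (cases "k = l") auto
      finally show "(adj (adj U) * adj U) $$ (k, l) = 1\<^sub>m N $$ (k, l)" .
    qed (use Uc in auto)
  qed (use Uc in auto)
  have V: "unitary_mat N V"
  proof (rule unitary_matI[OF Vc])
    show "adj V * V = 1\<^sub>m N"
    proof (rule eq_matI)
      fix k l assume "k < dim_row (1\<^sub>m N :: complex mat)" "l < dim_col (1\<^sub>m N :: complex mat)"
      hence kl: "k < N" "l < N" by auto
      have "(adj V * V) $$ (k, l) = (\<Sum>i<N. X k $$ (r k, i) * cnj (X l $$ (r l, i))) / (b k * b l)"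
        using kl Vc by (simp add: mult_index[of _ N N _ N] V_def sum_divide_distrib)
      also have "\<dots> = 1\<^sub>m N $$ (k, l)"
        using kl bpos[of k] b2[of k] orthD(2)[OF orth X X rs(1) rs(1), of k l k l] by (cases "k = l") auto
      finally show "(adj V * V) $$ (k, l) = 1\<^sub>m N $$ (k, l)" .
    qed (use Vc in auto)
  qed
  \<comment> \<open>Different matrices have orthogonal columns, so \<open>U * X l\<close> lives in
    row \<open>l\<close>; likewise \<open>X l * V\<close> lives in column \<open>l\<close>.\<close>
  have UX: "(U * X l) $$ (k, d) = 0" if "k < N" "l < N" "d < N" "k \<noteq> l" for k l d
  proof -
    have "(U * X l) $$ (k, d) = (\<Sum>i<N. cnj (X k $$ (i, s k)) * X l $$ (i, d)) / a k"
      using that X Uc by (simp add: mult_index[of _ N N _ N] U_def sum_divide_distrib)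
    thus ?thesis using orthD(1)[OF orth X X rs(2) that(3), of k l k] that by simp
  qed
  have XV: "(X l * V) $$ (d, k) = 0" if "k < N" "l < N" "d < N" "k \<noteq> l" for k l d
  proof -
    have "(X l * V) $$ (d, k) = (\<Sum>i<N. X l $$ (d, i) * cnj (X k $$ (r k, i))) / b k"
      using that X Vc by (simp add: mult_index[of _ N N _ N] V_def sum_divide_distrib)
    thus ?thesis using orthD(2)[OF orth X X that(3) rs(1), of l k k] that by simp
  qed
  have eq: "U * X l * V = (U * X l * V) $$ (l, l) \<cdot>\<^sub>m munit N l l" if l: "l < N" for l
  proof (rule eq_matI)
    fix k k' assume "k < dim_row ((U * X l * V) $$ (l, l) \<cdot>\<^sub>m munit N l l)"
      "k' < dim_col ((U * X l * V) $$ (l, l) \<cdot>\<^sub>m munit N l l)"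
    hence kk: "k < N" "k' < N" by auto
    have "(U * X l * V) $$ (k, k') = 0" if "k \<noteq> l"
      using mult_index[of "U * X l" N N V N k k'] Uc Vc X[OF l] kk l that
      by (simp add: UX square_mult_carrier)
    moreover have "(U * X l * V) $$ (k, k') = 0" if "k' \<noteq> l"
      using mult_index[of U N N "X l * V" N k k'] Uc Vc X[OF l] kk l that
      by (simp add: XV square_simps[where n = N])
    ultimately show "(U * X l * V) $$ (k, k') = ((U * X l * V) $$ (l, l) \<cdot>\<^sub>m munit N l l) $$ (k, k')"
      using kk l by auto
  qed (use Uc Vc X l in auto)
  have "unitary_mat N U" using unitary_adj[OF U] by simp
  thus ?thesis by (rule that[OF _ V]) (rule eq)
qed

section \<open>Unitary normalization of the diagonal units\<close>

context tensor_isometry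
begin

lemma munit_eq_kronecker:
  assumes "k < m * n"
  shows "munit (m * n) k k = munit m (k div n) (k div n) \<otimes>\<^sub>m munit n (k mod n) (k mod n)"
  using kronecker_munit[of "k div n" m "k mod n" n "k div n" "k mod n"] div_mod_less[OF assms] by simp

lemma iso_munit:
  assumes "k < m * n"
  shows "spec_sum p (adj (\<phi> (munit (m * n) k k)) * \<phi> (munit (m * n) k k)) = 1"
proof -
  have "spec_sum p (adj (\<phi> (munit (m * n) k k)) * \<phi> (munit (m * n) k k))
      = spec_sum p (adj (munit (m * n) k k) * munit (m * n) k k)"
    unfolding munit_eq_kronecker[OF assms] by (rule iso) auto
  also have "\<dots> = 1"
  proof -
    have "1 \<cdot>\<^sub>m munit (m * n) k k = munit (m * n) k k" by (intro eq_matI) auto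
    thus ?thesis using spec_sum_smult_munit[OF p(1) assms, of 1] by simp
  qed
  finally show ?thesis .
qed

lemma normalization:
  obtains U V where "unitary_mat (m * n) U" "unitary_mat (m * n) V"
    "tensor_system m n (m * n) (\<lambda>i j. i * n + j) (\<lambda>A B. U * \<phi> (A \<otimes>\<^sub>m B) * V)"
proof -
  let ?N = "m * n"
  define X where "X k = \<phi> (munit ?N k k)" for k
  note l = linear_mmD[OF linear]
  have X: "X k \<in> carrier_mat ?N ?N" for k unfolding X_def by (rule l(1)) simp
  have nz: "X k \<noteq> 0\<^sub>m ?N ?N" if "k < ?N" for k
  proof
    assume "X k = 0\<^sub>m ?N ?N"
    moreover have "0\<^sub>m ?N ?N = 0 \<cdot>\<^sub>m munit ?N k k" by (intro eq_matI) auto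
    ultimately have "spec_sum p (adj (X k) * X k) = 0"
      using spec_sum_smult_munit[OF p(1) that, of 0] by simp
    thus False using iso_munit[OF that] by (simp add: X_def)
  qed
  have orthX: "orth ?N (X k) (X l)" if kl: "k < ?N" "l < ?N" "k \<noteq> l" for k l
  \<comment> \<open>Distinct diagonal units of the large space differ in at least one tensor factor,
    which supplies the orthogonality.\<close>
  proof (cases "k div n = l div n")
    case True
    hence "k mod n \<noteq> l mod n" using kl(3) by (metis div_mult_mod_eq)
    thus ?thesis unfolding X_def munit_eq_kronecker[OF kl(1)] munit_eq_kronecker[OF kl(2)]
      using div_mod_less[OF kl(1)] div_mod_less[OF kl(2)] by (intro orth_right munit_orth) auto
  next
    case False
    thus ?thesis unfolding X_def munit_eq_kronecker[OF kl(1)] munit_eq_kronecker[OF kl(2)]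
      using div_mod_less[OF kl(1)] div_mod_less[OF kl(2)] by (intro orth_left munit_orth) auto
  qed
  obtain U V c where U: "unitary_mat ?N U" and V: "unitary_mat ?N V"
    and UXV: "\<And>k. k < ?N \<Longrightarrow> U * X k * V = c k \<cdot>\<^sub>m munit ?N k k"
    by (rule orth_frame[of ?N X]) (use X nz orthX in blast)+
  have c1: "cmod (c k) = 1" if k: "k < ?N" for k
  proof -
    have "cmod (c k) powr p = 1"
      using spec_sum_smult_munit[OF p(1) k, of "c k"] spec_sum_unitary[OF U V X[of k], of p] iso_munit[OF k]
      by (simp add: UXV[OF k] X_def[symmetric])
    hence "(cmod (c k) powr p) powr (1 / p) = 1" by simp
    thus ?thesis using p by (simp add: powr_powr)
  qed
  \<comment> \<open>Absorbs the unimodular scalars, so that the diagonal units become fixed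
    exactly.\<close>
  define E where "E = dmat ?N (\<lambda>k. cnj (c k))"
  have E: "unitary_mat ?N E" unfolding E_def by (rule unitary_dmat) (use c1 in simp)
  define W where "W = V * E"
  have W: "unitary_mat ?N W" unfolding W_def by (rule unitary_mult[OF V E])
  note Uc = unitary_matD(1)[OF U] and Vc = unitary_matD(1)[OF V] and Wc = unitary_matD(1)[OF W]
  have UXW: "U * X k * W = munit ?N k k" if k: "k < ?N" for k
  proof -
    have "U * X k * W = (c k \<cdot>\<^sub>m munit ?N k k) * E"
      unfolding W_def UXV[OF k, symmetric] using Uc Vc X[of k] unitary_matD(1)[OF E]
      by (simp add: square_simps[where n = ?N])
    also have "\<dots> = munit ?N k k"
    proof (rule eq_matI)
      fix i j assume "i < dim_row (munit ?N k k)" "j < dim_col (munit ?N k k)"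
      moreover have "c k * cnj (c k) = 1" using c1[OF k] complex_norm_square[of "c k"] by simp
      ultimately show "((c k \<cdot>\<^sub>m munit ?N k k) * E) $$ (i, j) = munit ?N k k $$ (i, j)"
        by (auto simp: E_def dmat_mult_index(2))
    qed (auto simp: E_def)
    finally show ?thesis .
  qed
  have "tensor_system m n ?N (\<lambda>i j. i * n + j) (\<lambda>A B. U * \<phi> (A \<otimes>\<^sub>m B) * W)"
  proof unfold_locales
    show "linear_mm m ?N (\<lambda>A. U * \<phi> (A \<otimes>\<^sub>m B) * W)" if "B \<in> carrier_mat n n" for B
      by (rule linear_mm_conj[OF linear_left[OF that] Uc Wc])
    show "linear_mm n ?N (\<lambda>B. U * \<phi> (A \<otimes>\<^sub>m B) * W)" if "A \<in> carrier_mat m m" for A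
      by (rule linear_mm_conj[OF linear_right[OF that] Uc Wc])
    show "orth ?N (U * \<phi> (A \<otimes>\<^sub>m B) * W) (U * \<phi> (C \<otimes>\<^sub>m D) * W)"
      if "A \<in> carrier_mat m m" "C \<in> carrier_mat m m" "B \<in> carrier_mat n n" "D \<in> carrier_mat n n" "orth m A C"
      for A B C D
      by (rule orth_unitary[OF U W _ _ orth_left[OF that]]) (use that in \<open>auto intro!: l(1)\<close>)
    show "orth ?N (U * \<phi> (A \<otimes>\<^sub>m B) * W) (U * \<phi> (C \<otimes>\<^sub>m D) * W)"
      if "A \<in> carrier_mat m m" "C \<in> carrier_mat m m" "B \<in> carrier_mat n n" "D \<in> carrier_mat n n" "orth n B D"
      for A B C D
      by (rule orth_unitary[OF U W _ _ orth_right[OF that]]) (use that in \<open>auto intro!: l(1)\<close>)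
    show "i * n + j < ?N" if "i < m" "j < n" for i j by (rule index_pair_less[OF that])
    show "i = k \<and> j = l" if "i < m" "j < n" "k < m" "l < n" "i * n + j = k * n + l" for i j k l
      using arg_cong[OF that(5), of "\<lambda>x. x div n"] arg_cong[OF that(5), of "\<lambda>x. x mod n"] that(2,4) by simp
    show "\<exists>i<m. \<exists>j<n. k = i * n + j" if "k < ?N" for k
      using div_mod_less[OF that] by (metis div_mult_mod_eq)
    show "U * \<phi> (munit m i i \<otimes>\<^sub>m munit n j j) * W = munit ?N (i * n + j) (i * n + j)" if "i < m" "j < n" for i j
      using UXW[OF index_pair_less[OF that]] that by (simp add: X_def kronecker_munit)
  qed (use mn in auto)
  thus ?thesis using that U W by blast
qed

end

section \<open>Partial transposes\<close>

context tensor_system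
begin

text \<open>Orthogonality is stable under transposition and diagonal units are fixed by it, so the
  axioms survive.\<close>

lemma transpose_left: "tensor_system m n N \<iota> (\<lambda>A B. \<Phi> A\<^sup>T B)"
proof unfold_locales
  show "linear_mm m N (\<lambda>A. \<Phi> A\<^sup>T B)" if "B \<in> carrier_mat n n" for B
    using linear_mm_transpose[OF linear1[OF that]] .
qed (use mn linear2 orth1 orth2 index inj surj diag orth_transpose in auto)

lemma transpose_right: "tensor_system m n N \<iota> (\<lambda>A B. \<Phi> A B\<^sup>T)"
proof unfold_locales
  show "linear_mm n N (\<lambda>B. \<Phi> A B\<^sup>T)" if "A \<in> carrier_mat m m" for A
    using linear_mm_transpose[OF linear2[OF that]] .
qed (use mn linear1 orth1 orth2 index inj surj diag orth_transpose in auto)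

text \<open>The second entry is the first one after transposing the left factor;
  \<open>a_or_b\<close> makes one of the two survive.\<close>

lemma nonzero_left:
  "\<Phi> (munit m 0 1) (munit n 0 0) $$ (\<iota> 0 0, \<iota> 1 0) \<noteq> 0 \<or> \<Phi> (munit m 1 0) (munit n 0 0) $$ (\<iota> 0 0, \<iota> 1 0) \<noteq> 0"
proof -
  interpret h: unit_system m N "\<lambda>i. \<iota> i 0" "\<lambda>A. \<Phi> A (munit n 0 0)" by (rule unit_system1) (use mn in simp)
  have "h.a 0 1 \<noteq> 0 \<or> h.b 1 0 \<noteq> 0" using h.a_or_b[of 0 1] h.b_cnj[of 0 1] mn by auto
  thus ?thesis by (simp add: h.a_def h.b_def)
qed

lemma nonzero_right:
  "\<Phi> (munit m 0 0) (munit n 0 1) $$ (\<iota> 0 0, \<iota> 0 1) \<noteq> 0 \<or> \<Phi> (munit m 0 0) (munit n 1 0) $$ (\<iota> 0 0, \<iota> 0 1) \<noteq> 0"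
proof -
  interpret h: unit_system n N "\<iota> 0" "\<Phi> (munit m 0 0)" by (rule unit_system2) (use mn in simp)
  have "h.a 0 1 \<noteq> 0 \<or> h.b 1 0 \<noteq> 0" using h.a_or_b[of 0 1] h.b_cnj[of 0 1] mn by auto
  thus ?thesis by (simp add: h.a_def h.b_def)
qed

lemma tensor_system_id_ex:
  "\<exists>\<phi>\<^sub>1 \<phi>\<^sub>2. \<phi>\<^sub>1 \<in> {\<lambda>X. X, transpose_mat} \<and> \<phi>\<^sub>2 \<in> {\<lambda>X. X, transpose_mat} \<and>
     tensor_system_id m n N \<iota> (\<lambda>A B. \<Phi> (\<phi>\<^sub>1 A) (\<phi>\<^sub>2 B))"
proof -
  define \<phi>\<^sub>1 :: "complex mat \<Rightarrow> complex mat"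
    where "\<phi>\<^sub>1 = (if \<Phi> (munit m 0 1) (munit n 0 0) $$ (\<iota> 0 0, \<iota> 1 0) \<noteq> 0 then \<lambda>X. X else transpose_mat)"
  define \<phi>\<^sub>2 :: "complex mat \<Rightarrow> complex mat"
    where "\<phi>\<^sub>2 = (if \<Phi> (munit m 0 0) (munit n 0 1) $$ (\<iota> 0 0, \<iota> 0 1) \<noteq> 0 then \<lambda>X. X else transpose_mat)"
  have in1: "\<phi>\<^sub>1 \<in> {\<lambda>X. X, transpose_mat}" and in2: "\<phi>\<^sub>2 \<in> {\<lambda>X. X, transpose_mat}"
    by (auto simp: \<phi>\<^sub>1_def \<phi>\<^sub>2_def)
  have "tensor_system m n N \<iota> (\<lambda>A B. \<Phi> (\<phi>\<^sub>1 A) B)"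
    using transpose_left tensor_system_axioms by (auto simp: \<phi>\<^sub>1_def)
  then interpret T1: tensor_system m n N \<iota> "\<lambda>A B. \<Phi> (\<phi>\<^sub>1 A) B" .
  have "tensor_system m n N \<iota> (\<lambda>A B. \<Phi> (\<phi>\<^sub>1 A) (\<phi>\<^sub>2 B))"
    using T1.transpose_right T1.tensor_system_axioms by (auto simp: \<phi>\<^sub>2_def)
  then interpret T2: tensor_system m n N \<iota> "\<lambda>A B. \<Phi> (\<phi>\<^sub>1 A) (\<phi>\<^sub>2 B)" .
  \<comment> \<open>The two tests do not interfere: each holds the other factor at a diagonal unit,
    which transposition fixes.\<close>
  have t: "\<phi>\<^sub>1 (munit k i i) = munit k i i" "\<phi>\<^sub>2 (munit k i i) = munit k i i" for k i
    by (auto simp: \<phi>\<^sub>1_def \<phi>\<^sub>2_def)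
  have "tensor_system_id m n N \<iota> (\<lambda>A B. \<Phi> (\<phi>\<^sub>1 A) (\<phi>\<^sub>2 B))"
  proof unfold_locales
    show "T2.a1 0 0 1 \<noteq> 0"
      unfolding T2.a1_def t using nonzero_left by (auto simp: \<phi>\<^sub>1_def)
    show "T2.a2 0 0 1 \<noteq> 0"
      unfolding T2.a2_def t using nonzero_right by (auto simp: \<phi>\<^sub>2_def)
  qed
  thus ?thesis using in1 in2 by blast
qed

end

text \<open>On units the image is a conjugation by the diagonal of phases; linearity extends this in
  the first factor and then in the second.\<close>

lemma tensor_system_id_kronecker:
  assumes "tensor_system_id m n (m * n) (\<lambda>i j. i * n + j) \<Phi>"
  obtains D where "unitary_mat (m * n) D"
    "\<And>A B. A \<in> carrier_mat m m \<Longrightarrow> B \<in> carrier_mat n n \<Longrightarrow> \<Phi> A B = D * (A \<otimes>\<^sub>m B) * adj D"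
proof -
  let ?N = "m * n"
  interpret tensor_system_id m n ?N "\<lambda>i j. i * n + j" \<Phi> by fact
  obtain d where d1: "\<And>i j. i < m \<Longrightarrow> j < n \<Longrightarrow> cmod (d i j) = 1"
    and d: "\<And>i k j l r c. i < m \<Longrightarrow> k < m \<Longrightarrow> j < n \<Longrightarrow> l < n \<Longrightarrow> r < ?N \<Longrightarrow> c < ?N \<Longrightarrow>
      \<Phi> (munit m k i) (munit n j l) $$ (r, c) = (if r = k * n + j \<and> c = i * n + l then d k j * cnj (d i l) else 0)"
    using image_diagonal_conj by metis
  define D where "D = dmat ?N (\<lambda>r. d (r div n) (r mod n))"
  have D: "unitary_mat ?N D" unfolding D_def by (rule unitary_dmat) (simp add: d1 div_mod_less)
  note Dc = unitary_matD(1)[OF D]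
  have Da: "adj D = dmat ?N (\<lambda>r. cnj (d (r div n) (r mod n)))" unfolding D_def by (intro eq_matI) auto
  have units: "\<Phi> (munit m k i) (munit n j l) = D * (munit m k i \<otimes>\<^sub>m munit n j l) * adj D"
    if ik: "i < m" "k < m" and jl: "j < n" "l < n" for i k j l
  proof (rule eq_matI)
    have M: "D * munit ?N (k * n + j) (i * n + l) \<in> carrier_mat ?N ?N" using Dc by (rule square_mult_carrier) simp
    fix r c assume "r < dim_row (D * (munit m k i \<otimes>\<^sub>m munit n j l) * adj D)"
      "c < dim_col (D * (munit m k i \<otimes>\<^sub>m munit n j l) * adj D)"
    hence rc: "r < ?N" "c < ?N" using Dc by auto
    show "\<Phi> (munit m k i) (munit n j l) $$ (r, c) = (D * (munit m k i \<otimes>\<^sub>m munit n j l) * adj D) $$ (r, c)"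
      unfolding kronecker_munit[OF ik(2) jl(1) ik(1) jl(2)] Da dmat_mult_index(2)[OF M rc]
      unfolding D_def using ik jl rc d[OF ik jl rc] by (simp add: dmat_mult_index)
  qed (use carrier_matD[OF carr[of k i j l]] Dc in auto)
  have left: "\<Phi> A (munit n j l) = D * (A \<otimes>\<^sub>m munit n j l) * adj D"
    if A: "A \<in> carrier_mat m m" and jl: "j < n" "l < n" for A j l
  proof (rule linear_mm_eqI[OF linear1 _ _ A])
    show "linear_mm m ?N (\<lambda>A. D * (A \<otimes>\<^sub>m munit n j l) * adj D)"
      by (intro linear_mm_conj linear_mm_kronecker Dc adj_carrier munit_carrier)
  qed (use units jl in auto)
  have "\<Phi> A B = D * (A \<otimes>\<^sub>m B) * adj D" if A: "A \<in> carrier_mat m m" and B: "B \<in> carrier_mat n n" for A B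
  proof (rule linear_mm_eqI[OF linear2[OF A] _ _ B])
    show "linear_mm n ?N (\<lambda>B. D * (A \<otimes>\<^sub>m B) * adj D)"
      using A by (intro linear_mm_conj linear_mm_kronecker Dc adj_carrier)
  qed (use left A in auto)
  thus ?thesis using that D by blast
qed

context tensor_isometry
begin

theorem factorization:
  obtains U V \<phi>\<^sub>1 \<phi>\<^sub>2 where "unitary_mat (m * n) U" "unitary_mat (m * n) V"
    "\<phi>\<^sub>1 \<in> {\<lambda>X. X, transpose_mat}" "\<phi>\<^sub>2 \<in> {\<lambda>X. X, transpose_mat}"
    "\<And>A B. A \<in> carrier_mat m m \<Longrightarrow> B \<in> carrier_mat n n \<Longrightarrow>
      \<phi> (A \<otimes>\<^sub>m B) = U * (\<phi>\<^sub>1 A \<otimes>\<^sub>m \<phi>\<^sub>2 B) * V"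
proof -
  let ?N = "m * n"
  obtain U V where U: "unitary_mat ?N U" and V: "unitary_mat ?N V"
    and T: "tensor_system m n ?N (\<lambda>i j. i * n + j) (\<lambda>A B. U * \<phi> (A \<otimes>\<^sub>m B) * V)"
    by (rule normalization)
  obtain \<phi>\<^sub>1 \<phi>\<^sub>2 where \<phi>: "\<phi>\<^sub>1 \<in> {\<lambda>X. X, transpose_mat}" "\<phi>\<^sub>2 \<in> {\<lambda>X. X, transpose_mat}"
    and T': "tensor_system_id m n ?N (\<lambda>i j. i * n + j) (\<lambda>A B. U * \<phi> (\<phi>\<^sub>1 A \<otimes>\<^sub>m \<phi>\<^sub>2 B) * V)"
    using tensor_system.tensor_system_id_ex[OF T] by blast
  obtain D where D: "unitary_mat ?N D"
    and eq: "\<And>A B. A \<in> carrier_mat m m \<Longrightarrow> B \<in> carrier_mat n n \<Longrightarrow>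
      U * \<phi> (\<phi>\<^sub>1 A \<otimes>\<^sub>m \<phi>\<^sub>2 B) * V = D * (A \<otimes>\<^sub>m B) * adj D"
    using tensor_system_id_kronecker[OF T'] by blast
  have carrier: "\<phi>\<^sub>1 A \<in> carrier_mat k k" "\<phi>\<^sub>2 A \<in> carrier_mat k k" if "A \<in> carrier_mat k k" for A k
    using \<phi> that by auto
  have invol: "\<phi>\<^sub>1 (\<phi>\<^sub>1 A) = A" "\<phi>\<^sub>2 (\<phi>\<^sub>2 A) = A" for A using \<phi> by auto
  have "\<phi> (A \<otimes>\<^sub>m B) = (adj U * D) * (\<phi>\<^sub>1 A \<otimes>\<^sub>m \<phi>\<^sub>2 B) * (adj D * adj V)"
    if A: "A \<in> carrier_mat m m" and B: "B \<in> carrier_mat n n" for A B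
  proof -
    have X: "\<phi> (A \<otimes>\<^sub>m B) \<in> carrier_mat ?N ?N" using A B by (intro linear_mmD(1)[OF linear]) auto
    have K: "\<phi>\<^sub>1 A \<otimes>\<^sub>m \<phi>\<^sub>2 B \<in> carrier_mat ?N ?N" using carrier A B by auto
    have "\<phi> (A \<otimes>\<^sub>m B) = adj U * (U * \<phi> (A \<otimes>\<^sub>m B) * V) * adj V"
      using unitary_conj_inverse(2)[OF U unitary_adj[OF V] X] by simp
    \<comment> \<open>\<open>\<phi>\<^sub>1\<close> and \<open>\<phi>\<^sub>2\<close> are
      involutions, so evaluation at the transformed factors moves them to the other side.\<close>
    also have "U * \<phi> (A \<otimes>\<^sub>m B) * V = D * (\<phi>\<^sub>1 A \<otimes>\<^sub>m \<phi>\<^sub>2 B) * adj D"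
      using eq[of "\<phi>\<^sub>1 A" "\<phi>\<^sub>2 B"] carrier A B by (simp add: invol)
    also have "adj U * (D * (\<phi>\<^sub>1 A \<otimes>\<^sub>m \<phi>\<^sub>2 B) * adj D) * adj V = (adj U * D) * (\<phi>\<^sub>1 A \<otimes>\<^sub>m \<phi>\<^sub>2 B) * (adj D * adj V)"
      using unitary_matD(1)[OF U] unitary_matD(1)[OF V] unitary_matD(1)[OF D] K
      by (simp add: square_simps[where n = ?N])
    finally show ?thesis .
  qed
  thus ?thesis
    by (rule that[OF unitary_mult[OF unitary_adj[OF U] D] unitary_mult[OF unitary_adj[OF D] unitary_adj[OF V]] \<phi>])
qed

end

theorem theorem2p9:
  fixes m n :: nat and p :: real and \<phi> :: "complex mat \<Rightarrow> complex mat"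
  assumes "m \<ge> 2" and "n \<ge> 2"
    and "1 \<le> p" and "p \<noteq> 2"
    and "linear_map_mat (m * n) \<phi>"
  shows "(\<forall>A \<in> carrier_mat m m. \<forall>B \<in> carrier_mat n n.
            schatten_norm p (\<phi> (A \<otimes>\<^sub>m B)) = schatten_norm p (A \<otimes>\<^sub>m B))
    \<longleftrightarrow>
         (\<exists>U V \<phi>\<^sub>1 \<phi>\<^sub>2. unitary_mat (m * n) U \<and> unitary_mat (m * n) V \<and>
            \<phi>\<^sub>1 \<in> {\<lambda>X. X, transpose_mat} \<and> \<phi>\<^sub>2 \<in> {\<lambda>X. X, transpose_mat} \<and>
            (\<forall>A \<in> carrier_mat m m. \<forall>B \<in> carrier_mat n n.
               \<phi> (A \<otimes>\<^sub>m B) = U * (\<phi>\<^sub>1 A \<otimes>\<^sub>m \<phi>\<^sub>2 B) * V))"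
  (is "?iso \<longleftrightarrow> ?form")
proof
  let ?N = "m * n"
  have p: "p > 0" using assms by simp
  have lin: "linear_mm ?N ?N \<phi>" using assms(5) unfolding linear_map_mat_iff linear_mm_def .
  show ?form if ?iso
  proof -
    have "tensor_isometry m n p \<phi>"
      using assms p lin that by unfold_locales (auto simp: schatten_norm_eq_iff)
    thus ?form by (rule tensor_isometry.factorization) metis
  qed
  show ?iso if form: ?form
  proof (intro ballI)
    obtain U V \<phi>\<^sub>1 \<phi>\<^sub>2 where U: "unitary_mat ?N U" and V: "unitary_mat ?N V"
      and \<phi>: "\<phi>\<^sub>1 \<in> {\<lambda>X. X, transpose_mat}" "\<phi>\<^sub>2 \<in> {\<lambda>X. X, transpose_mat}"
      and eq: "\<forall>A \<in> carrier_mat m m. \<forall>B \<in> carrier_mat n n. \<phi> (A \<otimes>\<^sub>m B) = U * (\<phi>\<^sub>1 A \<otimes>\<^sub>m \<phi>\<^sub>2 B) * V"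
      using form by (elim exE conjE) (rule that; assumption)
    fix A B :: "complex mat" assume A: "A \<in> carrier_mat m m" and B: "B \<in> carrier_mat n n"
    have K: "\<phi>\<^sub>1 A \<otimes>\<^sub>m \<phi>\<^sub>2 B \<in> carrier_mat ?N ?N" using \<phi> A B by auto
    show "schatten_norm p (\<phi> (A \<otimes>\<^sub>m B)) = schatten_norm p (A \<otimes>\<^sub>m B)"
      unfolding schatten_norm_eq_iff[OF p] eq[rule_format, OF A B] spec_sum_unitary[OF U V K]
      by (rule spec_sum_kronecker_transpose[OF A B \<phi>])
  qed
qed

end
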